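(* Let $p\in(1,\infty)$. For each $n$ let $X^{(n,p)}$ be uniformly distributed on the unit $\ell^p$ ball $\mathbb{B}_{n,p}$ of $\mathbb{R}^n$, let $\iota^{(n)}:=\frac1{\sqrt n}(1,1,\dots,1)\in\mathbb{R}^n$, and set $$W^{(n,p)}_\iota:=\frac{n^{1/p}}{n^{1/2}}\sum_{i=1}^nX^{(n,p)}_i\,\iota^{(n)}_i .$$ Then the sequence $(W^{(n,p)}_\iota)_{n\in\mathbb{N}}$ satisfies a large deviation principle (with speed $n$) with the quasiconvex, symmetric, good rate function $\mathbb{I}^{\mathsf{cr}}_p$. Moreover, for $w\in(-1,1)$: 1. for $p>2$, $\mathbb{I}^{\mathsf{qu}}_{p,\mu_2}(w)\ge\mathbb{I}^{\mathsf{cr}}_p(w)$, with equality if and only if $w=0$; 2. for $p=2$, $\mathbb{I}^{\mathsf{qu}}_{p,\mu_2}(w)=\mathbb{I}^{\mathsf{cr}}_p(w)$; 3. for $p<2$, $\mathbb{I}^{\mathsf{qu}}_{p,\mu_2}(w)\le\mathbb{I}^{\mathsf{cr}}_p(w)$, with equality if and only if $w=0$.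
   Context: $\mathbb{B}_{n,p}=\{x\in\mathbb{R}^n:\sum_{i=1}^n|x_i|^p\le 1\}$. $\mu_p$ is the probability measure on $\mathbb{R}$ with density $f_p(y)=\frac{1}{2p^{1/p}\Gamma(1+1/p)}e^{-|y|^p/p}$; $\mu_2$ is standard Gaussian. Legendre transform: $\Lambda^*(\tau)=\sup_t\{\langle t,\tau\rangle-\Lambda(t)\}$. Define, for a probability measure $\nu$ on $\mathbb{R}$ and $t_1,t_2,w\in\mathbb{R}$, $$\Lambda_p(t_1,t_2)=\log\int_{\mathbb{R}}e^{t_1y+t_2|y|^p}\mu_p(dy),\qquad\Psi_{p,\nu}(t_1,t_2)=\int_{\mathbb{R}}\Lambda_p(t_1u,t_2)\nu(du),$$ $$\mathbb{I}^{\mathsf{cr}}_p(w)=\inf_{\tau_1\in\mathbb{R},\,\tau_2>0:\ \tau_1\tau_2^{-1/p}=w}\Lambda_p^*(\tau_1,\tau_2),\qquad \mathbb{I}^{\mathsf{qu}}_{p,\nu}(w)=\inf_{\tau_1\in\mathbb{R},\,\tau_2>0:\ \tau_1\tau_2^{-1/p}=w}\Psi_{p,\nu}^*(\tau_1,\tau_2).$$ Large deviation principle (LDP): a sequence $(\xi_n)$ of random variables in a topological space $\Sigma$ satisfies an LDP with speed $s(n)$ and rate function $I:\Sigma\to[0,\infty]$ if $I$ is lower semi-continuous and for all Borel $\Gamma\subset\Sigma$, $-\inf_{\Gamma^\circ}I\le\liminf_n\frac{1}{s(n)}\log\mathbb{P}(\xi_n\in\Gamma^\circ)\le\limsup_n\frac1{s(n)}\log\mathbb{P}(\xi_n\in\bar\Gamma)\le-\inf_{\bar\Gamma}I$.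 $I$ is good if its level sets $\{I\le c\}$ are compact. A function $f:\mathbb{R}\to(-\infty,\infty]$ is quasiconvex if $\{f\le c\}$ is convex for all $c\in\mathbb{R}$, and symmetric if $f(-w)=f(w)$. *)

theory Defs
  imports "HOL-Probability.Probability"
begin

text \<open>The logarithm $[0,\infty] \to [-\infty,\infty]$, with $\log 0 = -\infty$ and
  $\log \infty = \infty$.\<close>

definition elog :: "ennreal \<Rightarrow> ereal" where
  "elog x = (if x = 0 then - \<infinity> else if x = \<infinity> then \<infinity> else ereal (ln (enn2real x)))"

text \<open>The integral of an extended-real function, positive part minus negative part
  (\<^const>\<open>e2ennreal\<close> sends negative arguments to 0). If both parts are infinite the
  value is $\infty$, by the convention $\infty - \infty = \infty$ of \<^typ>\<open>ereal\<close>.\<close>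

definition ext_integral :: "'a measure \<Rightarrow> ('a \<Rightarrow> ereal) \<Rightarrow> ereal" where
  "ext_integral M f =
     enn2ereal (\<integral>\<^sup>+ x. e2ennreal (f x) \<partial>M) - enn2ereal (\<integral>\<^sup>+ x. e2ennreal (- f x) \<partial>M)"

definition legendre :: "('a::real_inner \<Rightarrow> ereal) \<Rightarrow> 'a \<Rightarrow> ereal" where
  "legendre L \<tau> = (SUP t. ereal (t \<bullet> \<tau>) - L t)"


section \<open>Large deviation principles\<close>

definition lower_semicont :: "('a::topological_space \<Rightarrow> ereal) \<Rightarrow> bool" where
  "lower_semicont I \<longleftrightarrow> (\<forall>c::ereal. closed {x. I x \<le> c})"

definition rate_function :: "('a::topological_space \<Rightarrow> ereal) \<Rightarrow> bool" where
  "rate_function I \<longleftrightarrow> (\<forall>x. 0 \<le> I x) \<and> lower_semicont I"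

definition good_rate_function :: "('a::topological_space \<Rightarrow> ereal) \<Rightarrow> bool" where
  "good_rate_function I \<longleftrightarrow> rate_function I \<and> (\<forall>c::real. compact {x. I x \<le> ereal c})"

definition quasiconvex :: "(real \<Rightarrow> ereal) \<Rightarrow> bool" where
  "quasiconvex f \<longleftrightarrow> (\<forall>w. f w \<noteq> - \<infinity>) \<and> (\<forall>c::real. convex {w. f w \<le> ereal c})"

definition symmetric_fun :: "(real \<Rightarrow> ereal) \<Rightarrow> bool" where
  "symmetric_fun f \<longleftrightarrow> (\<forall>w. f (- w) = f w)"

text \<open>Sequences are indexed by $n \ge 1$, and the \<open>n\<close>-th random variable \<open>\<xi> n\<close> may live
  on its own probability space \<open>M n\<close>; the values at \<open>n = 0\<close> are irrelevant.\<close>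

definition satisfies_LDP ::
  "(nat \<Rightarrow> 'w measure) \<Rightarrow> (nat \<Rightarrow> 'w \<Rightarrow> 'a::topological_space) \<Rightarrow> (nat \<Rightarrow> real) \<Rightarrow> ('a \<Rightarrow> ereal) \<Rightarrow> bool"
where
  "satisfies_LDP M \<xi> s I \<longleftrightarrow>
     (\<forall>n\<ge>1. prob_space (M n) \<and> \<xi> n \<in> borel_measurable (M n)) \<and>
     rate_function I \<and>
     (\<forall>\<Gamma> \<in> sets borel.
        - (INF x\<in>interior \<Gamma>. I x)
            \<le> liminf (\<lambda>n. ereal (1 / s n) *
                 elog (emeasure (M n) {\<omega> \<in> space (M n). \<xi> n \<omega> \<in> interior \<Gamma>})) \<and>
        liminf (\<lambda>n. ereal (1 / s n) *
                 elog (emeasure (M n) {\<omega> \<in> space (M n). \<xi> n \<omega> \<in> interior \<Gamma>}))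
            \<le> limsup (\<lambda>n. ereal (1 / s n) *
                 elog (emeasure (M n) {\<omega> \<in> space (M n). \<xi> n \<omega> \<in> closure \<Gamma>})) \<and>
        limsup (\<lambda>n. ereal (1 / s n) *
                 elog (emeasure (M n) {\<omega> \<in> space (M n). \<xi> n \<omega> \<in> closure \<Gamma>}))
            \<le> - (INF x\<in>closure \<Gamma>. I x))"


section \<open>Uniform distribution on the unit lp ball\<close>

text \<open>Since the dimension \<open>n\<close> varies, $\mathbb{R}^n$ is represented by the product space
  $\prod_{i=1}^n \mathbb{R}$ of extensional functions on \<open>{1..n}\<close>, with Lebesgue measure.\<close>

abbreviation lborel_Rn :: "nat \<Rightarrow> (nat \<Rightarrow> real) measure" where
  "lborel_Rn n \<equiv> (\<Pi>\<^sub>M i\<in>{1..n}. lborel)"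

definition lp_ball :: "nat \<Rightarrow> real \<Rightarrow> (nat \<Rightarrow> real) set" where
  "lp_ball n p = {x \<in> space (lborel_Rn n). (\<Sum>i=1..n. \<bar>x i\<bar> powr p) \<le> 1}"

definition uniform_on_lp_ball :: "'w measure \<Rightarrow> ('w \<Rightarrow> nat \<Rightarrow> real) \<Rightarrow> nat \<Rightarrow> real \<Rightarrow> bool" where
  "uniform_on_lp_ball M X n p \<longleftrightarrow>
     X \<in> M \<rightarrow>\<^sub>M lborel_Rn n \<and>
     distr M (lborel_Rn n) X = uniform_measure (lborel_Rn n) (lp_ball n p)"

definition iota_dir :: "nat \<Rightarrow> nat \<Rightarrow> real" where
  "iota_dir n = (\<lambda>i. 1 / sqrt (real n))"

definition scaled_proj :: "real \<Rightarrow> nat \<Rightarrow> (nat \<Rightarrow> real) \<Rightarrow> (nat \<Rightarrow> real) \<Rightarrow> real" where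
  "scaled_proj p n \<theta> x =
     (real n powr (1 / p) / real n powr (1 / 2)) * (\<Sum>i=1..n. x i * \<theta> i)"


section \<open>The rate functions\<close>

text \<open>For \<open>p = 2\<close> this is the density of the standard Gaussian, as
  $2 \cdot 2^{1/2}\,\Gamma(3/2) = \sqrt{2\pi}$.\<close>

definition gen_gauss_density :: "real \<Rightarrow> real \<Rightarrow> real" where
  "gen_gauss_density p y =
     1 / (2 * p powr (1 / p) * Gamma (1 + 1 / p)) * exp (- (\<bar>y\<bar> powr p) / p)"

definition mu :: "real \<Rightarrow> real measure" where
  "mu p = density lborel (\<lambda>y. ennreal (gen_gauss_density p y))"

definition Lambda :: "real \<Rightarrow> real \<times> real \<Rightarrow> ereal" where
  "Lambda p = (\<lambda>(t1, t2). elog (\<integral>\<^sup>+ y. ennreal (exp (t1 * y + t2 * \<bar>y\<bar> powr p)) \<partial>mu p))"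

definition Psi :: "real \<Rightarrow> real measure \<Rightarrow> real \<times> real \<Rightarrow> ereal" where
  "Psi p \<nu> = (\<lambda>(t1, t2). ext_integral \<nu> (\<lambda>u. Lambda p (t1 * u, t2)))"

definition I_cr :: "real \<Rightarrow> real \<Rightarrow> ereal" where
  "I_cr p w = (INF \<tau> \<in> {(\<tau>1, \<tau>2). \<tau>2 > 0 \<and> \<tau>1 * \<tau>2 powr (- 1 / p) = w}. legendre (Lambda p) \<tau>)"

definition I_qu :: "real \<Rightarrow> real measure \<Rightarrow> real \<Rightarrow> ereal" where
  "I_qu p \<nu> w = (INF \<tau> \<in> {(\<tau>1, \<tau>2). \<tau>2 > 0 \<and> \<tau>1 * \<tau>2 powr (- 1 / p) = w}. legendre (Psi p \<nu>) \<tau>)"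

end

theory Submission
  imports Defs
begin

text \<open>Write \<open>Z(t, s) = \<integral> exp (t y - s \<bar>y\<bar>\<^sup>p) dy\<close>. The scaling relation
  \<open>Z(a t, a\<^sup>p s) = Z(t, s) / a\<close> shows that the infimum over \<open>\<tau>\<close> defining either rate function is
  attained at \<open>\<tau>\<^sub>2 = 1\<close>, so that both are of the form
  \<open>sup {t w - s - \<Phi>(t, s) + const | s > 0}\<close>, with \<open>\<Phi> = ln Z\<close> for \<^const>\<open>I_cr\<close> and with
  \<open>\<Phi>(t, s) = E (ln Z(t U, s))\<close>, \<open>U\<close> standard Gaussian, for \<^const>\<open>I_qu\<close>.

  The large deviation bounds compare volumes of slices of the ball directly, without the
  probabilistic representation of the uniform distribution. The upper bound is Chernoff's. For the
  lower bound the Lebesgue measure is tilted by the maximiser \<open>(t, s)\<close> of the supremum, whose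
  first-order conditions say that \<open>y\<close> and \<open>\<bar>y\<bar>\<^sup>p\<close> have tilted means \<open>w\<close> and \<open>1\<close>; a contraction by a
  factor slightly below 1 then moves the typical points into the ball.

  For the comparison, \<open>x \<mapsto> ln Z(\<surd>x, s)\<close> is strictly concave for \<open>p > 2\<close>, affine for \<open>p = 2\<close> and
  strictly convex for \<open>p < 2\<close>, so that Jensen's inequality with \<open>E U\<^sup>2 = 1\<close> compares the two functions
  \<open>\<Phi>\<close>. Indeed, after an integration by parts the reciprocal of its derivative is, up to a constant,
  the mean of \<open>y\<^sup>p\<^sup>-\<^sup>2\<close> under the density proportional to \<open>y sinh (t y) exp (- s y\<^sup>p)\<close> on the half-line,
  and \<open>sinh (t' y) / sinh (t y)\<close> increases in \<open>y\<close> when \<open>t < t'\<close>.\<close>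


section \<open>The partition function\<close>


text \<open>Both rates carry the constant \<open>1/p + ln Z(0, 1/p)\<close>, which is also the
  exponential growth rate of the volume of the ball once the factor \<open>n powr (-1/p)\<close> per
  coordinate is split off. The reason is that at \<open>w = 0\<close> the supremum is attained at
  \<open>(0, 1/p)\<close>, so the central slices already have the volume of the whole ball to
  exponential order and no exact volume formula enters. Since the tilted mean of
  \<open>\<bar>y\<bar> powr p\<close> is exactly 1, the tilted measure concentrates near the
  boundary of the ball and not inside it; this is what forces the contraction. Maximisers are
  constructed for \<open>\<bar>w\<bar> < 1\<close> only; the endpoints are reached from inside,
  along segments to 0, where the rate vanishes. Strictness is not handled symmetrically in
  \<open>p\<close>. For \<open>p > 2\<close> the maximiser for \<open>ln Z\<close> is a test point
  for the other supremum. For \<open>p < 2\<close> equality would turn a maximiser for the Gaussian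
  average into one for \<open>ln Z\<close>, so that only \<open>ln Z\<close> ever has to be
  differentiated.\<close>

lemma nn_integral_exp_tail:
  fixes a :: real
  shows "(\<integral>\<^sup>+ t. indicator {a..} t * ennreal (exp (- t)) \<partial>lborel) = ennreal (exp (- a))"
proof -
  have "(\<integral>\<^sup>+ t. ennreal (exp (- t)) * indicator {a..} t \<partial>lborel) = ennreal (0 - (- exp (- a)))"
  proof (rule nn_integral_FTC_atLeast)
    show "((\<lambda>t::real. - exp (- t)) \<longlongrightarrow> 0) at_top"
      using tendsto_minus[OF filterlim_compose[OF exp_at_bot filterlim_uminus_at_bot_at_top]] by simp
  qed (auto intro!: derivative_eq_intros)
  then show ?thesis by (simp add: mult.commute)
qed

text \<open>Layer-cake argument: \<open>exp (- a)\<close> is the integral of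
  \<open>exp (- t)\<close> over \<open>t \<ge> a\<close>, Tonelli exchanges the two integrals, and
  the inner one becomes the length of the interval
  \<open>\<bar>y\<bar> \<le> (p * t) powr (1/p)\<close>. What remains is Euler's integral for
  \<open>Gamma (1 + 1/p)\<close>.\<close>

lemma nn_integral_gen_gauss:
  fixes p :: real
  assumes "p > 0"
  shows "(\<integral>\<^sup>+ y. ennreal (exp (- (\<bar>y\<bar> powr p) / p)) \<partial>lborel)
    = ennreal (2 * p powr (1/p) * Gamma (1 + 1/p))"
proof -
  have "(\<integral>\<^sup>+ y. ennreal (exp (- (\<bar>y\<bar> powr p) / p)) \<partial>lborel)
     = (\<integral>\<^sup>+ y. (\<integral>\<^sup>+ t. indicator {\<bar>y\<bar> powr p / p..} t * ennreal (exp (- t)) \<partial>lborel) \<partial>lborel)"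
    by (simp add: nn_integral_exp_tail)
  also have "\<dots> = (\<integral>\<^sup>+ y. (\<integral>\<^sup>+ t. (if \<bar>y\<bar> powr p / p \<le> t then ennreal (exp (- t)) else 0) \<partial>lborel) \<partial>lborel)"
    by (intro nn_integral_cong) (auto simp: indicator_def)
  also have "\<dots> = (\<integral>\<^sup>+ t. (\<integral>\<^sup>+ y. (if \<bar>y\<bar> powr p / p \<le> t then ennreal (exp (- t)) else 0) \<partial>lborel) \<partial>lborel)"
    by (rule lborel_pair.Fubini'[symmetric]) (simp add: split_beta', measurable)
  also have "\<dots> = (\<integral>\<^sup>+ t. indicator {0..} t * ennreal (2 * p powr (1/p) * (t powr (1 + 1/p - 1) / exp t)) \<partial>lborel)"
  proof (intro nn_integral_cong)
    fix t :: real
    show "(\<integral>\<^sup>+ y. (if \<bar>y\<bar> powr p / p \<le> t then ennreal (exp (- t)) else 0) \<partial>lborel)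
      = indicator {0..} t * ennreal (2 * p powr (1/p) * (t powr (1 + 1/p - 1) / exp t))"
    proof (cases "t \<ge> 0")
      case False
      have "\<not> \<bar>y\<bar> powr p / p \<le> t" for y :: real
        using False assms divide_nonneg_pos[of "\<bar>y\<bar> powr p" p] by (smt (verit) powr_ge_zero)
      then show ?thesis using False by simp
    next
      case True
      have eq: "\<bar>y\<bar> powr p / p \<le> t \<longleftrightarrow> \<bar>y\<bar> \<le> (p * t) powr (1/p)" for y :: real
      proof -
        have "\<bar>y\<bar> powr p / p \<le> t \<longleftrightarrow> \<bar>y\<bar> powr p \<le> p * t" using assms by (simp add: field_simps)
        also have "p * t = ((p * t) powr (1/p)) powr p" using assms True by (simp add: powr_powr)
        also have "\<bar>y\<bar> powr p \<le> ((p * t) powr (1/p)) powr p \<longleftrightarrow> \<bar>y\<bar> \<le> (p * t) powr (1/p)"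
          using assms powr_mono2[of p "\<bar>y\<bar>" "(p * t) powr (1/p)"]
            powr_less_mono2[of p "(p * t) powr (1/p)" "\<bar>y\<bar>"] by (metis abs_ge_zero less_le_not_le linorder_not_less powr_ge_zero)
        finally show ?thesis .
      qed
      have "(\<integral>\<^sup>+ y. (if \<bar>y\<bar> powr p / p \<le> t then ennreal (exp (- t)) else 0) \<partial>lborel)
        = (\<integral>\<^sup>+ y. ennreal (exp (- t)) * indicator {- ((p * t) powr (1/p)) .. (p * t) powr (1/p)} y \<partial>lborel)"
        by (intro nn_integral_cong) (auto simp: eq indicator_def abs_le_iff)
      also have "\<dots> = ennreal (exp (- t)) * ennreal (2 * (p * t) powr (1/p))"
        by (simp add: nn_integral_cmult)
      also have "\<dots> = ennreal (2 * p powr (1/p) * (t powr (1 + 1/p - 1) / exp t))"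
        using assms True by (simp add: ennreal_mult[symmetric] powr_mult exp_minus field_simps)
      finally show ?thesis using True by simp
    qed
  qed
  also have "\<dots> = (\<integral>\<^sup>+ t. ennreal (if t \<in> {0..} then 2 * p powr (1/p) * (t powr (1 + 1/p - 1) / exp t) else 0) \<partial>lborel)"
    by (intro nn_integral_cong) (auto simp: indicator_def)
  also have "\<dots> = ennreal (2 * p powr (1/p) * Gamma (1 + 1/p))"
  proof (rule nn_integral_has_integral_lborel)
    show "((\<lambda>t. if t \<in> {0..} then 2 * p powr (1/p) * (t powr (1 + 1/p - 1) / exp t) else 0)
        has_integral 2 * p powr (1/p) * Gamma (1 + 1/p)) UNIV"
      unfolding has_integral_restrict_UNIV
      using assms by (intro has_integral_mult_right Gamma_integral_real) (simp add: add_pos_pos)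
  qed (auto)
  finally show ?thesis .
qed

section \<open>Exponential tilts: integrability, scaling and normalisation\<close>

text \<open>The parameter \<open>s\<close> stands for \<open>1/p - t2\<close> in
  \<open>Lambda p (t1, t2)\<close>: the density of \<open>mu p\<close> is absorbed into the
  exponent, and finiteness of \<open>Lambda\<close> becomes \<open>s > 0\<close>.\<close>

definition tilt :: "real \<Rightarrow> real \<Rightarrow> real \<Rightarrow> real \<Rightarrow> real" where
  "tilt p t s y = exp (t * y - s * \<bar>y\<bar> powr p)"

definition Zf :: "real \<Rightarrow> real \<Rightarrow> real \<Rightarrow> real" where
  "Zf p t s = (\<integral>y. tilt p t s y \<partial>lborel)"

lemma tilt_measurable [measurable]: "tilt p t s \<in> borel_measurable borel"
  unfolding tilt_def by measurable

lemma tilt_pos [simp]: "tilt p t s y > 0" and tilt_nonneg [simp]: "tilt p t s y \<ge> 0"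
  by (auto simp: tilt_def)

lemma tilt_mult_exp: "tilt p t s y * exp (a * y) = tilt p (t + a) s y"
  by (simp add: tilt_def exp_add[symmetric] algebra_simps)

lemma tilt_mult_exp': "tilt p t s y * exp (a * \<bar>y\<bar> powr p) = tilt p t (s - a) y"
  by (simp add: tilt_def exp_add[symmetric] algebra_simps)

lemma tilt_minus: "tilt p t s (- y) = tilt p (- t) s y"
  by (simp add: tilt_def)

lemma tilt_scale:
  assumes "a > 0"
  shows "tilt p t s (a * y) = tilt p (a * t) (a powr p * s) y"
  using assms by (simp add: tilt_def abs_mult powr_mult algebra_simps)

lemma nn_integral_tilt_scale:
  assumes "a > 0"
  shows "(\<integral>\<^sup>+ y. ennreal (tilt p t s y) \<partial>lborel) = a * (\<integral>\<^sup>+ y. ennreal (tilt p (a * t) (a powr p * s) y) \<partial>lborel)"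
  using assms
  by (subst nn_integral_real_affine[where c = a and t = 0]) (auto simp: tilt_scale)

lemma nn_integral_tilt_0_finite:
  assumes "p > 0" "s > 0"
  shows "(\<integral>\<^sup>+ y. ennreal (tilt p 0 s y) \<partial>lborel) < \<infinity>"
proof -
  \<comment> \<open>The dilation that carries \<open>s\<close> to \<open>1/p\<close>, where the
    integral is known exactly.\<close>
  define a where "a = (1 / (p * s)) powr (1 / p)"
  have a: "a > 0" "a powr p * s = 1 / p"
    using assms by (auto simp: a_def powr_powr)
  have "(\<integral>\<^sup>+ y. ennreal (tilt p 0 s y) \<partial>lborel) = a * (\<integral>\<^sup>+ y. ennreal (exp (- (\<bar>y\<bar> powr p) / p)) \<partial>lborel)"
    using nn_integral_tilt_scale[OF a(1), of p 0 s] a(2) by (simp add: tilt_def)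
  also have "\<dots> < \<infinity>"
    by (subst nn_integral_gen_gauss[OF assms(1)]) (simp add: ennreal_mult_less_top)
  finally show ?thesis .
qed

text \<open>A Young inequality with a crude constant. If
  \<open>\<bar>t\<bar> \<le> s * \<bar>y\<bar> powr (p - 1)\<close>, the first term on the right
  suffices; otherwise \<open>\<bar>y\<bar>\<close> is at most
  \<open>b = (\<bar>t\<bar> / s) powr (1 / (p - 1))\<close>, and \<open>\<bar>t\<bar> * b\<close> is
  the second term.\<close>

lemma mult_le_powr:
  fixes y s t p :: real
  assumes "p > 1" "s > 0"
  shows "t * y \<le> s * \<bar>y\<bar> powr p + s * (\<bar>t\<bar> / s) powr (p / (p - 1))"
proof (cases "\<bar>t\<bar> \<le> s * \<bar>y\<bar> powr (p - 1)")
  case True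
  have "t * y \<le> \<bar>t\<bar> * \<bar>y\<bar>" by (metis abs_ge_self abs_mult)
  also have "\<dots> \<le> s * \<bar>y\<bar> powr (p - 1) * \<bar>y\<bar>" using True by (intro mult_right_mono) auto
  also have "\<dots> = s * \<bar>y\<bar> powr p"
    using powr_mult_base[of "\<bar>y\<bar>" "p - 1"] by (simp add: mult_ac)
  finally show ?thesis using assms by (smt (verit) mult_nonneg_nonneg powr_ge_zero)
next
  case False
  define b where "b = (\<bar>t\<bar> / s) powr (1 / (p - 1))"
  have "\<bar>y\<bar> powr (p - 1) < \<bar>t\<bar> / s" using False assms by (simp add: field_simps)
  then have "(\<bar>y\<bar> powr (p - 1)) powr (1 / (p - 1)) \<le> b"
    unfolding b_def using assms by (intro powr_mono2) auto
  then have yb: "\<bar>y\<bar> \<le> b" using assms by (simp add: powr_powr)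
  have "t * y \<le> \<bar>t\<bar> * \<bar>y\<bar>" by (metis abs_ge_self abs_mult)
  also have "\<dots> \<le> \<bar>t\<bar> * b" using yb by (intro mult_left_mono) auto
  also have "\<dots> = s * ((\<bar>t\<bar> / s) * (\<bar>t\<bar> / s) powr (1 / (p - 1)))" using assms by (simp add: b_def)
  also have "(\<bar>t\<bar> / s) * (\<bar>t\<bar> / s) powr (1 / (p - 1)) = (\<bar>t\<bar> / s) powr (1 + 1 / (p - 1))"
    using assms by (intro powr_mult_base) simp
  also have "1 + 1 / (p - 1) = p / (p - 1)" using assms by (simp add: field_simps)
  finally show ?thesis using assms by (smt (verit) mult_nonneg_nonneg powr_ge_zero)
qed

text \<open>Half of the decay absorbs the linear term, the other half is kept for
  integrability.\<close>

lemma tilt_le: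
  assumes "p > 1" "s > 0"
  shows "tilt p t s y \<le> exp (s/2 * (2 * \<bar>t\<bar> / s) powr (p / (p - 1))) * tilt p 0 (s/2) y"
  using mult_le_powr[of p "s/2" t y] assms by (simp add: tilt_def exp_add[symmetric] algebra_simps)

lemma tilt_integrable:
  assumes "p > 1" "s > 0"
  shows "integrable lborel (tilt p t s)"
proof -
  have "integrable lborel (tilt p 0 (s/2))"
    using nn_integral_tilt_0_finite[of p "s/2"] assms by (intro integrableI_nonneg) auto
  then have "integrable lborel (\<lambda>y. exp (s/2 * (2 * \<bar>t\<bar> / s) powr (p / (p - 1))) * tilt p 0 (s/2) y)"
    by simp
  then show ?thesis
    by (rule Bochner_Integration.integrable_bound) (use tilt_le[OF assms] in auto)
qed

lemma nn_integral_tilt: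
  assumes "p > 1" "s > 0"
  shows "(\<integral>\<^sup>+ y. ennreal (tilt p t s y) \<partial>lborel) = ennreal (Zf p t s)"
  using tilt_integrable[OF assms] by (simp add: Zf_def nn_integral_eq_integral)

lemma Zf_pos:
  assumes "p > 1" "s > 0"
  shows "Zf p t s > 0"
proof -
  have "Zf p t s \<noteq> 0"
    unfolding Zf_def using tilt_integrable[OF assms, of t]
    by (subst integral_nonneg_eq_0_iff_AE) (auto simp: tilt_def eventually_False ae_filter_eq_bot_iff)
  moreover have "Zf p t s \<ge> 0" unfolding Zf_def by (intro Bochner_Integration.integral_nonneg) auto
  ultimately show ?thesis by linarith
qed

text \<open>Lets \<open>ln (Zf p t s)\<close> grow at most like
  \<open>\<bar>t\<bar> powr (p / (p - 1))\<close>, which a Gaussian average tolerates.\<close>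

lemma Zf_le:
  assumes "p > 1" "s > 0"
  shows "Zf p t s \<le> exp (s/2 * (2 * \<bar>t\<bar> / s) powr (p / (p - 1))) * Zf p 0 (s/2)"
proof -
  have "Zf p t s \<le> (\<integral>y. exp (s/2 * (2 * \<bar>t\<bar> / s) powr (p / (p - 1))) * tilt p 0 (s/2) y \<partial>lborel)"
    unfolding Zf_def using assms by (intro integral_mono tilt_integrable tilt_le integrable_mult_right) auto
  then show ?thesis by (simp add: Zf_def)
qed

lemma Zf_scale:
  assumes "a > 0"
  shows "Zf p (a * t) (a powr p * s) = Zf p t s / a"
  unfolding Zf_def using assms
  by (subst (2) lborel_integral_real_affine[where c = a and t = 0]) (auto simp: tilt_scale)

lemma Zf_minus: "Zf p (- t) s = Zf p t s"
  unfolding Zf_def by (subst lborel_integral_real_affine[where c = "-1" and t = 0]) (auto simp: tilt_minus)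

lemma Zf_normalisation:
  assumes "p > 1"
  shows "Zf p 0 (1/p) = 2 * p powr (1/p) * Gamma (1 + 1/p)"
proof -
  have "ennreal (Zf p 0 (1/p)) = ennreal (2 * p powr (1/p) * Gamma (1 + 1/p))"
    using nn_integral_gen_gauss[of p] nn_integral_tilt[of p "1/p" 0] assms by (simp add: tilt_def)
  moreover have "Gamma (1 + 1/p) > 0" using assms by (intro Gamma_real_pos) (simp add: add_pos_pos)
  ultimately show ?thesis using Zf_pos[of p "1/p" 0] assms
    by (subst (asm) ennreal_inj) (auto intro!: mult_nonneg_nonneg)
qed

section \<open>Differentiation of exponential families under the integral sign\<close>

lemma abs_exp_minus_linear_le: "\<bar>exp x - 1 - x\<bar> \<le> x\<^sup>2 * exp \<bar>x\<bar>" for x :: real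
proof -
  obtain t where t: "\<bar>t\<bar> \<le> \<bar>x\<bar>" "exp x = (\<Sum>m<2. (x ^ m) / fact m) + (exp t / fact 2) * x ^ 2"
    using Maclaurin_exp_le[of x 2] by blast
  then have "\<bar>exp x - 1 - x\<bar> = (exp t / 2) * x\<^sup>2" by (simp add: numeral_2_eq_2 lessThan_Suc)
  also have "exp t / 2 \<le> exp \<bar>x\<bar>"
    using t(1) exp_le_cancel_iff[of t "\<bar>x\<bar>"] exp_gt_zero[of t] by linarith
  then have "exp t / 2 * x\<^sup>2 \<le> exp \<bar>x\<bar> * x\<^sup>2" by (intro mult_right_mono) auto
  finally show ?thesis by (simp add: mult.commute)
qed

lemma sq_le_exp:
  fixes h :: real
  assumes "\<delta> > 0"
  shows "h\<^sup>2 \<le> 8 / \<delta>\<^sup>2 * exp (\<delta>/2 * \<bar>h\<bar>)"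
proof -
  have "(\<delta>/2 * \<bar>h\<bar>)\<^sup>2 / 2 \<le> exp (\<delta>/2 * \<bar>h\<bar>)"
    using exp_lower_Taylor_quadratic[of "\<delta>/2 * \<bar>h\<bar>"] assms by (smt (verit) mult_nonneg_nonneg abs_ge_zero divide_pos_pos)
  then show ?thesis using assms by (simp add: field_simps power2_eq_square)
qed

lemma abs_le_exp:
  fixes h :: real
  assumes "\<delta> > 0"
  shows "\<bar>h\<bar> \<le> 1 / \<delta> * exp (\<delta> * \<bar>h\<bar>)"
proof -
  have "\<delta> * \<bar>h\<bar> \<le> exp (\<delta> * \<bar>h\<bar>)" using exp_ge_add_one_self[of "\<delta> * \<bar>h\<bar>"] by linarith
  then show ?thesis using assms by (simp add: field_simps)
qed

text \<open>The remainder of \<open>exp (\<epsilon> * h)\<close> after its linear term is at most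
  \<open>(\<epsilon> * h)\<close> squared times \<open>exp \<bar>\<epsilon> * h\<bar>\<close>. For
  \<open>\<bar>\<epsilon>\<bar> \<le> \<delta> / 2\<close> one half of the exponential moment of
  order \<open>\<delta>\<close> pays for the square and the other half for the exponential, so the
  difference quotient converges at rate \<open>\<bar>\<epsilon>\<bar>\<close>. The point 0 is
  enough, because a change of base point only changes the weight \<open>k\<close>.\<close>

lemma
  fixes k h :: "'a \<Rightarrow> real"
  assumes [measurable]: "k \<in> borel_measurable M" "h \<in> borel_measurable M"
    and k: "\<And>x. k x \<ge> 0" and "\<delta> > 0"
    and int: "integrable M (\<lambda>x. k x * exp (\<delta> * \<bar>h x\<bar>))"
  shows integrable_exp_family_moment: "integrable M (\<lambda>x. k x * h x)"
    and DERIV_exp_family: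
      "((\<lambda>\<epsilon>. \<integral>x. k x * exp (\<epsilon> * h x) \<partial>M) has_real_derivative (\<integral>x. k x * h x \<partial>M)) (at 0)"
proof -
  have bd: "integrable M (\<lambda>x. C * (k x * exp (\<delta> * \<bar>h x\<bar>)))" for C using int by simp
  show i1: "integrable M (\<lambda>x. k x * h x)"
    by (rule Bochner_Integration.integrable_bound[OF bd[of "1/\<delta>"]])
      (use mult_left_mono[OF abs_le_exp[OF \<open>\<delta> > 0\<close>] k] k \<open>\<delta> > 0\<close> in \<open>auto simp: abs_mult intro!: AE_I2\<close>)
  have i2: "integrable M (\<lambda>x. k x * exp (\<epsilon> * h x))" if "\<bar>\<epsilon>\<bar> \<le> \<delta>" for \<epsilon>
  proof (rule Bochner_Integration.integrable_bound[OF bd[of 1]])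
    have "\<epsilon> * h x \<le> \<delta> * \<bar>h x\<bar>" for x
      using that mult_right_mono[of "\<bar>\<epsilon>\<bar>" \<delta> "\<bar>h x\<bar>"] by (metis abs_ge_self abs_ge_zero abs_mult order_trans)
    then show "AE x in M. norm (k x * exp (\<epsilon> * h x)) \<le> norm (1 * (k x * exp (\<delta> * \<bar>h x\<bar>)))"
      using k by (auto intro!: mult_left_mono)
  qed measurable
  define E where "E = (\<integral>x. k x * exp (\<delta> * \<bar>h x\<bar>) \<partial>M)"
  define m where "m = (\<integral>x. k x * h x \<partial>M)"
  define G where "G \<epsilon> = (\<integral>x. k x * exp (\<epsilon> * h x) \<partial>M)" for \<epsilon>
  have main: "\<bar>G \<epsilon> - G 0 - \<epsilon> * m\<bar> \<le> \<epsilon>\<^sup>2 * (8 / \<delta>\<^sup>2 * E)" if e: "\<bar>\<epsilon>\<bar> \<le> \<delta> / 2" for \<epsilon>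
  proof -
    have pt: "\<bar>k x * exp (\<epsilon> * h x) - k x - \<epsilon> * (k x * h x)\<bar>
        \<le> \<epsilon>\<^sup>2 * (8 / \<delta>\<^sup>2) * (k x * exp (\<delta> * \<bar>h x\<bar>))" for x
    proof -
      have "\<bar>exp (\<epsilon> * h x) - 1 - \<epsilon> * h x\<bar> \<le> (\<epsilon> * h x)\<^sup>2 * exp \<bar>\<epsilon> * h x\<bar>"
        by (rule abs_exp_minus_linear_le)
      also have "\<dots> \<le> (\<epsilon>\<^sup>2 * (8 / \<delta>\<^sup>2 * exp (\<delta>/2 * \<bar>h x\<bar>))) * exp (\<delta>/2 * \<bar>h x\<bar>)"
      proof (intro mult_mono)
        show "(\<epsilon> * h x)\<^sup>2 \<le> \<epsilon>\<^sup>2 * (8 / \<delta>\<^sup>2 * exp (\<delta>/2 * \<bar>h x\<bar>))"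
          unfolding power_mult_distrib by (intro mult_left_mono sq_le_exp \<open>\<delta> > 0\<close>) auto
        show "exp \<bar>\<epsilon> * h x\<bar> \<le> exp (\<delta>/2 * \<bar>h x\<bar>)"
          using mult_right_mono[OF e, of "\<bar>h x\<bar>"] by (simp add: abs_mult)
      qed auto
      also have "\<dots> = \<epsilon>\<^sup>2 * (8 / \<delta>\<^sup>2) * exp (\<delta> * \<bar>h x\<bar>)"
        by (simp add: exp_add[symmetric] mult.assoc)
      finally have "k x * \<bar>exp (\<epsilon> * h x) - 1 - \<epsilon> * h x\<bar> \<le> k x * (\<epsilon>\<^sup>2 * (8 / \<delta>\<^sup>2) * exp (\<delta> * \<bar>h x\<bar>))"
        using k by (intro mult_left_mono)
      moreover have "k x * \<bar>exp (\<epsilon> * h x) - 1 - \<epsilon> * h x\<bar> = \<bar>k x * exp (\<epsilon> * h x) - k x - \<epsilon> * (k x * h x)\<bar>"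
        using k[of x] by (subst abs_of_nonneg[OF k[of x], symmetric]) (simp only: abs_mult[symmetric], simp add: algebra_simps)
      ultimately show ?thesis by (simp add: mult_ac)
    qed
    have ik: "integrable M k" using i2[of 0] \<open>\<delta> > 0\<close> by simp
    have ie: "integrable M (\<lambda>x. k x * exp (\<epsilon> * h x))" using i2 e \<open>\<delta> > 0\<close> by simp
    have "G \<epsilon> - G 0 - \<epsilon> * m = (\<integral>x. k x * exp (\<epsilon> * h x) - k x - \<epsilon> * (k x * h x) \<partial>M)"
      using ik ie i1 by (simp add: G_def m_def)
    also have "\<bar>\<dots>\<bar> \<le> (\<integral>x. \<bar>k x * exp (\<epsilon> * h x) - k x - \<epsilon> * (k x * h x)\<bar> \<partial>M)"
      by (rule integral_abs_bound)
    also have "\<dots> \<le> (\<integral>x. \<epsilon>\<^sup>2 * (8 / \<delta>\<^sup>2) * (k x * exp (\<delta> * \<bar>h x\<bar>)) \<partial>M)"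
      using ik ie i1 int by (intro integral_mono pt) auto
    finally show ?thesis by (simp add: E_def mult.assoc)
  qed
  have "((\<lambda>\<epsilon>. (G (0 + \<epsilon>) - G 0) / \<epsilon>) \<longlongrightarrow> m) (at 0)"
  proof (rule Lim_transform_bound[where g = "\<lambda>\<epsilon>. \<bar>\<epsilon>\<bar> * (8 / \<delta>\<^sup>2 * E)", THEN Lim_null[THEN iffD2]])
    show "((\<lambda>\<epsilon>. \<bar>\<epsilon>\<bar> * (8 / \<delta>\<^sup>2 * E)) \<longlongrightarrow> 0) (at 0)"
      by (intro tendsto_mult_left_zero tendsto_rabs_zero tendsto_ident_at)
    have "\<forall>\<^sub>F \<epsilon> in at 0. \<bar>\<epsilon>\<bar> \<le> \<delta> / 2 \<and> \<epsilon> \<noteq> 0"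
      unfolding eventually_at by (rule exI[of _ "\<delta>/2"]) (use \<open>\<delta> > 0\<close> in auto)
    then show "\<forall>\<^sub>F \<epsilon> in at 0. norm ((G (0 + \<epsilon>) - G 0) / \<epsilon> - m) \<le> norm (\<bar>\<epsilon>\<bar> * (8 / \<delta>\<^sup>2 * E))"
    proof eventually_elim
      case (elim \<epsilon>)
      have E: "E \<ge> 0" unfolding E_def using k by (intro Bochner_Integration.integral_nonneg) auto
      have "\<bar>(G (0 + \<epsilon>) - G 0) / \<epsilon> - m\<bar> = \<bar>G \<epsilon> - G 0 - \<epsilon> * m\<bar> / \<bar>\<epsilon>\<bar>"
        using elim by (simp only: abs_divide[symmetric]) (simp add: diff_divide_distrib)
      also have "\<dots> \<le> \<epsilon>\<^sup>2 * (8 / \<delta>\<^sup>2 * E) / \<bar>\<epsilon>\<bar>" using main elim by (intro divide_right_mono) auto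
      also have "\<dots> = \<bar>\<epsilon>\<bar> * (8 / \<delta>\<^sup>2 * E)" using elim by (simp add: power2_eq_square abs_if)
      finally show ?case using E by (simp add: abs_mult)
    qed
  qed
  then show "((\<lambda>\<epsilon>. \<integral>x. k x * exp (\<epsilon> * h x) \<partial>M) has_real_derivative (\<integral>x. k x * h x \<partial>M)) (at 0)"
    unfolding DERIV_def G_def m_def .
qed

lemma tilt_exp_abs_integrable:
  assumes "p > 1" "s > 0"
  shows "integrable lborel (\<lambda>y. tilt p t s y * exp (\<bar>y\<bar>))"
proof (rule Bochner_Integration.integrable_bound)
  show "integrable lborel (\<lambda>y. tilt p (t + 1) s y + tilt p (t - 1) s y)"
    by (intro Bochner_Integration.integrable_add tilt_integrable assms)
  show "AE y in lborel. norm (tilt p t s y * exp \<bar>y\<bar>) \<le> norm (tilt p (t + 1) s y + tilt p (t - 1) s y)"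
  proof (intro AE_I2)
    fix y :: real
    have "tilt p t s y * exp \<bar>y\<bar> \<le> tilt p (t + 1) s y + tilt p (t - 1) s y"
      using tilt_mult_exp[of p t s y 1] tilt_mult_exp[of p t s y "-1"]
        tilt_nonneg[of p "t+1" s y] tilt_nonneg[of p "t-1" s y] by (cases "y \<ge> 0") auto
    then show "norm (tilt p t s y * exp \<bar>y\<bar>) \<le> norm (tilt p (t + 1) s y + tilt p (t - 1) s y)" by simp
  qed
qed measurable

definition Z1 :: "real \<Rightarrow> real \<Rightarrow> real \<Rightarrow> real" where
  "Z1 p t s = (\<integral>y. tilt p t s y * y \<partial>lborel)"

definition Zp :: "real \<Rightarrow> real \<Rightarrow> real \<Rightarrow> real" where
  "Zp p t s = (\<integral>y. tilt p t s y * \<bar>y\<bar> powr p \<partial>lborel)"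

lemma
  assumes "p > 1" "s > 0"
  shows tilt_times_integrable: "integrable lborel (\<lambda>y. tilt p t s y * y)"
    and DERIV_Zf_t: "((\<lambda>t. Zf p t s) has_real_derivative Z1 p t s) (at t)"
proof -
  have i: "integrable lborel (\<lambda>y. tilt p t s y * exp (1 * \<bar>y\<bar>))"
    using tilt_exp_abs_integrable[OF assms] by simp
  show "integrable lborel (\<lambda>y. tilt p t s y * y)"
    by (rule integrable_exp_family_moment[OF _ _ _ _ i]) auto
  have "((\<lambda>\<epsilon>. \<integral>y. tilt p t s y * exp (\<epsilon> * y) \<partial>lborel) has_real_derivative (\<integral>y. tilt p t s y * y \<partial>lborel)) (at 0)"
    by (rule DERIV_exp_family[OF _ _ _ _ i]) auto
  then have "((\<lambda>\<epsilon>. Zf p (\<epsilon> + t) s) has_real_derivative Z1 p t s) (at 0)"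
    by (simp add: tilt_mult_exp Zf_def Z1_def add.commute)
  then show "((\<lambda>t. Zf p t s) has_real_derivative Z1 p t s) (at t)"
    using DERIV_shift[of "\<lambda>t. Zf p t s" "Z1 p t s" 0 t] by simp
qed

lemma
  assumes "p > 1" "s > 0"
  shows tilt_powr_integrable: "integrable lborel (\<lambda>y. tilt p t s y * \<bar>y\<bar> powr p)"
    and DERIV_Zf_s: "((\<lambda>s. Zf p t s) has_real_derivative - Zp p t s) (at s)"
proof -
  \<comment> \<open>Lowering \<open>s\<close> to \<open>s/2\<close> supplies an exponential moment
    of \<open>\<bar>y\<bar> powr p\<close> of order \<open>s/2\<close>.\<close>
  have "integrable lborel (tilt p t (s - s/2))" using assms by (intro tilt_integrable) auto
  then have i: "integrable lborel (\<lambda>y. tilt p t s y * exp (s/2 * \<bar>- (\<bar>y\<bar> powr p)\<bar>))"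
    using tilt_mult_exp'[of p t s _ "s/2"] by simp
  have "integrable lborel (\<lambda>y. tilt p t s y * (- (\<bar>y\<bar> powr p)))"
    by (rule integrable_exp_family_moment[OF _ _ _ _ i]) (use assms in auto)
  then show "integrable lborel (\<lambda>y. tilt p t s y * \<bar>y\<bar> powr p)" by simp
  have "((\<lambda>\<epsilon>. \<integral>y. tilt p t s y * exp (\<epsilon> * (- (\<bar>y\<bar> powr p))) \<partial>lborel) has_real_derivative
      (\<integral>y. tilt p t s y * (- (\<bar>y\<bar> powr p)) \<partial>lborel)) (at 0)"
    by (rule DERIV_exp_family[OF _ _ _ _ i]) (use assms in auto)
  moreover have "tilt p t s y * exp (\<epsilon> * (- (\<bar>y\<bar> powr p))) = tilt p t (\<epsilon> + s) y" for \<epsilon> y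
    using tilt_mult_exp'[of p t s y "- \<epsilon>"] by (simp add: add.commute)
  ultimately have "((\<lambda>\<epsilon>. Zf p t (\<epsilon> + s)) has_real_derivative - Zp p t s) (at 0)"
    by (simp add: Zf_def Zp_def)
  then show "((\<lambda>s. Zf p t s) has_real_derivative - Zp p t s) (at s)"
    using DERIV_shift[of "\<lambda>s. Zf p t s" "- Zp p t s" 0 s] by simp
qed


section \<open>Variational formulas for the rate functions\<close>


text \<open>Hoelder's inequality. Once each tilt is divided by its own integral, convexity of
  \<open>exp\<close> gives a pointwise bound whose right-hand side integrates to
  \<open>exp L\<close>.\<close>

lemma ln_Zf_mix:
  assumes "p > 1" "s1 > 0" "s2 > 0" "0 \<le> \<theta>" "\<theta> \<le> 1"
  shows "ln (Zf p ((1 - \<theta>) * t1 + \<theta> * t2) ((1 - \<theta>) * s1 + \<theta> * s2))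
    \<le> (1 - \<theta>) * ln (Zf p t1 s1) + \<theta> * ln (Zf p t2 s2)"
proof -
  define t s where "t = (1 - \<theta>) * t1 + \<theta> * t2" and "s = (1 - \<theta>) * s1 + \<theta> * s2"
  have s: "s > 0"
  proof (cases "\<theta> = 0")
    case False
    then show ?thesis unfolding s_def using assms by (intro add_nonneg_pos mult_nonneg_nonneg mult_pos_pos) auto
  qed (use assms in \<open>auto simp: s_def\<close>)
  define L1 L2 where "L1 = ln (Zf p t1 s1)" and "L2 = ln (Zf p t2 s2)"
  define L where "L = (1 - \<theta>) * L1 + \<theta> * L2"
  have Z: "Zf p t1 s1 = exp L1" "Zf p t2 s2 = exp L2"
    using Zf_pos assms by (auto simp: L1_def L2_def)
  have pt: "tilt p t s y \<le> exp L * ((1 - \<theta>) * (tilt p t1 s1 y / exp L1) + \<theta> * (tilt p t2 s2 y / exp L2))" for y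
  proof -
    define a b where "a = t1 * y - s1 * \<bar>y\<bar> powr p - L1" and "b = t2 * y - s2 * \<bar>y\<bar> powr p - L2"
    have "tilt p t s y = exp (L + ((1 - \<theta>) * a + \<theta> * b))"
      by (simp add: tilt_def L_def a_def b_def t_def s_def algebra_simps)
    also have "\<dots> = exp L * exp ((1 - \<theta>) * a + \<theta> * b)" by (rule exp_add)
    also have "exp ((1 - \<theta>) * a + \<theta> * b) \<le> (1 - \<theta>) * exp a + \<theta> * exp b"
      using convex_onD[OF exp_convex, of \<theta> a b] assms by simp
    finally show ?thesis by (simp add: tilt_def a_def b_def exp_diff)
  qed
  have i: "integrable lborel (tilt p t1 s1)" "integrable lborel (tilt p t2 s2)"
    using tilt_integrable assms by auto
  have "Zf p t s \<le> (\<integral>y. exp L * ((1 - \<theta>) * (tilt p t1 s1 y / exp L1) + \<theta> * (tilt p t2 s2 y / exp L2)) \<partial>lborel)"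
    unfolding Zf_def using assms s i by (intro integral_mono tilt_integrable pt) auto
  also have "\<dots> = exp L * ((1 - \<theta>) * (Zf p t1 s1 / exp L1) + \<theta> * (Zf p t2 s2 / exp L2))"
    using i by (simp add: Zf_def)
  also have "\<dots> = exp L" by (simp add: Z)
  finally have "ln (Zf p t s) \<le> L" using Zf_pos[OF assms(1) s, of t] by (metis exp_gt_zero ln_exp ln_le_cancel_iff)
  then show ?thesis by (simp add: t_def s_def L_def L1_def L2_def)
qed

lemma ln_Zf_ge_0:
  assumes "p > 1" "s > 0"
  shows "ln (Zf p 0 s) \<le> ln (Zf p t s)"
  using ln_Zf_mix[of p s s "1/2" t "- t"] assms by (simp add: Zf_minus)

lemma ln_Zf_scale:
  assumes "p > 1" "a > 0" "s > 0"
  shows "ln (Zf p (a * t) (a powr p * s)) = ln (Zf p t s) - ln a"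
  using Zf_pos[of p s t] assms by (simp add: Zf_scale ln_div)

text \<open>Homogeneity makes the blow-up as \<open>s\<close> tends to 0 explicit; this keeps
  maximisers away from the boundary of the half-plane.\<close>

lemma ln_Zf_0:
  assumes "p > 1" "s > 0"
  shows "ln (Zf p 0 s) = ln (Zf p 0 1) - ln s / p"
  using ln_Zf_scale[of p "s powr (1/p)" 1 0] assms by (simp add: powr_powr ln_powr)

definition upper_half :: "(real \<times> real) set" where
  "upper_half = {z. snd z > 0}"

lemma open_upper_half: "open upper_half"
  unfolding upper_half_def by (intro open_Collect_less continuous_intros)

lemma convex_upper_half: "convex upper_half"
  using convex_halfspace_gt[of 0 "(0, 1) :: real \<times> real"] by (simp add: upper_half_def inner_prod_def)

lemma ln_Zf_convex:
  assumes "p > 1"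
  shows "convex_on upper_half (\<lambda>(t, s). ln (Zf p t s))"
  by (rule convex_onI) (use ln_Zf_mix[OF assms] convex_upper_half in \<open>auto simp: upper_half_def\<close>)

lemma ln_Zf_continuous:
  assumes "p > 1"
  shows "continuous_on upper_half (\<lambda>(t, s). ln (Zf p t s))"
  by (rule convex_on_continuous[OF open_upper_half ln_Zf_convex[OF assms]])

section \<open>Coercivity and existence of maximisers\<close>

lemma Zf_ge_interval:
  assumes "p > 1" "s > 0" "d > 0" and "\<And>y. y \<in> {a..a + d} \<Longrightarrow> c \<le> t * y - s * \<bar>y\<bar> powr p"
  shows "ln d + c \<le> ln (Zf p t s)"
proof -
  have "d * exp c = (\<integral>y. indicator {a..a + d} y * exp c \<partial>lborel)" using assms by simp
  also have "\<dots> \<le> Zf p t s" unfolding Zf_def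
  proof (intro integral_mono tilt_integrable)
    show "integrable lborel (\<lambda>y. indicator {a..a + d} y * exp c)"
      by (intro integrable_mult_left integrable_real_indicator) (auto simp: emeasure_lborel_Icc_eq)
    show "indicator {a..a + d} y * exp c \<le> tilt p t s y" for y
      using assms(4)[of y] by (cases "y \<in> {a..a + d}") (auto simp: tilt_def)
  qed (use assms in auto)
  finally have "ln (d * exp c) \<le> ln (Zf p t s)"
    using assms Zf_pos[of p s t] by (subst ln_le_cancel_iff) auto
  then show ?thesis using assms by (simp add: ln_mult)
qed

lemma ln_Zf_coercive:
  assumes "p > 1" "\<bar>w\<bar> < 1"
  shows "\<exists>C \<delta>. \<delta> > 0 \<and> (\<forall>t s. s > 0 \<longrightarrow> t * w - s - ln (Zf p t s) \<le> C - \<delta> * (\<bar>t\<bar> + s))"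
proof -
  \<comment> \<open>One third of the room left by \<open>\<bar>w\<bar> < 1\<close>. An interval of
    length \<open>d\<close>, at distance \<open>d\<close> from \<open>w\<close> on the side given by
    the sign of \<open>t\<close>, still lies in \<open>\<bar>y\<bar> \<le> 1 - d\<close>. On it
    \<open>t * y\<close> exceeds \<open>t * w\<close> by at least \<open>d * \<bar>t\<bar>\<close>,
    and \<open>\<bar>y\<bar> powr p\<close> stays below 1 by at least
    \<open>1 - \<kappa>\<close>.\<close>
  define d where "d = (1 - \<bar>w\<bar>) / 3"
  have d: "d > 0" "\<bar>w\<bar> + 2 * d = 1 - d" "d < 1" using assms by (auto simp: d_def field_simps)
  define \<kappa> where "\<kappa> = (1 - d) powr p"
  have k: "\<kappa> < 1" using d assms powr_less_mono2[of p "1 - d" 1] by (simp add: \<kappa>_def)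
  have kk: "\<bar>y\<bar> powr p \<le> \<kappa>" if "\<bar>y\<bar> \<le> 1 - d" for y
    unfolding \<kappa>_def using that assms by (intro powr_mono2) auto
  define \<delta> where "\<delta> = min d (1 - \<kappa>)"
  have "t * w - s - ln (Zf p t s) \<le> - ln d - \<delta> * (\<bar>t\<bar> + s)" if s: "s > 0" for t s
  proof -
    have "ln d + (t * w + d * \<bar>t\<bar> - s * \<kappa>) \<le> ln (Zf p t s)"
    proof (cases "t \<ge> 0")
      case True
      show ?thesis
      proof (rule Zf_ge_interval[OF assms(1) s d(1), of "w + d"])
        fix y assume y: "y \<in> {w + d..w + d + d}"
        have "\<bar>y\<bar> powr p \<le> \<kappa>" using y d by (intro kk) auto
        then have "s * \<bar>y\<bar> powr p \<le> s * \<kappa>" using s by simp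
        moreover have "t * (w + d) \<le> t * y" using True y by (intro mult_left_mono) auto
        ultimately show "t * w + d * \<bar>t\<bar> - s * \<kappa> \<le> t * y - s * \<bar>y\<bar> powr p"
          using True by (simp add: algebra_simps)
      qed
    next
      case False
      show ?thesis
      proof (rule Zf_ge_interval[OF assms(1) s d(1), of "w - 2 * d"])
        fix y assume y: "y \<in> {w - 2 * d..w - 2 * d + d}"
        have "\<bar>y\<bar> powr p \<le> \<kappa>" using y d by (intro kk) auto
        then have "s * \<bar>y\<bar> powr p \<le> s * \<kappa>" using s by simp
        moreover have "t * (w - d) \<le> t * y" using False y by (intro mult_left_mono_neg) auto
        ultimately show "t * w + d * \<bar>t\<bar> - s * \<kappa> \<le> t * y - s * \<bar>y\<bar> powr p"
          using False by (simp add: algebra_simps)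
      qed
    qed
    moreover have "\<delta> * \<bar>t\<bar> \<le> d * \<bar>t\<bar>" "\<delta> * s \<le> (1 - \<kappa>) * s"
      unfolding \<delta>_def using s by (auto intro!: mult_right_mono)
    ultimately show ?thesis by (simp add: algebra_simps)
  qed
  moreover have "\<delta> > 0" using d k by (simp add: \<delta>_def)
  ultimately show ?thesis by (intro exI[of _ "- ln d", OF exI[of _ \<delta>]]) simp
qed

text \<open>Stated for any continuous \<open>\<Phi>\<close> above \<open>ln Zf\<close>, so that it
  covers \<open>ln Zf\<close> itself and, for \<open>p < 2\<close>, its Gaussian average. Coercivity
  discards large \<open>\<bar>t\<bar> + s\<close>, the blow-up of \<open>Zf p 0 s\<close> discards
  small \<open>s\<close>, and a compact rectangle remains.\<close>

lemma legendre_attained: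
  fixes \<Phi> :: "real \<Rightarrow> real \<Rightarrow> real"
  assumes p: "p > 1" and w: "\<bar>w\<bar> < 1"
    and cont: "continuous_on upper_half (\<lambda>(t, s). \<Phi> t s)"
    and ge: "\<And>t s. s > 0 \<Longrightarrow> ln (Zf p t s) \<le> \<Phi> t s"
  shows "\<exists>t0 s0. s0 > 0 \<and> (\<forall>t s. s > 0 \<longrightarrow> t * w - s - \<Phi> t s \<le> t0 * w - s0 - \<Phi> t0 s0)"
proof -
  obtain \<delta> C where \<delta>: "\<delta> > 0" and
    coer: "\<And>t s. s > 0 \<Longrightarrow> t * w - s - ln (Zf p t s) \<le> C - \<delta> * (\<bar>t\<bar> + s)"
    using ln_Zf_coercive[OF p w] by meson
  define F where "F = (\<lambda>(t, s). t * w - s - \<Phi> t s)"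
  define L where "L = F (0, 1)"
  define R where "R = max 1 ((C - L) / \<delta>)"
  define c where "c = ln (Zf p 0 1)"
  \<comment> \<open>For \<open>s < k\<close> the term \<open>c - ln s / p\<close> exceeds
    \<open>R - L\<close>, while \<open>t * w \<le> R\<close>; the objective is then below its value
    \<open>L\<close> at \<open>(0, 1)\<close>.\<close>
  define k where "k = min 1 (exp (p * (L - R + c)))"
  have kR: "0 < k" "k \<le> 1" "1 \<le> R" by (auto simp: k_def R_def)
  define B where "B = {-R..R} \<times> {k..R}"
  have BU: "B \<subseteq> upper_half" using kR by (auto simp: B_def upper_half_def)
  have "compact B" unfolding B_def by (intro compact_Times compact_Icc)
  moreover have "continuous_on B F"
  proof -
    have "continuous_on B (\<lambda>z. fst z * w - snd z - (case z of (t, s) \<Rightarrow> \<Phi> t s))"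
      by (intro continuous_intros continuous_on_subset[OF cont BU])
    then show ?thesis unfolding F_def by (simp add: case_prod_unfold)
  qed
  moreover have L_in: "(0, 1) \<in> B" using kR by (auto simp: B_def)
  ultimately have "\<exists>z\<in>B. \<forall>z'\<in>B. F z' \<le> F z" by (intro continuous_attains_sup) auto
  then obtain z where z: "z \<in> B" "\<And>z'. z' \<in> B \<Longrightarrow> F z' \<le> F z" by auto
  obtain t0 s0 where z0: "z = (t0, s0)" by (cases z)
  have "F (t, s) \<le> F z" if s: "s > 0" for t s
  proof (cases "(t, s) \<in> B")
    case False
    have "F (t, s) \<le> L"
    proof (cases "\<bar>t\<bar> \<le> R \<and> s \<le> R")
      case False
      then have "R \<le> \<bar>t\<bar> + s" using s by auto
      then have "(C - L) / \<delta> \<le> \<bar>t\<bar> + s" by (simp add: R_def)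
      then have "C - \<delta> * (\<bar>t\<bar> + s) \<le> L" using \<delta> by (simp add: field_simps)
      then show ?thesis using coer[OF s, of t] ge[OF s, of t] by (simp add: F_def)
    next
      case True
      then have "s < k" using False by (auto simp: B_def)
      then have "s < exp (p * (L - R + c))" by (simp add: k_def)
      then have "ln s < p * (L - R + c)" using s by (metis exp_less_cancel_iff exp_ln)
      then have "ln s / p < L - R + c" using p by (simp add: field_simps)
      moreover have "t * w \<le> R"
      proof -
        have "t * w \<le> \<bar>t\<bar> * \<bar>w\<bar>" by (metis abs_ge_self abs_mult)
        also have "\<dots> \<le> \<bar>t\<bar> * 1" using w by (intro mult_left_mono) auto
        finally show ?thesis using True by simp
      qed
      moreover have "c - ln s / p \<le> \<Phi> t s"
        using ln_Zf_ge_0[OF p s, of t] ln_Zf_0[OF p s] ge[OF s, of t] by (simp add: c_def)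
      ultimately show ?thesis using s by (simp add: F_def)
    qed
    also have "L \<le> F z" unfolding L_def by (rule z(2)[OF L_in])
    finally show ?thesis .
  qed (use z in auto)
  then have "s0 > 0 \<and> (\<forall>t s. s > 0 \<longrightarrow> t * w - s - \<Phi> t s \<le> t0 * w - s0 - \<Phi> t0 s0)"
    using z(1) kR by (auto simp: F_def z0 B_def)
  then show ?thesis by meson
qed

text \<open>The maximiser is interior, so both partial derivatives vanish. The result is phrased
  through \<open>ln Zf\<close> and not through moments, since the concentration estimate works with
  increments of \<open>ln Zf\<close>.\<close>

lemma first_order_conditions:
  assumes p: "p > 1" and s0: "s0 > 0"
    and mx: "\<And>t s. s > 0 \<Longrightarrow> t * w - s - ln (Zf p t s) \<le> t0 * w - s0 - ln (Zf p t0 s0)"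
  shows "((\<lambda>t. ln (Zf p t s0)) has_real_derivative w) (at t0)"
    and "((\<lambda>s. ln (Zf p t0 s)) has_real_derivative -1) (at s0)"
proof -
  have Z: "Zf p t0 s0 > 0" by (rule Zf_pos[OF p s0])
  have D1: "((\<lambda>t. ln (Zf p t s0)) has_real_derivative (Z1 p t0 s0 / Zf p t0 s0)) (at t0)"
    using DERIV_chain2[OF DERIV_ln[OF Z] DERIV_Zf_t[OF p s0]] by (simp add: divide_inverse mult.commute)
  have "((\<lambda>t. t * w - s0 - ln (Zf p t s0)) has_real_derivative (w - Z1 p t0 s0 / Zf p t0 s0)) (at t0)"
    by (rule derivative_eq_intros D1 refl | simp)+
  then have "w - Z1 p t0 s0 / Zf p t0 s0 = 0"
    by (rule DERIV_local_max[OF _ zero_less_one]) (use mx[OF s0] in auto)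
  then show "((\<lambda>t. ln (Zf p t s0)) has_real_derivative w) (at t0)" using D1 by simp
  have D2: "((\<lambda>s. ln (Zf p t0 s)) has_real_derivative (- Zp p t0 s0 / Zf p t0 s0)) (at s0)"
    using DERIV_chain2[OF DERIV_ln[OF Z] DERIV_Zf_s[OF p s0]] by (simp add: divide_inverse mult.commute)
  have "((\<lambda>s. t0 * w - s - ln (Zf p t0 s)) has_real_derivative (- 1 - (- Zp p t0 s0 / Zf p t0 s0))) (at s0)"
    by (rule derivative_eq_intros D2 refl | simp)+
  then have "- 1 - (- Zp p t0 s0 / Zf p t0 s0) = 0"
    by (rule DERIV_local_max[OF _ s0]) (use mx in auto)
  then show "((\<lambda>s. ln (Zf p t0 s)) has_real_derivative -1) (at s0)" using D2 by simp
qed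

section \<open>Reduction of both rate functions to a supremum over \<open>t\<close> and
  \<open>s > 0\<close>\<close>

text \<open>The Legendre transform at \<open>(w, 1)\<close> after the substitution
  \<open>t2 = 1/p - s\<close>: the term \<open>1/p\<close> comes from \<open>t2\<close>, and
  \<open>ln (Zf p 0 (1/p))\<close> from the normalisation of \<open>mu p\<close>.\<close>

definition rate_sup :: "(real \<Rightarrow> real \<Rightarrow> real) \<Rightarrow> real \<Rightarrow> real \<Rightarrow> ereal" where
  "rate_sup \<Phi> p w = (SUP (t, s) \<in> UNIV \<times> {0<..}. ereal (t * w - s - \<Phi> t s + (1/p + ln (Zf p 0 (1/p)))))"

lemma rate_sup_upper:
  "s > 0 \<Longrightarrow> ereal (t * w - s - \<Phi> t s + (1/p + ln (Zf p 0 (1/p)))) \<le> rate_sup \<Phi> p w"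
  unfolding rate_sup_def by (rule SUP_upper2[of "(t, s)"]) auto

lemma rate_sup_least:
  "(\<And>t s. s > 0 \<Longrightarrow> ereal (t * w - s - \<Phi> t s + (1/p + ln (Zf p 0 (1/p)))) \<le> c) \<Longrightarrow> rate_sup \<Phi> p w \<le> c"
  unfolding rate_sup_def by (rule SUP_least) auto

text \<open>The pair \<open>(w, 1)\<close> is admissible, which gives one inequality. For any other
  admissible pair a point \<open>(t, s)\<close> is replaced by \<open>(a * t, s / \<tau>2)\<close>
  with \<open>a = \<tau>2 powr (- 1 / p)\<close>. The rescaling loses \<open>ln \<tau>2 / p\<close>
  and gains \<open>(\<tau>2 - 1) / p\<close>, and \<open>ln x \<le> x - 1\<close>.\<close>

lemma inf_legendre_eq_rate_sup:
  assumes p: "p > 1"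
    and Linf: "\<And>t1 t2. t2 \<ge> 1/p \<Longrightarrow> L (t1, t2) = \<infinity>"
    and Lfin: "\<And>t1 t2. t2 < 1/p \<Longrightarrow> L (t1, t2) = ereal (\<Phi> t1 (1/p - t2) - ln (Zf p 0 (1/p)))"
    and scale: "\<And>a t s. a > 0 \<Longrightarrow> s > 0 \<Longrightarrow> \<Phi> (a * t) (a powr p * s) = \<Phi> t s - ln a"
  shows "(INF \<tau> \<in> {(\<tau>1, \<tau>2). \<tau>2 > 0 \<and> \<tau>1 * \<tau>2 powr (- 1 / p) = w}. legendre L \<tau>) = rate_sup \<Phi> p w"
proof (rule antisym)
  have "legendre L (w, 1) \<le> rate_sup \<Phi> p w"
    unfolding legendre_def
  proof (rule SUP_least, clarify)
    fix t1 t2 :: real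
    show "ereal ((t1, t2) \<bullet> (w, 1)) - L (t1, t2) \<le> rate_sup \<Phi> p w"
    proof (cases "t2 \<ge> 1/p")
      case True
      then show ?thesis by (simp add: Linf)
    next
      case False
      then show ?thesis
        using rate_sup_upper[of "1/p - t2" t1 w \<Phi> p] Lfin[of t2 t1] by (simp add: inner_prod_def algebra_simps)
    qed
  qed
  then show "(INF \<tau> \<in> {(\<tau>1, \<tau>2). \<tau>2 > 0 \<and> \<tau>1 * \<tau>2 powr (- 1 / p) = w}. legendre L \<tau>) \<le> rate_sup \<Phi> p w"
    by (intro INF_lower2[of "(w, 1)"]) auto
  show "rate_sup \<Phi> p w \<le> (INF \<tau> \<in> {(\<tau>1, \<tau>2). \<tau>2 > 0 \<and> \<tau>1 * \<tau>2 powr (- 1 / p) = w}. legendre L \<tau>)"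
  proof (rule INF_greatest, clarify)
    fix \<tau>1 \<tau>2 :: real
    assume \<tau>2: "\<tau>2 > 0" and w: "w = \<tau>1 * \<tau>2 powr (- 1 / p)"
    show "rate_sup \<Phi> p (\<tau>1 * \<tau>2 powr (- 1 / p)) \<le> legendre L (\<tau>1, \<tau>2)"
    proof (rule rate_sup_least)
      fix t s :: real
      assume s: "s > 0"
      define a where "a = \<tau>2 powr (- 1 / p)"
      have a: "a > 0" "a powr p = 1 / \<tau>2" "ln a = - ln \<tau>2 / p"
        using \<tau>2 p by (auto simp: a_def powr_powr powr_neg_one ln_powr simp del: powr_minus_divide)
      have "\<Phi> (a * t) (s / \<tau>2) = \<Phi> t s + ln \<tau>2 / p"
        using scale[OF a(1) s, of t] a by simp
      moreover have "ln \<tau>2 / p \<le> (\<tau>2 - 1) / p"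
        using ln_le_minus_one[OF \<tau>2] p by (intro divide_right_mono) auto
      ultimately have "t * (\<tau>1 * a) - s - \<Phi> t s + (1/p + ln (Zf p 0 (1/p)))
         \<le> (a * t) * \<tau>1 + (1/p - s / \<tau>2) * \<tau>2 - (\<Phi> (a * t) (s / \<tau>2) - ln (Zf p 0 (1/p)))"
        using \<tau>2 by (simp add: algebra_simps diff_divide_distrib)
      also have "ereal \<dots> = ereal ((a * t, 1/p - s / \<tau>2) \<bullet> (\<tau>1, \<tau>2)) - L (a * t, 1/p - s / \<tau>2)"
        using Lfin[of "1/p - s / \<tau>2" "a * t"] s \<tau>2 by (simp add: inner_prod_def)
      also have "\<dots> \<le> legendre L (\<tau>1, \<tau>2)" unfolding legendre_def by (rule SUP_upper) simp
      finally show "ereal (t * (\<tau>1 * \<tau>2 powr (- 1 / p)) - s - \<Phi> t s + (1/p + ln (Zf p 0 (1/p)))) \<le> legendre L (\<tau>1, \<tau>2)"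
        unfolding a_def by simp
    qed
  qed
qed

lemma elog_ennreal: "x > 0 \<Longrightarrow> elog (ennreal x) = ereal (ln x)"
  by (simp add: elog_def)

lemma nn_integral_mu:
  assumes p: "p > 1" and [measurable]: "f \<in> borel_measurable borel"
  shows "(\<integral>\<^sup>+ y. f y \<partial>mu p) = (\<integral>\<^sup>+ y. ennreal (1 / Zf p 0 (1/p)) * (ennreal (tilt p 0 (1/p) y) * f y) \<partial>lborel)"
proof -
  have d: "gen_gauss_density p y = 1 / Zf p 0 (1/p) * tilt p 0 (1/p) y" for y
    by (simp add: gen_gauss_density_def tilt_def Zf_normalisation[OF p])
  have "Zf p 0 (1/p) > 0" using Zf_pos[of p "1/p" 0] p by simp
  then show ?thesis unfolding mu_def d
    by (subst nn_integral_density)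
      (auto simp: ennreal_mult mult.assoc simp del: times_divide_eq_left times_divide_eq_right)
qed

lemma Lambda_eq:
  assumes p: "p > 1" and t2: "t2 < 1/p"
  shows "Lambda p (t1, t2) = ereal (ln (Zf p t1 (1/p - t2)) - ln (Zf p 0 (1/p)))"
proof -
  have s: "1/p - t2 > 0" using t2 by simp
  have Z0: "Zf p 0 (1/p) > 0" using Zf_pos[of p "1/p" 0] p by simp
  have "(\<integral>\<^sup>+ y. ennreal (exp (t1 * y + t2 * \<bar>y\<bar> powr p)) \<partial>mu p)
    = (\<integral>\<^sup>+ y. ennreal (1 / Zf p 0 (1/p)) * ennreal (tilt p t1 (1/p - t2) y) \<partial>lborel)"
    by (subst nn_integral_mu[OF p])
      (auto intro!: nn_integral_cong simp: ennreal_mult[symmetric] tilt_def exp_add[symmetric] algebra_simps)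
  also have "\<dots> = ennreal (1 / Zf p 0 (1/p)) * ennreal (Zf p t1 (1/p - t2))"
    by (subst nn_integral_cmult) (auto simp: nn_integral_tilt[OF p s])
  also have "\<dots> = ennreal (Zf p t1 (1/p - t2) / Zf p 0 (1/p))"
    using Z0 Zf_pos[OF p s, of t1] by (simp add: ennreal_mult[symmetric])
  finally show ?thesis
    unfolding Lambda_def using Z0 Zf_pos[OF p s, of t1] by (simp add: elog_ennreal ln_div)
qed

text \<open>Beyond the critical value the power term no longer decays, so the integrand with respect
  to Lebesgue measure is bounded below by a positive constant on the half-line where
  \<open>t1 * y \<ge> 0\<close>.\<close>

lemma Lambda_eq_infinity:
  assumes p: "p > 1" and t2: "t2 \<ge> 1/p"
  shows "Lambda p (t1, t2) = \<infinity>"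
proof -
  have Z0: "Zf p 0 (1/p) > 0" using Zf_pos[of p "1/p" 0] p by simp
  define S where "S = (if t1 \<ge> 0 then {0::real..} else {..0})"
  have [measurable]: "S \<in> sets borel" by (simp add: S_def)
  have S: "emeasure lborel S = \<infinity>"
  proof (rule ccontr)
    assume "emeasure lborel S \<noteq> \<infinity>"
    then obtain n where n: "emeasure lborel S < of_nat n"
      using ennreal_Ex_less_of_nat[of "emeasure lborel S"] by (auto simp: less_top)
    have "of_nat n = emeasure lborel (if t1 \<ge> 0 then {0..real n} else {- real n..0})"
      by (simp add: ennreal_of_nat_eq_real_of_nat)
    also have "\<dots> \<le> emeasure lborel S" by (intro emeasure_mono) (auto simp: S_def)
    finally show False using n by simp
  qed
  have ge: "1 \<le> tilt p 0 (1/p) y * exp (t1 * y + t2 * \<bar>y\<bar> powr p)" if "y \<in> S" for y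
  proof -
    have "t1 * y \<ge> 0" using that by (auto simp: S_def zero_le_mult_iff split: if_splits)
    moreover have "(t2 - 1/p) * \<bar>y\<bar> powr p \<ge> 0" using t2 by simp
    ultimately show ?thesis by (simp add: tilt_def exp_add[symmetric] algebra_simps)
  qed
  have "\<infinity> = (\<integral>\<^sup>+ y. ennreal (1 / Zf p 0 (1/p)) * indicator S y \<partial>lborel)"
    using Z0 S by (simp add: nn_integral_cmult ennreal_mult_top)
  also have "\<dots> \<le> (\<integral>\<^sup>+ y. ennreal (1 / Zf p 0 (1/p)) *
      (ennreal (tilt p 0 (1/p) y) * ennreal (exp (t1 * y + t2 * \<bar>y\<bar> powr p))) \<partial>lborel)"
    using ge by (intro nn_integral_mono mult_left_mono)
      (auto simp: indicator_def ennreal_mult[symmetric] intro!: ennreal_leI[of 1, simplified])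
  also have "\<dots> = (\<integral>\<^sup>+ y. ennreal (exp (t1 * y + t2 * \<bar>y\<bar> powr p)) \<partial>mu p)"
    by (rule nn_integral_mu[OF p, symmetric]) measurable
  finally show ?thesis by (simp add: Lambda_def elog_def top_unique)
qed

lemma I_cr_eq:
  assumes "p > 1"
  shows "I_cr p w = rate_sup (\<lambda>t s. ln (Zf p t s)) p w"
  unfolding I_cr_def
  by (rule inf_legendre_eq_rate_sup) (use assms Lambda_eq Lambda_eq_infinity ln_Zf_scale in auto)

section \<open>The Gaussian average of the logarithmic partition function\<close>

definition Psi_fin :: "real \<Rightarrow> real \<Rightarrow> real \<Rightarrow> real" where
  "Psi_fin p t s = (\<integral>u. ln (Zf p (t * u) s) \<partial>mu 2)"

lemma mu_2_eq: "mu 2 = density lborel (\<lambda>y. ennreal (std_normal_density y))"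
proof -
  have "Gamma (1 + 1/2 :: real) = sqrt pi / 2"
    using Gamma_plus1[of "1/2 :: real"] nonpos_Ints_nonpos[of "1/2 :: real"]
    by (auto simp: Gamma_one_half_real add.commute)
  then have "gen_gauss_density 2 y = std_normal_density y" for y
    by (simp add: gen_gauss_density_def std_normal_density_def powr_half_sqrt real_sqrt_mult)
  then show ?thesis by (simp add: mu_def)
qed

lemma prob_space_mu_2: "prob_space (mu 2)"
  unfolding mu_2_eq by (rule prob_space_normal_density) simp

lemma sets_mu [measurable_cong, simp]: "sets (mu p) = sets borel" and space_mu [simp]: "space (mu p) = UNIV"
  by (simp_all add: mu_def)

lemma measure_mu_2 [simp]: "measure (mu 2) UNIV = 1"
  using prob_space.prob_space[OF prob_space_mu_2] by simp

lemma mu_2_square: "integrable (mu 2) (\<lambda>u. u\<^sup>2)" "(\<integral>u. u\<^sup>2 \<partial>mu 2) = 1"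
proof -
  have *: "has_bochner_integral lborel (\<lambda>x. std_normal_density x * x ^ 2) 1"
    using std_normal_moment_even[of 1] by simp
  show "integrable (mu 2) (\<lambda>u. u\<^sup>2)"
    unfolding mu_2_eq using * by (subst integrable_density) (auto simp: has_bochner_integral_iff)
  show "(\<integral>u. u\<^sup>2 \<partial>mu 2) = 1"
    unfolding mu_2_eq using * by (subst integral_density) (auto simp: has_bochner_integral_iff)
qed

lemma mu_2_exp_abs: "integrable (mu 2) (\<lambda>u. exp \<bar>u\<bar>)"
proof -
  have "std_normal_density u = 1 / sqrt (2 * pi) * tilt 2 0 (1/2) u" for u
    by (simp add: std_normal_density_def tilt_def)
  then show ?thesis
    unfolding mu_2_eq using tilt_exp_abs_integrable[of 2 "1/2" 0]
    by (subst integrable_density) (auto simp: mult.assoc)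
qed

text \<open>The inequality \<open>x \<le> exp x\<close> at \<open>x = \<bar>u\<bar> / q\<close>,
  raised to the power \<open>q\<close>.\<close>

lemma powr_le_exp_abs:
  fixes u q :: real
  assumes "q > 0"
  shows "\<bar>u\<bar> powr q \<le> q powr q * exp \<bar>u\<bar>"
proof -
  have "\<bar>u\<bar> powr q = (q * (\<bar>u\<bar> / q)) powr q" using assms by simp
  also have "\<dots> = q powr q * (\<bar>u\<bar> / q) powr q" using assms by (intro powr_mult)
  also have "\<dots> \<le> q powr q * exp (\<bar>u\<bar> / q) powr q"
  proof (intro mult_left_mono powr_mono2)
    show "\<bar>u\<bar> / q \<le> exp (\<bar>u\<bar> / q)" using exp_ge_add_one_self[of "\<bar>u\<bar> / q"] by linarith
  qed (use assms in auto)
  also have "exp (\<bar>u\<bar> / q) powr q = exp \<bar>u\<bar>" using assms by (simp add: exp_powr_real)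
  finally show ?thesis by simp
qed

lemma mu_2_powr:
  assumes "q > 0"
  shows "integrable (mu 2) (\<lambda>u. \<bar>u\<bar> powr q)"
  by (rule Bochner_Integration.integrable_bound[OF integrable_mult_right[OF mu_2_exp_abs, of "q powr q"]])
    (use powr_le_exp_abs[OF assms] in auto)

lemma Zf_measurable:
  assumes "p > 1" "s > 0"
  shows "(\<lambda>t. Zf p t s) \<in> borel_measurable borel"
  using DERIV_Zf_t[OF assms] by (intro borel_measurable_continuous_onI)
    (auto simp: continuous_on_eq_continuous_at intro: DERIV_isCont)

text \<open>The integrand lies between the constant \<open>ln (Zf p 0 s)\<close> and the upper bound
  from \<open>Zf_le\<close>, which is a constant plus a multiple of a power of
  \<open>\<bar>u\<bar>\<close>; Gaussian absolute moments are finite.\<close>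

lemma ln_Zf_mu_2_integrable:
  assumes "p > 1" "s > 0"
  shows "integrable (mu 2) (\<lambda>u. ln (Zf p (t * u) s))"
proof (rule Bochner_Integration.integrable_bound)
  define q where "q = p / (p - 1)"
  define C where "C = \<bar>ln (Zf p 0 s)\<bar> + \<bar>ln (Zf p 0 (s/2))\<bar>"
  interpret prob_space "mu 2" by (rule prob_space_mu_2)
  show "integrable (mu 2) (\<lambda>u. C + s/2 * (2 * \<bar>t\<bar> / s) powr q * \<bar>u\<bar> powr q)"
    using assms by (intro Bochner_Integration.integrable_add integrable_mult_right mu_2_powr) (auto simp: q_def)
  show "(\<lambda>u. ln (Zf p (t * u) s)) \<in> borel_measurable (mu 2)"
    using measurable_compose[OF _ Zf_measurable[OF assms], of "\<lambda>u. t * u" borel] by measurable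
  show "AE u in mu 2. norm (ln (Zf p (t * u) s)) \<le> norm (C + s/2 * (2 * \<bar>t\<bar> / s) powr q * \<bar>u\<bar> powr q)"
  proof (intro AE_I2)
    fix u :: real
    have "Zf p (t * u) s \<le> exp (s/2 * (2 * \<bar>t * u\<bar> / s) powr q) * Zf p 0 (s/2)"
      unfolding q_def by (rule Zf_le[OF assms])
    then have "ln (Zf p (t * u) s) \<le> ln (exp (s/2 * (2 * \<bar>t * u\<bar> / s) powr q) * Zf p 0 (s/2))"
      using Zf_pos assms by (subst ln_le_cancel_iff) auto
    also have "\<dots> = s/2 * (2 * \<bar>t * u\<bar> / s) powr q + ln (Zf p 0 (s/2))"
      using Zf_pos[of p "s/2" 0] assms by (simp add: ln_mult)
    also have "(2 * \<bar>t * u\<bar> / s) = (2 * \<bar>t\<bar> / s) * \<bar>u\<bar>" by (simp add: abs_mult)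
    also have "\<dots> powr q = (2 * \<bar>t\<bar> / s) powr q * \<bar>u\<bar> powr q" using assms by (intro powr_mult)
    finally have "ln (Zf p (t * u) s) \<le> s/2 * (2 * \<bar>t\<bar> / s) powr q * \<bar>u\<bar> powr q + ln (Zf p 0 (s/2))"
      by (simp add: mult.assoc)
    moreover have "ln (Zf p 0 s) \<le> ln (Zf p (t * u) s)" by (rule ln_Zf_ge_0[OF assms])
    moreover have "s/2 * (2 * \<bar>t\<bar> / s) powr q * \<bar>u\<bar> powr q \<ge> 0" using assms by simp
    ultimately show "norm (ln (Zf p (t * u) s)) \<le> norm (C + s/2 * (2 * \<bar>t\<bar> / s) powr q * \<bar>u\<bar> powr q)"
      unfolding real_norm_def C_def by linarith
  qed
qed

lemma ext_integral_integrable: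
  assumes "integrable M f"
  shows "ext_integral M (\<lambda>x. ereal (f x)) = ereal (\<integral>x. f x \<partial>M)"
proof -
  have e: "enn2ereal x = ereal (enn2real x)" if "x \<noteq> \<infinity>" for x
    using that by (cases x) auto
  have f: "(\<integral>\<^sup>+ x. ennreal (f x) \<partial>M) \<noteq> \<infinity>" "(\<integral>\<^sup>+ x. ennreal (- f x) \<partial>M) \<noteq> \<infinity>"
    using assms by (auto simp: real_integrable_def)
  then have "enn2ereal (\<integral>\<^sup>+ x. ennreal (f x) \<partial>M) = ereal (enn2real (\<integral>\<^sup>+ x. ennreal (f x) \<partial>M))"
    "enn2ereal (\<integral>\<^sup>+ x. ennreal (- f x) \<partial>M) = ereal (enn2real (\<integral>\<^sup>+ x. ennreal (- f x) \<partial>M))"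
    using e by blast+
  then show ?thesis
    unfolding ext_integral_def real_lebesgue_integral_def[OF assms] by simp
qed

lemma Psi_eq:
  assumes p: "p > 1" and t2: "t2 < 1/p"
  shows "Psi p (mu 2) (t1, t2) = ereal (Psi_fin p t1 (1/p - t2) - ln (Zf p 0 (1/p)))"
proof -
  interpret prob_space "mu 2" by (rule prob_space_mu_2)
  have i: "integrable (mu 2) (\<lambda>u. ln (Zf p (t1 * u) (1/p - t2)))"
    using ln_Zf_mu_2_integrable[OF p, of "1/p - t2"] t2 by simp
  show ?thesis
    unfolding Psi_def Psi_fin_def using i
    by (simp add: Lambda_eq[OF p t2] ext_integral_integrable prob_space)
qed

lemma Psi_eq_infinity:
  assumes p: "p > 1" and t2: "t2 \<ge> 1/p"
  shows "Psi p (mu 2) (t1, t2) = \<infinity>"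
proof -
  interpret prob_space "mu 2" by (rule prob_space_mu_2)
  show ?thesis
    by (simp add: Psi_def ext_integral_def Lambda_eq_infinity[OF assms] emeasure_space_1[simplified])
qed

lemma Psi_fin_scale:
  assumes "p > 1" "a > 0" "s > 0"
  shows "Psi_fin p (a * t) (a powr p * s) = Psi_fin p t s - ln a"
proof -
  interpret prob_space "mu 2" by (rule prob_space_mu_2)
  show ?thesis
    using ln_Zf_scale[OF assms, of "t * _"] ln_Zf_mu_2_integrable[OF assms(1,3), of t]
    by (simp add: Psi_fin_def mult.assoc prob_space)
qed

lemma Psi_fin_convex:
  assumes "p > 1"
  shows "convex_on upper_half (\<lambda>(t, s). Psi_fin p t s)"
proof (rule convex_onI)
  fix \<theta> :: real and x y :: "real \<times> real"
  assume \<theta>: "0 < \<theta>" "\<theta> < 1" and xy: "x \<in> upper_half" "y \<in> upper_half"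
  obtain t1 s1 t2 s2 where e: "x = (t1, s1)" "y = (t2, s2)" by (cases x, cases y)
  have s: "s1 > 0" "s2 > 0" using xy by (auto simp: e upper_half_def)
  have s': "(1 - \<theta>) * s1 + \<theta> * s2 > 0" using s \<theta> by (simp add: add_pos_pos)
  note i = ln_Zf_mu_2_integrable[OF assms s(1)] ln_Zf_mu_2_integrable[OF assms s(2)]
  have "Psi_fin p ((1 - \<theta>) * t1 + \<theta> * t2) ((1 - \<theta>) * s1 + \<theta> * s2)
    \<le> (\<integral>u. (1 - \<theta>) * ln (Zf p (t1 * u) s1) + \<theta> * ln (Zf p (t2 * u) s2) \<partial>mu 2)"
    unfolding Psi_fin_def
  proof (intro integral_mono ln_Zf_mu_2_integrable[OF assms s'])
    show "ln (Zf p (((1 - \<theta>) * t1 + \<theta> * t2) * u) ((1 - \<theta>) * s1 + \<theta> * s2))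
        \<le> (1 - \<theta>) * ln (Zf p (t1 * u) s1) + \<theta> * ln (Zf p (t2 * u) s2)" for u
      using ln_Zf_mix[OF assms s, of \<theta> "t1 * u" "t2 * u"] \<theta> by (simp add: algebra_simps)
  qed (use i in auto)
  also have "\<dots> = (1 - \<theta>) * Psi_fin p t1 s1 + \<theta> * Psi_fin p t2 s2"
    using i by (simp add: Psi_fin_def)
  finally show "(case (1 - \<theta>) *\<^sub>R x + \<theta> *\<^sub>R y of (t, s) \<Rightarrow> Psi_fin p t s)
     \<le> (1 - \<theta>) * (case x of (t, s) \<Rightarrow> Psi_fin p t s) + \<theta> * (case y of (t, s) \<Rightarrow> Psi_fin p t s)"
    by (simp add: e)
qed (rule convex_upper_half)

lemma Psi_fin_continuous:
  assumes "p > 1"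
  shows "continuous_on upper_half (\<lambda>(t, s). Psi_fin p t s)"
  by (rule convex_on_continuous[OF open_upper_half Psi_fin_convex[OF assms]])

lemma I_qu_eq:
  assumes "p > 1"
  shows "I_qu p (mu 2) w = rate_sup (Psi_fin p) p w"
  unfolding I_qu_def
  by (rule inf_legendre_eq_rate_sup) (use assms Psi_eq Psi_eq_infinity Psi_fin_scale in auto)

lemma Psi_fin_ge_0:
  assumes "p > 1" "s > 0"
  shows "ln (Zf p 0 s) \<le> Psi_fin p t s"
proof -
  interpret prob_space "mu 2" by (rule prob_space_mu_2)
  have "(\<integral>u. ln (Zf p 0 s) \<partial>mu 2) \<le> Psi_fin p t s"
    unfolding Psi_fin_def by (intro integral_mono ln_Zf_mu_2_integrable ln_Zf_ge_0 assms) auto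
  then show ?thesis by (simp add: prob_space)
qed

lemma Psi_fin_0: "Psi_fin p 0 s = ln (Zf p 0 s)"
proof -
  interpret prob_space "mu 2" by (rule prob_space_mu_2)
  show ?thesis by (simp add: Psi_fin_def prob_space)
qed

text \<open>For \<open>w = 0\<close> a nonzero \<open>t\<close> cannot help, because
  \<open>\<Phi> t s\<close> is at least \<open>ln (Zf p 0 s)\<close>. Homogeneity then reduces the
  claim to \<open>ln (s * p) \<le> s * p - 1\<close>, with equality at
  \<open>s = 1/p\<close>.\<close>

lemma rate_sup_0_eq:
  assumes "p > 1" "\<And>s. s > 0 \<Longrightarrow> \<Phi> 0 s = ln (Zf p 0 s)"
    and "\<And>t s. s > 0 \<Longrightarrow> ln (Zf p 0 s) \<le> \<Phi> t s"
  shows "rate_sup \<Phi> p 0 = 0"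
proof (rule antisym)
  have p: "1 / p > 0" using assms by simp
  show "rate_sup \<Phi> p 0 \<le> 0"
  proof (rule rate_sup_least)
    fix t s :: real assume s: "s > 0"
    have "ln (s * p) \<le> s * p - 1" using s assms(1) by (intro ln_le_minus_one) auto
    then have "ln s + ln p \<le> s * p - 1" using s assms(1) by (simp add: ln_mult)
    then have "(ln s + ln p) / p \<le> (s * p - 1) / p" using assms(1) by (intro divide_right_mono) auto
    then have "ln s / p + ln p / p \<le> s - 1/p" using assms(1) by (simp add: add_divide_distrib diff_divide_distrib)
    moreover have "ln (Zf p 0 (1/p)) = ln (Zf p 0 1) + ln p / p"
      using ln_Zf_0[OF assms(1) p] assms(1) by (simp add: ln_div)
    ultimately show "ereal (t * 0 - s - \<Phi> t s + (1 / p + ln (Zf p 0 (1 / p)))) \<le> 0"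
      using assms(3)[OF s, of t] ln_Zf_0[OF assms(1) s] by (simp add: zero_ereal_def)
  qed
  show "0 \<le> rate_sup \<Phi> p 0"
    using rate_sup_upper[OF p, of 0 0 \<Phi> p] assms(2)[OF p] by (simp add: zero_ereal_def)
qed


section \<open>Comparison of the rate functions\<close>


lemma integral_fold:
  fixes f :: "real \<Rightarrow> real"
  assumes f: "integrable lborel f"
  shows "(\<integral>y. f y \<partial>lborel) = (LBINT y:{0<..}. f y + f (- y))"
proof -
  have f': "integrable lborel (\<lambda>y. f (- y))"
    using lborel_integrable_real_affine[OF f, of "-1" 0] by simp
  have i: "integrable lborel (\<lambda>y. indicator {0<..} y * f y)" "integrable lborel (\<lambda>y. indicator {..<0} y * f y)"
    "integrable lborel (\<lambda>y. indicator {0<..} y * f (- y))"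
    using f f' integrable_mult_indicator[of "{0<..}" lborel f] integrable_mult_indicator[of "{..<0}" lborel f]
      integrable_mult_indicator[of "{0<..}" lborel "\<lambda>y. f (- y)"] by simp_all
  have "(\<integral>y. f y \<partial>lborel) = (\<integral>y. indicator {0<..} y * f y + indicator {..<0} y * f y \<partial>lborel)"
    using i f AE_lborel_singleton[of 0]
    by (intro integral_cong_AE) (auto simp: indicator_def elim!: eventually_mono intro!: borel_measurable_integrable)
  also have "\<dots> = (\<integral>y. indicator {0<..} y * f y \<partial>lborel) + (\<integral>y. indicator {..<0} y * f y \<partial>lborel)"
    by (rule Bochner_Integration.integral_add[OF i(1,2)])
  also have "(\<integral>y. indicator {..<0} y * f y \<partial>lborel) = (\<integral>y. indicator {0<..} y * f (- y) \<partial>lborel)"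
    by (subst lborel_integral_real_affine[where c = "-1" and t = 0])
      (auto simp: indicator_def intro!: Bochner_Integration.integral_cong)
  also have "(\<integral>y. indicator {0<..} y * f y \<partial>lborel) + \<dots> = (LBINT y:{0<..}. f y + f (- y))"
    unfolding set_lebesgue_integral_def using i by (simp add: distrib_left)
  finally show ?thesis .
qed

lemma powr_minus_1_le: "\<bar>y\<bar> powr (p - 1) \<le> 1 + \<bar>y\<bar> powr p" if "p > 1" for y p :: real
proof (cases "\<bar>y\<bar> \<le> 1")
  case True
  then have "\<bar>y\<bar> powr (p - 1) \<le> 1 powr (p - 1)" using that by (intro powr_mono2) auto
  then show ?thesis by (simp add: add_increasing2)
next
  case False
  then have "\<bar>y\<bar> powr (p - 1) \<le> \<bar>y\<bar> powr p" by (intro powr_mono) auto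
  then show ?thesis by simp
qed

lemma tilt_powr_minus_1_integrable:
  assumes "p > 1" "s > 0"
  shows "integrable lborel (\<lambda>y. tilt p t s y * \<bar>y\<bar> powr (p - 1))"
proof (rule Bochner_Integration.integrable_bound)
  show "integrable lborel (\<lambda>y. tilt p t s y + tilt p t s y * \<bar>y\<bar> powr p)"
    by (intro Bochner_Integration.integrable_add tilt_integrable tilt_powr_integrable assms)
  show "AE y in lborel. norm (tilt p t s y * \<bar>y\<bar> powr (p - 1)) \<le> norm (tilt p t s y + tilt p t s y * \<bar>y\<bar> powr p)"
    using mult_left_mono[OF powr_minus_1_le[OF assms(1)] tilt_nonneg] by (auto simp: distrib_left)
qed measurable

text \<open>Twice the odd part in \<open>y\<close> of the tilt. Folding the line onto the half-line
  produces it, and it is positive there when \<open>t > 0\<close>.\<close>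

definition tilt_odd :: "real \<Rightarrow> real \<Rightarrow> real \<Rightarrow> real \<Rightarrow> real" where
  "tilt_odd p t s y = tilt p t s y - tilt p (- t) s y"

lemma tilt_odd_sinh: "tilt_odd p t s y = 2 * sinh (t * y) * tilt p 0 s y"
  by (simp add: tilt_odd_def tilt_def sinh_def exp_minus exp_diff field_simps)

text \<open>Used with two exponents: \<open>a = 1\<close> gives \<open>Z1\<close>, and
  \<open>a = p - 1\<close> gives \<open>t * Zf p t s\<close> up to the factor \<open>p * s\<close>.
  The derivative of \<open>ln Zf\<close> in \<open>t\<close>, divided by \<open>t\<close>, is thus a
  ratio of two moments of one positive weight.\<close>

definition odd_moment :: "real \<Rightarrow> real \<Rightarrow> real \<Rightarrow> real \<Rightarrow> real" where
  "odd_moment p s a t = (LBINT y:{0<..}. y powr a * tilt_odd p t s y)"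

lemma
  assumes "p > 1" "s > 0"
  shows odd_integrable_1: "set_integrable lborel {0<..} (\<lambda>y. y powr 1 * tilt_odd p t s y)"
    and odd_integrable_p: "set_integrable lborel {0<..} (\<lambda>y. y powr (p - 1) * tilt_odd p t s y)"
proof -
  have "integrable lborel (\<lambda>y. indicator {0<..} y *\<^sub>R (tilt p t s y * y - tilt p (- t) s y * y))"
    by (intro integrable_mult_indicator Bochner_Integration.integrable_diff tilt_times_integrable assms) auto
  then show "set_integrable lborel {0<..} (\<lambda>y. y powr 1 * tilt_odd p t s y)"
    unfolding set_integrable_def
    by (rule Bochner_Integration.integrable_cong[THEN iffD1, rotated -1]) (auto simp: indicator_def tilt_odd_def algebra_simps)
  have "integrable lborel (\<lambda>y. indicator {0<..} y *\<^sub>R (tilt p t s y * \<bar>y\<bar> powr (p - 1) - tilt p (- t) s y * \<bar>y\<bar> powr (p - 1)))"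
    by (intro integrable_mult_indicator Bochner_Integration.integrable_diff tilt_powr_minus_1_integrable assms) auto
  then show "set_integrable lborel {0<..} (\<lambda>y. y powr (p - 1) * tilt_odd p t s y)"
    unfolding set_integrable_def
    by (rule Bochner_Integration.integrable_cong[THEN iffD1, rotated -1]) (auto simp: indicator_def tilt_odd_def algebra_simps)
qed

lemma Z1_eq_odd_moment:
  assumes "p > 1" "s > 0"
  shows "Z1 p t s = odd_moment p s 1 t"
proof -
  have "Z1 p t s = (LBINT y:{0<..}. tilt p t s y * y + tilt p t s (- y) * - y)"
    unfolding Z1_def by (rule integral_fold[OF tilt_times_integrable[OF assms]])
  also have "\<dots> = odd_moment p s 1 t"
    unfolding odd_moment_def by (intro set_lebesgue_integral_cong) (auto simp: tilt_odd_def tilt_minus algebra_simps)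
  finally show ?thesis .
qed

lemma tilt_tendsto_0:
  assumes "p > 1" "s > 0"
  shows "(tilt p t s \<longlongrightarrow> 0) at_top"
proof -
  define C where "C = exp (s/2 * (2 * \<bar>t\<bar> / s) powr (p / (p - 1)))"
  have "filterlim (\<lambda>y. (s/2) * y powr p) at_top at_top"
  proof (rule filterlim_tendsto_pos_mult_at_top[OF tendsto_const])
    show "filterlim (\<lambda>y. y powr p) at_top at_top"
    proof (rule filterlim_at_top_mono[OF filterlim_ident])
      show "\<forall>\<^sub>F y in at_top. y \<le> y powr p"
        using eventually_ge_at_top[of 1]
      proof eventually_elim
        case (elim y)
        then show ?case using powr_mono[of 1 p y] assms by simp
      qed
    qed
  qed (use assms in auto)
  then have "((\<lambda>y. exp (- ((s/2) * y powr p))) \<longlongrightarrow> 0) at_top"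
    by (intro filterlim_compose[OF exp_at_bot] filterlim_compose[OF filterlim_uminus_at_bot_at_top])
  then have lim: "((\<lambda>y. C * exp (- ((s/2) * y powr p))) \<longlongrightarrow> 0) at_top"
    by (rule tendsto_mult_right_zero)
  show ?thesis
  proof (rule tendsto_sandwich[OF _ _ tendsto_const lim])
    show "\<forall>\<^sub>F y in at_top. tilt p t s y \<le> C * exp (- ((s/2) * y powr p))"
      using eventually_ge_at_top[of 0]
    proof eventually_elim
      case (elim y)
      then show ?case using tilt_le[OF assms, of t y] by (simp add: C_def tilt_def)
    qed
  qed auto
qed

text \<open>Integrates the derivative of \<^term>\<open>tilt_odd p t s\<close> over the half-line.\<close>
lemma Zf_eq_odd_moment:
  assumes p: "p > 1" and s: "s > 0"
  shows "t * Zf p t s = p * s * odd_moment p s (p - 1) t"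
proof -
  define f where "f y = t * (tilt p t s y + tilt p (- t) s y) - p * s * (y powr (p - 1) * tilt_odd p t s y)" for y
  have i1: "set_integrable lborel {0<..} (\<lambda>y. t * (tilt p t s y + tilt p (- t) s y))"
    unfolding set_integrable_def using tilt_integrable[OF assms]
    by (intro integrable_mult_indicator Bochner_Integration.integrable_add integrable_mult_right) auto
  have i2: "set_integrable lborel {0<..} (\<lambda>y. p * s * (y powr (p - 1) * tilt_odd p t s y))"
    using odd_integrable_p[OF assms] by (intro set_integrable_mult_right) auto
  have fi: "set_integrable lborel {0<..} f"
    unfolding f_def by (rule set_integral_diff[OF i1 i2])
  have D: "(tilt p t s has_real_derivative (t - p * s * y powr (p - 1)) * tilt p t s y) (at y)" if "y > 0" for y t
  proof -
    have "((\<lambda>y. exp (t * y - s * y powr p)) has_real_derivative (t - p * s * y powr (p - 1)) * exp (t * y - s * y powr p)) (at y)"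
      using that by (auto intro!: derivative_eq_intros simp: powr_diff field_simps)
    moreover have "\<forall>\<^sub>F y in nhds y. tilt p t s y = exp (t * y - s * y powr p)"
      by (rule eventually_mono[OF eventually_nhds_in_open[of "{0<..}" y]]) (use that in \<open>auto simp: tilt_def\<close>)
    ultimately show ?thesis using that by (subst DERIV_cong_ev[OF refl _ refl]) (auto simp: tilt_def)
  qed
  \<comment> \<open>The boundary terms vanish: at 0 both tilts equal 1 and cancel, at infinity both
    decay.\<close>
  have "(LBINT y=0..\<infinity>. f y) = 0 - 0"
  proof (rule interval_integral_FTC_integrable)
    fix y :: real assume "0 < ereal y"
    then have y: "y > 0" by simp
    have "(tilt_odd p t s has_real_derivative (t - p * s * y powr (p - 1)) * tilt p t s y
       - (- t - p * s * y powr (p - 1)) * tilt p (- t) s y) (at y)"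
      unfolding tilt_odd_def by (intro DERIV_diff D y)
    moreover have "(t - p * s * y powr (p - 1)) * tilt p t s y - (- t - p * s * y powr (p - 1)) * tilt p (- t) s y = f y"
      by (simp add: f_def tilt_odd_def algebra_simps)
    ultimately show "(tilt_odd p t s has_vector_derivative f y) (at y)"
      by (simp add: has_real_derivative_iff_has_vector_derivative)
    have "isCont (tilt p t' s) y" for t' using D[OF y] by (rule DERIV_isCont)
    then show "isCont f y"
      unfolding f_def tilt_odd_def using y by (intro continuous_intros) auto
  next
    show "set_integrable lborel (einterval 0 \<infinity>) f"
      using fi by (simp add: einterval_eq zero_ereal_def)
    have "((tilt_odd p t s \<circ> real_of_ereal) \<longlongrightarrow> tilt_odd p t s 0) (at_right (ereal 0))"
    proof (subst ereal_tendsto_simps, unfold tilt_odd_def)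
      have "isCont (\<lambda>y. tilt p t s y - tilt p (- t) s y) 0"
        unfolding tilt_def using p by (intro continuous_intros) auto
      then show "((\<lambda>y. tilt p t s y - tilt p (- t) s y) \<longlongrightarrow> tilt p t s 0 - tilt p (- t) s 0) (at_right 0)"
        unfolding isCont_def by (rule tendsto_mono[OF at_le, rotated]) simp
    qed
    then show "((tilt_odd p t s \<circ> real_of_ereal) \<longlongrightarrow> 0) (at_right 0)"
      by (simp add: tilt_odd_def tilt_def zero_ereal_def)
    show "((tilt_odd p t s \<circ> real_of_ereal) \<longlongrightarrow> 0) (at_left \<infinity>)"
      unfolding ereal_tendsto_simps tilt_odd_def
      using tendsto_diff[OF tilt_tendsto_0[OF assms, of t] tilt_tendsto_0[OF assms, of "- t"]] by simp
  qed auto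
  then have "(LBINT y:{0<..}. f y) = 0"
    by (simp add: interval_lebesgue_integral_def einterval_eq zero_ereal_def)
  then have "(LBINT y:{0<..}. t * (tilt p t s y + tilt p (- t) s y))
      = (LBINT y:{0<..}. p * s * (y powr (p - 1) * tilt_odd p t s y))"
    unfolding f_def using set_integral_diff(2)[OF i1 i2] by simp
  moreover have "Zf p t s = (LBINT y:{0<..}. tilt p t s y + tilt p (- t) s y)"
    unfolding Zf_def tilt_minus[symmetric] by (rule integral_fold[OF tilt_integrable[OF assms]])
  ultimately show ?thesis by (simp add: odd_moment_def)
qed

section \<open>Monotonicity of the ratio of odd moments\<close>

text \<open>The difference of the two sides vanishes at \<open>y = 0\<close>, and its derivative is
  \<open>\<alpha> * \<beta>\<close> times a difference of values of \<open>cosh\<close>, which is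
  positive.\<close>

lemma sinh_mult_less:
  fixes \<alpha> \<beta> y :: real
  assumes "0 < \<beta>" "\<beta> < \<alpha>" "0 < y"
  shows "\<alpha> * sinh (\<beta> * y) < \<beta> * sinh (\<alpha> * y)"
proof -
  define h where "h y = \<beta> * sinh (\<alpha> * y) - \<alpha> * sinh (\<beta> * y)" for y
  have "h 0 < h y"
  proof (rule DERIV_pos_imp_increasing_open[OF assms(3)])
    fix x :: real assume x: "0 < x" "x < y"
    have "(h has_real_derivative \<alpha> * \<beta> * (cosh (\<alpha> * x) - cosh (\<beta> * x))) (at x)"
      unfolding h_def by (auto intro!: derivative_eq_intros simp: algebra_simps)
    moreover have "cosh (\<beta> * x) < cosh (\<alpha> * x)"
      using assms x by (subst cosh_real_nonneg_less_iff) auto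
    then have "0 < \<alpha> * \<beta> * (cosh (\<alpha> * x) - cosh (\<beta> * x))" using assms by simp
    ultimately show "\<exists>d. (h has_real_derivative d) (at x) \<and> 0 < d" by blast
  qed (auto simp: h_def intro!: continuous_intros)
  then show ?thesis by (simp add: h_def)
qed

lemma sinh_ratio_less:
  fixes t t' y z :: real
  assumes "0 < t" "t < t'" "0 < y" "y < z"
  shows "sinh (t' * y) / sinh (t * y) < sinh (t' * z) / sinh (t * z)"
proof (rule DERIV_pos_imp_increasing[OF assms(4)])
  fix x assume "y \<le> x" "x \<le> z"
  then have x: "x > 0" using assms by simp
  have sx: "sinh (t * x) > 0" using x assms by simp
  have D: "((\<lambda>y. sinh (t' * y) / sinh (t * y)) has_real_derivative
     (t' * cosh (t' * x) * sinh (t * x) - sinh (t' * x) * (t * cosh (t * x))) / (sinh (t * x) * sinh (t * x))) (at x)"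
    using sx by (auto intro!: derivative_eq_intros)
  \<comment> \<open>By the addition formulas the numerator of the derivative is half the difference
    of these two sides.\<close>
  have "(t' + t) * sinh ((t' - t) * x) < (t' - t) * sinh ((t' + t) * x)"
    using sinh_mult_less[of "t' - t" "t' + t" x] assms x by simp
  then have "0 < t' * cosh (t' * x) * sinh (t * x) - sinh (t' * x) * (t * cosh (t * x))"
    by (simp add: ring_distribs sinh_add sinh_diff algebra_simps)
  then have "0 < (t' * cosh (t' * x) * sinh (t * x) - sinh (t' * x) * (t * cosh (t * x))) / (sinh (t * x) * sinh (t * x))"
    using sx by (intro divide_pos_pos mult_pos_pos)
  then show "\<exists>d. ((\<lambda>y. sinh (t' * y) / sinh (t * y)) has_real_derivative d) (at x) \<and> 0 < d"
    using D by blast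
qed

text \<open>One point \<open>c\<close> is exempted because the integrand of the moment comparison
  vanishes where its two factors change sign.\<close>

lemma integral_pos_halfline:
  fixes f :: "real \<Rightarrow> real"
  assumes i: "set_integrable lborel {0<..} f" and f: "\<And>y. y > 0 \<Longrightarrow> y \<noteq> c \<Longrightarrow> f y > 0" "f c \<ge> 0"
  shows "(LBINT y:{0<..}. f y) > 0"
proof -
  have nn: "indicator {0<..} y *\<^sub>R f y \<ge> 0" for y
    using f(1)[of y] f(2) by (cases "y = c") (auto simp: indicator_def)
  have "(LBINT y:{0<..}. f y) \<noteq> 0"
  proof
    assume "(LBINT y:{0<..}. f y) = 0"
    then have "AE y in lborel. indicator {0<..} y *\<^sub>R f y = 0"
      using i nn unfolding set_lebesgue_integral_def set_integrable_def
      by (subst (asm) integral_nonneg_eq_0_iff_AE) auto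
    with AE_lborel_singleton[of c] have "AE y in lborel. y \<notin> {0::real<..}"
    proof eventually_elim
      case (elim y)
      then show ?case using f(1)[of y] by (cases "y > 0") auto
    qed
    then have "emeasure lborel {0::real<..} = 0" by (subst (asm) AE_iff_measurable[OF _ refl]) (auto simp: greaterThan_def)
    moreover have "emeasure lborel {1..2::real} \<le> emeasure lborel {0::real<..}" by (intro emeasure_mono) auto
    ultimately show False by simp
  qed
  moreover have "(LBINT y:{0<..}. f y) \<ge> 0"
    unfolding set_lebesgue_integral_def by (rule Bochner_Integration.integral_nonneg) (use nn in auto)
  ultimately show ?thesis by linarith
qed

lemma odd_moment_pos:
  assumes "t > 0" "set_integrable lborel {0<..} (\<lambda>y. y powr a * tilt_odd p t s y)"
  shows "odd_moment p s a t > 0"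
  unfolding odd_moment_def
  by (rule integral_pos_halfline[OF assms(2), of 0]) (use assms(1) in \<open>auto simp: tilt_odd_sinh\<close>)

text \<open>Chebyshev's association inequality in single-crossing form. The factors
  \<open>(p - 2) * (y powr (p - 2) - k)\<close> and
  \<open>sinh (t' * y) - \<rho> * sinh (t * y)\<close> both change sign from minus to plus at the
  same point \<open>c\<close>, so their product is positive elsewhere; integrated against the weight
  \<open>2 * y * tilt p 0 s y\<close> it yields the claim.\<close>

lemma odd_moment_ratio_mono:
  assumes p: "p > 1" "p \<noteq> 2" and s: "s > 0" and t: "0 < t" "t < t'"
  shows "(p - 2) * (odd_moment p s (p - 1) t' * odd_moment p s 1 t - odd_moment p s (p - 1) t * odd_moment p s 1 t') > 0"
proof -
  note i = odd_integrable_1[OF p(1) s] odd_integrable_p[OF p(1) s]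
  define N D where "N = odd_moment p s 1" and "D = odd_moment p s (p - 1)"
  have N: "N t > 0" and D: "D t > 0"
    unfolding N_def D_def using odd_moment_pos[OF t(1)] i by auto
  \<comment> \<open>The mean of \<open>y powr (p - 2)\<close> under the weight with parameter
    \<open>t\<close>. This choice makes the coefficient of \<open>\<rho>\<close> in the final
    integral vanish.\<close>
  define k where "k = D t / N t"
  have k: "k > 0" using N D by (simp add: k_def)
  define c where "c = k powr (1 / (p - 2))"
  have c: "c > 0" "c powr (p - 2) = k" using k p by (auto simp: c_def powr_powr)
  define \<rho> where "\<rho> = sinh (t' * c) / sinh (t * c)"
  define f where "f y = (p - 2) * (y powr (p - 1) * tilt_odd p t' s y - \<rho> * (y powr (p - 1) * tilt_odd p t s y)
     - (k * (y powr 1 * tilt_odd p t' s y) - k * \<rho> * (y powr 1 * tilt_odd p t s y)))" for y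
  have f_eq: "f y = ((p - 2) * (y powr (p - 2) - k)) * (sinh (t' * y) - \<rho> * sinh (t * y)) * (2 * y * tilt p 0 s y)"
    if "y > 0" for y
  proof -
    have "y powr (p - 1) = y powr (p - 2) * y" using that powr_mult_base[of y "p - 2"] by (simp add: mult.commute)
    then show ?thesis using that by (simp add: f_def tilt_odd_sinh algebra_simps)
  qed
  have pos: "f y > 0" if y: "y > 0" "y \<noteq> c" for y
  proof -
    have ty: "sinh (t * y) > 0" using t y by simp
    have pw: "0 < (p - 2) * (b powr (p - 2) - a powr (p - 2))" if "0 < a" "a < b" for a b
    proof (cases "p > 2")
      case True
      then show ?thesis using powr_less_mono2[of "p - 2" a b] that by auto
    next
      case False
      then have "p - 2 < 0" using p by simp
      then show ?thesis using powr_less_mono2_neg[of "p - 2" a b] that by (intro mult_neg_neg) auto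
    qed
    have "((p - 2) * (y powr (p - 2) - k)) * (sinh (t' * y) - \<rho> * sinh (t * y)) > 0"
    proof (cases "y < c")
      case True
      have "sinh (t' * y) / sinh (t * y) < \<rho>"
        unfolding \<rho>_def by (rule sinh_ratio_less[OF t y(1) True])
      then have "sinh (t' * y) - \<rho> * sinh (t * y) < 0" using ty by (simp add: field_simps)
      moreover have "(p - 2) * (y powr (p - 2) - k) < 0"
        using pw[OF y(1) True] c by (simp add: algebra_simps)
      ultimately show ?thesis by (rule mult_neg_neg[rotated])
    next
      case False
      then have cy: "c < y" using y by simp
      have "\<rho> < sinh (t' * y) / sinh (t * y)"
        unfolding \<rho>_def by (rule sinh_ratio_less[OF t c(1) cy])
      then have "sinh (t' * y) - \<rho> * sinh (t * y) > 0" using ty by (simp add: field_simps)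
      moreover have "(p - 2) * (y powr (p - 2) - k) > 0"
        using pw[OF c(1) cy] c by (simp add: algebra_simps)
      ultimately show ?thesis by (rule mult_pos_pos[rotated])
    qed
    then show ?thesis unfolding f_eq[OF y(1)] by (rule mult_pos_pos) (use y in auto)
  qed
  have fc: "f c \<ge> 0" using f_eq[OF c(1)] c by simp
  have j: "integrable lborel (\<lambda>y. indicator {0<..} y * (y powr (p - 1) * tilt_odd p t s y))"
     "integrable lborel (\<lambda>y. indicator {0<..} y * (y powr 1 * tilt_odd p t s y))" for t
    using i[of t] unfolding set_integrable_def real_scaleR_def by auto
  have fe: "indicator {0<..} y * f y = (p - 2) * (indicator {0<..} y * (y powr (p - 1) * tilt_odd p t' s y)
     - \<rho> * (indicator {0<..} y * (y powr (p - 1) * tilt_odd p t s y))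
     - (k * (indicator {0<..} y * (y powr 1 * tilt_odd p t' s y)) - k * \<rho> * (indicator {0<..} y * (y powr 1 * tilt_odd p t s y))))" for y
    by (simp add: f_def indicator_def)
  have fi: "set_integrable lborel {0<..} f"
    unfolding set_integrable_def real_scaleR_def fe
    by (intro integrable_mult_right Bochner_Integration.integrable_diff j)
  have "(LBINT y:{0<..}. f y) = (p - 2) * (D t' - \<rho> * D t - (k * N t' - k * \<rho> * N t))"
    unfolding set_lebesgue_integral_def fe D_def N_def odd_moment_def real_scaleR_def
    by (simp only: Bochner_Integration.integral_diff j integrable_mult_right Bochner_Integration.integrable_diff integral_mult_right_zero)
  \<comment> \<open>The terms with \<open>\<rho>\<close> cancel because
    \<open>D t = k * N t\<close>.\<close>
  also have "\<dots> = (p - 2) * (D t' - k * N t')" using N by (simp add: k_def)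
  finally have "(p - 2) * (D t' - k * N t') > 0" using integral_pos_halfline[OF fi pos fc] by simp
  then have "(p - 2) * (D t' - k * N t') * N t > 0" using N by simp
  also have "(p - 2) * (D t' - k * N t') * N t = (p - 2) * (D t' * N t - D t * N t')"
    using N by (simp add: k_def field_simps)
  finally show ?thesis by (simp add: N_def D_def)
qed

text \<open>With \<open>g t = ln (Zf p t s)\<close> and \<open>x = t\<^sup>2\<close> this says that \<open>x \<mapsto> g (sqrt x)\<close> is strictly concave for
  \<open>p > 2\<close> and strictly convex for \<open>p < 2\<close>: its derivative is \<open>g' t / (2 * t)\<close>, a multiple of the ratio
  of odd moments.\<close>
lemma ln_Zf_tangent:
  assumes p: "p > 1" and s: "s > 0" and t0: "t0 > 0"
  obtains c where
    "\<And>t. p \<noteq> 2 \<Longrightarrow> \<bar>t\<bar> \<noteq> t0 \<Longrightarrow> (p - 2) * (ln (Zf p t0 s) + c * (t\<^sup>2 - t0\<^sup>2) - ln (Zf p t s)) > 0"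
    "\<And>t. p = 2 \<Longrightarrow> ln (Zf p t s) = ln (Zf p t0 s) + c * (t\<^sup>2 - t0\<^sup>2)"
proof -
  \<comment> \<open>Here \<open>r t\<close> is the derivative of \<open>ln Zf\<close> in
    \<open>t\<close> divided by \<open>t\<close>, and \<open>c = r t0 / 2\<close> is the slope of
    the tangent in the variable \<open>x\<close>. Subtracting the linear term gives \<open>G\<close>
    with derivative \<open>t * (r t - r t0)\<close>, whose sign for \<open>t > 0\<close> is decided
    by the monotonicity of \<open>r\<close>.\<close>
  define r where "r t = odd_moment p s 1 t / odd_moment p s (p - 1) t / (p * s)" for t
  define c where "c = r t0 / 2"
  define G where "G t = ln (Zf p t s) - c * t\<^sup>2" for t
  have DG: "(G has_real_derivative t * (r t - r t0)) (at t)" if "t > 0" for t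
  proof -
    have Z: "Zf p t s > 0" by (rule Zf_pos[OF p s])
    have D: "odd_moment p s (p - 1) t > 0" by (rule odd_moment_pos[OF that odd_integrable_p[OF p s]])
    have "t * Zf p t s = p * s * odd_moment p s (p - 1) t" by (rule Zf_eq_odd_moment[OF p s])
    then have "Z1 p t s / Zf p t s = t * r t"
      using Z D p s that unfolding r_def Z1_eq_odd_moment[OF p s] by (simp add: field_simps)
    moreover have "((\<lambda>t. ln (Zf p t s)) has_real_derivative (Z1 p t s / Zf p t s)) (at t)"
      using DERIV_chain2[OF DERIV_ln[OF Z] DERIV_Zf_t[OF p s]] by (simp add: divide_inverse mult.commute)
    ultimately have D1: "((\<lambda>t. ln (Zf p t s)) has_real_derivative t * r t) (at t)" by simp
    show ?thesis unfolding G_def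
      by (rule derivative_eq_intros D1 refl | simp add: c_def algebra_simps)+
  qed
  have contG: "continuous_on A G" for A
  proof -
    have "isCont (\<lambda>t. Zf p t s) t" for t using DERIV_Zf_t[OF p s] by (rule DERIV_isCont)
    then show ?thesis unfolding G_def using Zf_pos[OF p s]
      by (intro continuous_intros continuous_at_imp_continuous_on) (auto simp: less_imp_neq[symmetric])
  qed
  have even: "G t = G \<bar>t\<bar>" for t
    by (cases "t \<ge> 0") (auto simp: G_def Zf_minus)
  show ?thesis
  proof (rule that[of c])
    fix t assume p2: "p \<noteq> 2" and t: "\<bar>t\<bar> \<noteq> t0"
    have r_mono: "(p - 2) * (r a - r b) > 0" if "0 < a" "a < b" for a b
    proof -
      have D: "odd_moment p s (p - 1) t > 0" if "t > 0" for t by (rule odd_moment_pos[OF that odd_integrable_p[OF p s]])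
      have "(p - 2) * (r a - r b) = (p - 2) * (odd_moment p s (p - 1) b * odd_moment p s 1 a - odd_moment p s (p - 1) a * odd_moment p s 1 b)
         / (odd_moment p s (p - 1) b * odd_moment p s (p - 1) a * (p * s))"
        using D[of a] D[of b] that p s by (simp add: r_def field_simps)
      also have "\<dots> > 0"
        by (rule divide_pos_pos[OF odd_moment_ratio_mono[OF p p2 s that]]) (use D[of a] D[of b] that p s in simp)
      finally show ?thesis .
    qed
    have "(p - 2) * G \<bar>t\<bar> < (p - 2) * G t0"
    proof (cases "\<bar>t\<bar> < t0")
      case True
      show ?thesis
      proof (rule DERIV_pos_imp_increasing_open[OF True])
        fix x assume x: "\<bar>t\<bar> < x" "x < t0"
        then have x0: "x > 0" by linarith
        have "((\<lambda>x. (p - 2) * G x) has_real_derivative (p - 2) * (x * (r x - r t0))) (at x)"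
          by (rule DERIV_cmult[OF DG[OF x0]])
        moreover have "(p - 2) * (x * (r x - r t0)) > 0"
          using mult_pos_pos[OF x0 r_mono[OF x0 x(2)]] by (simp add: mult_ac)
        ultimately show "\<exists>d. ((\<lambda>x. (p - 2) * G x) has_real_derivative d) (at x) \<and> 0 < d" by blast
      qed (intro continuous_intros contG)
    next
      case False
      then have lt: "t0 < \<bar>t\<bar>" using t by simp
      show ?thesis
      proof (rule DERIV_neg_imp_decreasing_open[OF lt])
        fix x assume x: "t0 < x" "x < \<bar>t\<bar>"
        then have x0: "x > 0" using t0 by linarith
        have "((\<lambda>x. (p - 2) * G x) has_real_derivative (p - 2) * (x * (r x - r t0))) (at x)"
          by (rule DERIV_cmult[OF DG[OF x0]])
        moreover have "(p - 2) * (x * (r x - r t0)) < 0"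
          using mult_pos_pos[OF x0 r_mono[OF t0 x(1)]] by (simp add: algebra_simps)
        ultimately show "\<exists>d. ((\<lambda>x. (p - 2) * G x) has_real_derivative d) (at x) \<and> d < 0" by blast
      qed (intro continuous_intros contG)
    qed
    then have "(p - 2) * G t < (p - 2) * G t0" using even[of t] by simp
    then show "(p - 2) * (ln (Zf p t0 s) + c * (t\<^sup>2 - t0\<^sup>2) - ln (Zf p t s)) > 0"
      by (simp add: G_def algebra_simps)
  next
    fix t assume p2: "p = 2"
    \<comment> \<open>For \<open>p = 2\<close> the exponents \<open>1\<close> and
      \<open>p - 1\<close> coincide, so the ratio of moments is constant.\<close>
    have r: "r a = r t0" if "a > 0" for a
    proof -
      have "r a = 1 / (2 * s)" if "a > 0" for a
        using odd_moment_pos[OF that odd_integrable_p[OF p s]] by (simp add: r_def p2)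
      then show ?thesis using that t0 by simp
    qed
    have DG0: "(G has_real_derivative 0) (at a)" if "a > 0" for a
      using DG[OF that] unfolding r[OF that] by simp
    have "G \<bar>t\<bar> = G t0"
    proof (cases "\<bar>t\<bar>" t0 rule: linorder_cases)
      case less
      show ?thesis
        by (rule DERIV_isconst_end[OF less contG, symmetric]) (use DG0 in auto)
    next
      case greater
      show ?thesis
        by (rule DERIV_isconst_end[OF greater contG]) (use DG0 t0 in auto)
    qed simp
    then have "G t = G t0" using even[of t] by simp
    then show "ln (Zf p t s) = ln (Zf p t0 s) + c * (t\<^sup>2 - t0\<^sup>2)"
      by (simp add: G_def algebra_simps)
  qed
qed

section \<open>Jensen's inequality for the Gaussian average\<close>

text \<open>The points \<open>1\<close> and \<open>-1\<close> are exempted because the tangent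
  touches the function there; the Gaussian measure does not charge them.\<close>

lemma integral_mu_2_pos:
  fixes f :: "real \<Rightarrow> real"
  assumes i: "integrable (mu 2) f" and f: "\<And>u. \<bar>u\<bar> \<noteq> 1 \<Longrightarrow> f u > 0" "f 1 \<ge> 0" "f (-1) \<ge> 0"
  shows "(\<integral>u. f u \<partial>mu 2) > 0"
proof -
  interpret prob_space "mu 2" by (rule prob_space_mu_2)
  have nn: "f u \<ge> 0" for u
    using f(1)[of u] f(2,3) by (cases "\<bar>u\<bar> = 1") (auto simp: abs_if less_imp_le split: if_splits)
  have a: "AE u in mu 2. \<bar>u\<bar> \<noteq> 1"
  proof -
    have "AE u in lborel. u \<noteq> 1 \<and> u \<noteq> (-1::real)"
      using AE_lborel_singleton[of 1] AE_lborel_singleton[of "-1::real"] by eventually_elim auto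
    then have "AE u in lborel. 0 < ennreal (std_normal_density u) \<longrightarrow> \<bar>u\<bar> \<noteq> 1"
      by eventually_elim auto
    then show ?thesis unfolding mu_2_eq by (subst AE_density) auto
  qed
  have "(\<integral>u. f u \<partial>mu 2) \<noteq> 0"
  proof
    assume "(\<integral>u. f u \<partial>mu 2) = 0"
    then have "AE u in mu 2. f u = 0"
      using i nn by (subst (asm) integral_nonneg_eq_0_iff_AE) auto
    with a have "AE u in mu 2. False"
    proof eventually_elim
      case (elim u)
      then show ?case using f(1)[of u] by auto
    qed
    then show False by simp
  qed
  moreover have "(\<integral>u. f u \<partial>mu 2) \<ge> 0" by (rule Bochner_Integration.integral_nonneg) (rule nn)
  ultimately show ?thesis by linarith
qed

text \<open>Jensen by integrating the tangent at \<open>t\<close> evaluated at \<open>t * u\<close>: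
  its linear part \<open>c * (t\<^sup>2 * u\<^sup>2 - t\<^sup>2)\<close> has Gaussian mean zero.
  Strictness comes from the gap being positive off \<open>u = 1\<close> and
  \<open>u = -1\<close>.\<close>

lemma Psi_fin_compare_pos:
  assumes p: "p > 1" and s: "s > 0" and t: "t > 0"
  shows "p \<noteq> 2 \<Longrightarrow> (p - 2) * (ln (Zf p t s) - Psi_fin p t s) > 0"
    and "p = 2 \<Longrightarrow> Psi_fin p t s = ln (Zf p t s)"
proof -
  interpret prob_space "mu 2" by (rule prob_space_mu_2)
  obtain c where c: "\<And>t'. p \<noteq> 2 \<Longrightarrow> \<bar>t'\<bar> \<noteq> t \<Longrightarrow> (p - 2) * (ln (Zf p t s) + c * (t'\<^sup>2 - t\<^sup>2) - ln (Zf p t' s)) > 0"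
    "\<And>t'. p = 2 \<Longrightarrow> ln (Zf p t' s) = ln (Zf p t s) + c * (t'\<^sup>2 - t\<^sup>2)"
    using ln_Zf_tangent[OF p s t] by metis
  define f where "f u = (p - 2) * (ln (Zf p t s) + c * (t\<^sup>2 * u\<^sup>2 - t\<^sup>2) - ln (Zf p (t * u) s))" for u
  note i = ln_Zf_mu_2_integrable[OF p s, of t] mu_2_square
  have int: "(\<integral>u. ln (Zf p t s) + c * (t\<^sup>2 * u\<^sup>2 - t\<^sup>2) \<partial>mu 2) = ln (Zf p t s)"
    using i by simp
  {
    assume p2: "p \<noteq> 2"
    have "integrable (mu 2) f" unfolding f_def using i by simp
    then have "(\<integral>u. f u \<partial>mu 2) > 0"
    proof (rule integral_mu_2_pos)
      show "f u > 0" if "\<bar>u\<bar> \<noteq> 1" for u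
        using c(1)[OF p2, of "t * u"] that t by (simp add: f_def power_mult_distrib abs_mult)
    qed (auto simp: f_def Zf_minus)
    also have "(\<integral>u. f u \<partial>mu 2) = (p - 2) * (ln (Zf p t s) - Psi_fin p t s)"
      unfolding f_def Psi_fin_def using i int by simp
    finally show "(p - 2) * (ln (Zf p t s) - Psi_fin p t s) > 0" .
  }
  {
    assume p2: "p = 2"
    show "Psi_fin p t s = ln (Zf p t s)"
      unfolding Psi_fin_def using c(2)[OF p2, of "t * _"] int by (simp add: power_mult_distrib)
  }
qed

lemma Psi_fin_minus: "Psi_fin p (- t) s = Psi_fin p t s"
  by (simp add: Psi_fin_def Zf_minus)

lemma
  assumes p: "p > 1" and s: "s > 0"
  shows Psi_fin_less: "p > 2 \<Longrightarrow> t \<noteq> 0 \<Longrightarrow> Psi_fin p t s < ln (Zf p t s)"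
    and Psi_fin_greater: "p < 2 \<Longrightarrow> t \<noteq> 0 \<Longrightarrow> Psi_fin p t s > ln (Zf p t s)"
    and Psi_fin_2: "p = 2 \<Longrightarrow> Psi_fin p t s = ln (Zf p t s)"
proof -
  have e: "Psi_fin p \<bar>t\<bar> s = Psi_fin p t s" "Zf p \<bar>t\<bar> s = Zf p t s"
    by (auto simp: abs_if Psi_fin_minus Zf_minus)
  show "Psi_fin p t s < ln (Zf p t s)" if "p > 2" "t \<noteq> 0"
    using Psi_fin_compare_pos(1)[OF p s, of "\<bar>t\<bar>"] that e by (simp add: zero_less_mult_iff)
  show "Psi_fin p t s > ln (Zf p t s)" if "p < 2" "t \<noteq> 0"
    using Psi_fin_compare_pos(1)[OF p s, of "\<bar>t\<bar>"] that e by (simp add: zero_less_mult_iff)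
  show "Psi_fin p t s = ln (Zf p t s)" if "p = 2"
    using Psi_fin_compare_pos(2)[OF p s, of "\<bar>t\<bar>"] that e by (cases "t = 0") (auto simp: Psi_fin_0)
qed

section \<open>Strict comparison of the two suprema\<close>

lemma rate_sup_attained:
  assumes "s0 > 0" "\<And>t s. s > 0 \<Longrightarrow> t * w - s - \<Phi> t s \<le> t0 * w - s0 - \<Phi> t0 s0"
  shows "rate_sup \<Phi> p w = ereal (t0 * w - s0 - \<Phi> t0 s0 + (1/p + ln (Zf p 0 (1/p))))"
proof (rule antisym)
  show "rate_sup \<Phi> p w \<le> ereal (t0 * w - s0 - \<Phi> t0 s0 + (1/p + ln (Zf p 0 (1/p))))"
    by (rule rate_sup_least) (use assms in auto)
qed (rule rate_sup_upper[OF assms(1)])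

lemma rate_sup_mono:
  assumes "\<And>t s. s > 0 \<Longrightarrow> \<Phi> t s \<le> \<Phi>' t s"
  shows "rate_sup \<Phi>' p w \<le> rate_sup \<Phi> p w"
proof (rule rate_sup_least)
  fix t s :: real assume s: "s > 0"
  show "ereal (t * w - s - \<Phi>' t s + (1 / p + ln (Zf p 0 (1 / p)))) \<le> rate_sup \<Phi> p w"
    by (rule order_trans[OF _ rate_sup_upper[OF s, of t]]) (use assms[OF s, of t] in simp)
qed

text \<open>By symmetry \<open>ln Zf\<close> has zero derivative in \<open>t\<close> at 0, whereas
  the first-order condition demands the derivative \<open>w\<close>.\<close>

lemma maximiser_nonzero:
  assumes p: "p > 1" and "s0 > 0" "w \<noteq> 0"
    and "\<And>t s. s > 0 \<Longrightarrow> t * w - s - ln (Zf p t s) \<le> t0 * w - s0 - ln (Zf p t0 s0)"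
  shows "t0 \<noteq> 0"
proof
  assume t0: "t0 = 0"
  have "((\<lambda>t. ln (Zf p t s0)) has_real_derivative w) (at 0)"
    using first_order_conditions(1)[OF p assms(2,4)] t0 by simp
  moreover have "((\<lambda>t. ln (Zf p t s0)) has_real_derivative 0) (at 0)"
  proof -
    have Z: "Zf p 0 s0 > 0" by (rule Zf_pos[OF p assms(2)])
    have "Z1 p 0 s0 = 0" by (simp add: Z1_eq_odd_moment[OF p assms(2)] odd_moment_def tilt_odd_def)
    then show ?thesis using DERIV_chain2[OF DERIV_ln[OF Z] DERIV_Zf_t[OF p assms(2)]] by simp
  qed
  ultimately show False using DERIV_unique assms(3) by blast
qed

lemma I_cr_I_qu_0:
  assumes "p > 1"
  shows "I_cr p 0 = 0" "I_qu p (mu 2) 0 = 0"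
  unfolding I_cr_eq[OF assms] I_qu_eq[OF assms]
  by (intro rate_sup_0_eq assms ln_Zf_ge_0 Psi_fin_ge_0 Psi_fin_0 refl; assumption)+

text \<open>If \<open>w \<noteq> 0\<close>, the maximiser for \<open>ln Zf\<close> has
  \<open>t0 \<noteq> 0\<close>; there \<open>Psi_fin\<close> is strictly smaller, so the same point
  already gives a larger value in the supremum for \<open>I_qu\<close>.\<close>

theorem I_qu_I_cr_gt_2:
  assumes p: "p > 2" and w: "\<bar>w\<bar> < 1"
  shows "I_cr p w \<le> I_qu p (mu 2) w" "I_qu p (mu 2) w = I_cr p w \<longleftrightarrow> w = 0"
proof -
  have p1: "p > 1" using p by simp
  have le: "Psi_fin p t s \<le> ln (Zf p t s)" if "s > 0" for t s
    using Psi_fin_less[OF p1 that p, of t] by (cases "t = 0") (auto simp: Psi_fin_0)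
  show "I_cr p w \<le> I_qu p (mu 2) w"
    unfolding I_cr_eq[OF p1] I_qu_eq[OF p1] by (rule rate_sup_mono) (rule le)
  show "I_qu p (mu 2) w = I_cr p w \<longleftrightarrow> w = 0"
  proof
    assume eq: "I_qu p (mu 2) w = I_cr p w"
    show "w = 0"
    proof (rule ccontr)
      assume w0: "w \<noteq> 0"
      obtain t0 s0 where s0: "s0 > 0" and
        mx: "\<And>t s. s > 0 \<Longrightarrow> t * w - s - ln (Zf p t s) \<le> t0 * w - s0 - ln (Zf p t0 s0)"
        using legendre_attained[OF p1 w ln_Zf_continuous[OF p1] order_refl] by meson
      have "t0 \<noteq> 0" by (rule maximiser_nonzero[OF p1 s0 w0 mx])
      then have "Psi_fin p t0 s0 < ln (Zf p t0 s0)" by (intro Psi_fin_less p1 s0 p)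
      then have "I_cr p w < ereal (t0 * w - s0 - Psi_fin p t0 s0 + (1/p + ln (Zf p 0 (1/p))))"
        unfolding I_cr_eq[OF p1] using rate_sup_attained[OF s0 mx] by simp
      also have "\<dots> \<le> I_qu p (mu 2) w" unfolding I_qu_eq[OF p1] by (rule rate_sup_upper[OF s0])
      finally show False using eq by simp
    qed
  qed (use I_cr_I_qu_0[OF p1] in simp)
qed

text \<open>Under equality the value at a maximiser for \<open>Psi_fin\<close> bounds the whole
  supremum for \<open>ln Zf\<close>. Evaluated at the maximiser itself, this forces
  \<open>t0 = 0\<close>, where the two functions agree; hence the point maximises for
  \<open>ln Zf\<close> too, and \<open>maximiser_nonzero\<close> contradicts \<open>t0 = 0\<close>
  when \<open>w \<noteq> 0\<close>. No derivative of \<open>Psi_fin\<close> is needed.\<close>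

theorem I_qu_I_cr_less_2:
  assumes p1: "p > 1" and p: "p < 2" and w: "\<bar>w\<bar> < 1"
  shows "I_qu p (mu 2) w \<le> I_cr p w" "I_qu p (mu 2) w = I_cr p w \<longleftrightarrow> w = 0"
proof -
  have le: "ln (Zf p t s) \<le> Psi_fin p t s" if "s > 0" for t s
    using Psi_fin_greater[OF p1 that p, of t] by (cases "t = 0") (auto simp: Psi_fin_0)
  show "I_qu p (mu 2) w \<le> I_cr p w"
    unfolding I_cr_eq[OF p1] I_qu_eq[OF p1] by (rule rate_sup_mono[OF le])
  show "I_qu p (mu 2) w = I_cr p w \<longleftrightarrow> w = 0"
  proof
    assume eq: "I_qu p (mu 2) w = I_cr p w"
    show "w = 0"
    proof (rule ccontr)
      assume w0: "w \<noteq> 0"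
      obtain t0 s0 where s0: "s0 > 0" and
        mx: "\<And>t s. s > 0 \<Longrightarrow> t * w - s - Psi_fin p t s \<le> t0 * w - s0 - Psi_fin p t0 s0"
        using legendre_attained[OF p1 w Psi_fin_continuous[OF p1] le] by meson
      have val: "I_cr p w = ereal (t0 * w - s0 - Psi_fin p t0 s0 + (1/p + ln (Zf p 0 (1/p))))"
        unfolding eq[symmetric] I_qu_eq[OF p1] by (rule rate_sup_attained[OF s0 mx])
      have bound: "t * w - s - ln (Zf p t s) \<le> t0 * w - s0 - Psi_fin p t0 s0" if "s > 0" for t s
        using rate_sup_upper[OF that, of t w "\<lambda>t s. ln (Zf p t s)" p] val
        unfolding I_cr_eq[OF p1] by simp
      have t0: "t0 = 0"
      proof (rule ccontr)
        assume "t0 \<noteq> 0"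
        then show False using bound[OF s0, of t0] Psi_fin_greater[OF p1 s0 p, of t0] by linarith
      qed
      then have mx0:  "t * w - s - ln (Zf p t s) \<le> t0 * w - s0 - ln (Zf p t0 s0)" if "s > 0" for t s
        using bound[OF that, of t] by (simp add: Psi_fin_0)
      show False using maximiser_nonzero[OF p1 s0 w0 mx0] t0 by simp
    qed
  qed (use I_cr_I_qu_0[OF p1] in simp)
qed

theorem I_qu_I_cr_2: "I_qu 2 (mu 2) w = I_cr 2 w"
proof -
  have "rate_sup (Psi_fin 2) 2 w = rate_sup (\<lambda>t s. ln (Zf 2 t s)) 2 w"
    by (intro antisym rate_sup_mono) (simp_all add: Psi_fin_2)
  then show ?thesis by (simp add: I_cr_eq I_qu_eq)
qed


section \<open>Volume estimates\<close>


declare One_nat_def [simp del]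

abbreviation coord_sum :: "nat \<Rightarrow> (nat \<Rightarrow> real) \<Rightarrow> real" where
  "coord_sum n x \<equiv> (\<Sum>i=1..n. x i)"

abbreviation powr_sum :: "real \<Rightarrow> nat \<Rightarrow> (nat \<Rightarrow> real) \<Rightarrow> real" where
  "powr_sum p n x \<equiv> (\<Sum>i=1..n. \<bar>x i\<bar> powr p)"

text \<open>The product of the one-dimensional tilts at \<open>c * x i\<close>, written through the
  two sums on which all later sets depend. The dilation \<open>c\<close> will be
  \<open>n powr (1/p)\<close>, or this number divided by a contraction factor.\<close>

definition ptilt :: "real \<Rightarrow> nat \<Rightarrow> real \<Rightarrow> real \<Rightarrow> real \<Rightarrow> (nat \<Rightarrow> real) \<Rightarrow> real" where
  "ptilt p n c t s x = exp (t * (c * coord_sum n x) - s * (c powr p * powr_sum p n x))"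

lemma coord_sum_measurable [measurable]: "coord_sum n \<in> borel_measurable (lborel_Rn n)"
  by measurable

lemma powr_sum_measurable [measurable]: "powr_sum p n \<in> borel_measurable (lborel_Rn n)"
  by measurable

lemma ptilt_measurable [measurable]: "ptilt p n c t s \<in> borel_measurable (lborel_Rn n)"
  unfolding ptilt_def by measurable

lemma nn_integral_ptilt:
  assumes p: "p > 1" and s: "s > 0" and c: "c > 0"
  shows "(\<integral>\<^sup>+ x. ennreal (ptilt p n c t s x) \<partial>lborel_Rn n) = ennreal ((Zf p t s / c) ^ n)"
proof -
  interpret product_sigma_finite "\<lambda>_::nat. lborel :: real measure" by unfold_locales
  have "ennreal (ptilt p n c t s x) = (\<Prod>i\<in>{1..n}. ennreal (tilt p t s (c * x i)))" for x
  proof -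
    have "(\<Prod>i\<in>{1..n}. tilt p t s (c * x i)) = exp (\<Sum>i=1..n. t * (c * x i) - s * \<bar>c * x i\<bar> powr p)"
      by (simp add: tilt_def exp_sum)
    also have "(\<Sum>i=1..n. t * (c * x i) - s * \<bar>c * x i\<bar> powr p) = t * (c * coord_sum n x) - s * (c powr p * powr_sum p n x)"
      using c by (simp add: sum_subtractf sum_distrib_left abs_mult powr_mult)
    finally show ?thesis by (simp add: ptilt_def prod_ennreal)
  qed
  then have "(\<integral>\<^sup>+ x. ennreal (ptilt p n c t s x) \<partial>lborel_Rn n)
    = (\<integral>\<^sup>+ x. (\<Prod>i\<in>{1..n}. ennreal (tilt p t s (c * x i))) \<partial>lborel_Rn n)" by simp
  also have "\<dots> = (\<Prod>i\<in>{1..n}. \<integral>\<^sup>+ y. ennreal (tilt p t s (c * y)) \<partial>lborel)"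
    by (rule product_nn_integral_prod) auto
  also have "(\<integral>\<^sup>+ y. ennreal (tilt p t s (c * y)) \<partial>lborel) = ennreal (Zf p t s / c)"
    unfolding tilt_scale[OF c] using nn_integral_tilt[OF p, of "c powr p * s" "c * t"] s c by (simp add: Zf_scale)
  finally show ?thesis using Zf_pos[OF p s, of t] c by (simp add: ennreal_power)
qed

lemma volume_chernoff:
  assumes p: "p > 1" and s: "s > 0" and c: "c > 0" and A[measurable]: "A \<in> sets (lborel_Rn n)"
    and ge: "\<And>x. x \<in> A \<Longrightarrow> real n * b \<le> t * (c * coord_sum n x) - s * (c powr p * powr_sum p n x)"
  shows "emeasure (lborel_Rn n) A \<le> ennreal (exp (real n * (ln (Zf p t s) - b)) / c ^ n)"
proof -
  have Z: "Zf p t s > 0" by (rule Zf_pos[OF p s])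
  have "emeasure (lborel_Rn n) A = (\<integral>\<^sup>+ x. indicator A x \<partial>lborel_Rn n)" by simp
  also have "\<dots> \<le> (\<integral>\<^sup>+ x. ennreal (exp (- (real n * b))) * ennreal (ptilt p n c t s x) \<partial>lborel_Rn n)"
  proof (intro nn_integral_mono)
    fix x
    show "indicator A x \<le> ennreal (exp (- (real n * b))) * ennreal (ptilt p n c t s x)"
    proof (cases "x \<in> A")
      case True
      then have "1 \<le> exp (- (real n * b)) * ptilt p n c t s x"
        using ge[OF True] by (simp add: ptilt_def exp_add[symmetric])
      then have "ennreal 1 \<le> ennreal (exp (- (real n * b)) * ptilt p n c t s x)" by (rule ennreal_leI)
      then show ?thesis using True by (simp add: ennreal_mult ptilt_def)
    qed simp
  qed
  also have "\<dots> = ennreal (exp (- (real n * b)) * (Zf p t s / c) ^ n)"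
    using Z c by (subst nn_integral_cmult) (auto simp: nn_integral_ptilt[OF p s c] ennreal_mult)
  also have "exp (- (real n * b)) * (Zf p t s / c) ^ n = exp (real n * (ln (Zf p t s) - b)) / c ^ n"
  proof -
    have "Zf p t s ^ n = exp (real n * ln (Zf p t s))" using Z by (simp add: exp_of_nat_mult)
    then show ?thesis by (simp add: power_divide right_diff_distrib exp_diff exp_minus field_simps)
  qed
  finally show ?thesis .
qed

text \<open>Markov's inequality under the tilted measure: an extra exponential weight only moves the
  parameters to \<open>(t + a, s - b)\<close>, so its integral is again explicit.\<close>

lemma tilted_bad_set:
  assumes p: "p > 1" and s: "s - b > 0" and c: "c > 0" and A[measurable]: "A \<in> sets (lborel_Rn n)"
    and ge: "\<And>x. x \<in> A \<Longrightarrow> real n * \<kappa> \<le> a * (c * coord_sum n x) + b * (c powr p * powr_sum p n x)"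
  shows "(\<integral>\<^sup>+ x. ennreal (ptilt p n c t s x) * indicator A x \<partial>lborel_Rn n)
    \<le> ennreal (exp (real n * (ln (Zf p (t + a) (s - b)) - \<kappa>)) / c ^ n)"
proof -
  have Z: "Zf p (t + a) (s - b) > 0" by (rule Zf_pos[OF p s])
  have "(\<integral>\<^sup>+ x. ennreal (ptilt p n c t s x) * indicator A x \<partial>lborel_Rn n)
    \<le> (\<integral>\<^sup>+ x. ennreal (exp (- (real n * \<kappa>))) * ennreal (ptilt p n c (t + a) (s - b) x) \<partial>lborel_Rn n)"
  proof (intro nn_integral_mono)
    fix x
    show "ennreal (ptilt p n c t s x) * indicator A x \<le> ennreal (exp (- (real n * \<kappa>))) * ennreal (ptilt p n c (t + a) (s - b) x)"
    proof (cases "x \<in> A")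
      case True
      then have "ptilt p n c t s x \<le> exp (- (real n * \<kappa>)) * ptilt p n c (t + a) (s - b) x"
        using ge[OF True] by (simp add: ptilt_def exp_add[symmetric] algebra_simps)
      then have "ennreal (ptilt p n c t s x) \<le> ennreal (exp (- (real n * \<kappa>)) * ptilt p n c (t + a) (s - b) x)" by (rule ennreal_leI)
      then show ?thesis using True by (simp add: ennreal_mult ptilt_def)
    qed simp
  qed
  also have "\<dots> = ennreal (exp (- (real n * \<kappa>)) * (Zf p (t + a) (s - b) / c) ^ n)"
    using Z c by (subst nn_integral_cmult) (auto simp: nn_integral_ptilt[OF p s c] ennreal_mult)
  also have "exp (- (real n * \<kappa>)) * (Zf p (t + a) (s - b) / c) ^ n = exp (real n * (ln (Zf p (t + a) (s - b)) - \<kappa>)) / c ^ n"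
  proof -
    have "Zf p (t + a) (s - b) ^ n = exp (real n * ln (Zf p (t + a) (s - b)))" using Z by (simp add: exp_of_nat_mult)
    then show ?thesis by (simp add: power_divide right_diff_distrib exp_diff exp_minus field_simps)
  qed
  finally show ?thesis .
qed

text \<open>Yields a step at which the function lies strictly below the line of slope
  \<open>D + \<delta>\<close>; this makes the Chernoff exponent of a deviation by
  \<open>\<delta>\<close> negative. The cap \<open>r\<close> serves to keep a decreased
  \<open>s\<close> positive.\<close>

lemma DERIV_increment_less:
  fixes f :: "real \<Rightarrow> real"
  assumes "(f has_real_derivative D) (at x)" "\<delta> > 0" "r > 0"
  obtains \<epsilon> where "0 < \<epsilon>" "\<epsilon> < r" "f (x + \<epsilon>) - f x < \<epsilon> * (D + \<delta>)"
proof -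
  have "((\<lambda>y. f y - (D + \<delta>) * y) has_real_derivative D - (D + \<delta>)) (at x)"
    by (rule derivative_eq_intros assms refl | simp)+
  then obtain d where d: "d > 0" "\<And>h. h > 0 \<Longrightarrow> h < d \<Longrightarrow> f (x + h) - (D + \<delta>) * (x + h) < f x - (D + \<delta>) * x"
    using DERIV_neg_dec_right[of "\<lambda>y. f y - (D + \<delta>) * y" "D - (D + \<delta>)" x] assms(2) by auto
  define h where "h = min d r / 2"
  have "h > 0" "h < d" "h < r" using d assms by (auto simp: h_def)
  then show ?thesis using that[of h] d(2)[of h] by (simp add: algebra_simps)
qed

lemma DERIV_decrement_less:
  fixes f :: "real \<Rightarrow> real"
  assumes "(f has_real_derivative D) (at x)" "\<delta> > 0" "r > 0"
  obtains \<epsilon> where "0 < \<epsilon>" "\<epsilon> < r" "f (x - \<epsilon>) - f x < \<epsilon> * (\<delta> - D)"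
proof -
  have "((\<lambda>y. f (- y)) has_real_derivative - D) (at (- x))"
    using DERIV_mirror[of f D "- x"] assms(1) by simp
  from DERIV_increment_less[OF this assms(2,3)] obtain \<epsilon> where
    "0 < \<epsilon>" "\<epsilon> < r" "f (- (- x + \<epsilon>)) - f (- (- x)) < \<epsilon> * (- D + \<delta>)" by blast
  then show ?thesis using that[of \<epsilon>] by simp
qed

text \<open>The tilted measure concentrates where the two empirical means are close to their expectations
  \<open>w\<close> and \<open>1\<close>; the exceptional half-spaces are controlled by tilting once more.\<close>
lemma volume_tilted_lower:
  assumes p: "p > 1" and s0: "s0 > 0" and \<delta>: "\<delta> > 0"
    and Dt: "((\<lambda>t. ln (Zf p t s0)) has_real_derivative w) (at t0)"
    and Ds: "((\<lambda>s. ln (Zf p t0 s)) has_real_derivative -1) (at s0)"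
  shows "\<exists>N. \<forall>n\<ge>N. \<forall>c>0. ennreal (exp (real n * (ln (Zf p t0 s0) - t0 * w + s0 - (\<bar>t0\<bar> + s0) * \<delta>)) / (2 * c ^ n))
     \<le> emeasure (lborel_Rn n) {x \<in> space (lborel_Rn n).
         \<bar>c * coord_sum n x - real n * w\<bar> \<le> real n * \<delta> \<and> \<bar>c powr p * powr_sum p n x - real n\<bar> \<le> real n * \<delta>}"
proof -
  define L where "L = ln (Zf p t0 s0)"
  obtain e1 where e1: "0 < e1" "ln (Zf p (t0 + e1) s0) - L < e1 * (w + \<delta>)"
    using DERIV_increment_less[OF Dt \<delta> zero_less_one] unfolding L_def by metis
  obtain e2 where e2: "0 < e2" "ln (Zf p (t0 - e2) s0) - L < e2 * (\<delta> - w)"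
    using DERIV_decrement_less[OF Dt \<delta> zero_less_one] unfolding L_def by metis
  obtain e3 where e3: "0 < e3" "ln (Zf p t0 (s0 + e3)) - L < e3 * (- 1 + \<delta>)"
    using DERIV_increment_less[OF Ds \<delta> zero_less_one] unfolding L_def by metis
  obtain e4 where e4: "0 < e4" "e4 < s0" "ln (Zf p t0 (s0 - e4)) - L < e4 * (\<delta> - - 1)"
    using DERIV_decrement_less[OF Ds \<delta> s0] unfolding L_def by metis
  \<comment> \<open>The exponential rates of the four exceptional half-spaces relative to the total
    tilted mass; the choice of the steps makes all of them negative.\<close>
  define d1 d2 d3 d4 where "d1 = ln (Zf p (t0 + e1) s0) - L - e1 * (w + \<delta>)"
    and "d2 = ln (Zf p (t0 - e2) s0) - L - e2 * (\<delta> - w)"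
    and "d3 = ln (Zf p t0 (s0 + e3)) - L - e3 * (\<delta> - 1)"
    and "d4 = ln (Zf p t0 (s0 - e4)) - L - e4 * (\<delta> + 1)"
  have d: "d1 < 0" "d2 < 0" "d3 < 0" "d4 < 0" using e1 e2 e3 e4 by (auto simp: d1_def d2_def d3_def d4_def)
  have lim: "(\<lambda>n. exp (real n * a)) \<longlonglongrightarrow> 0" if "a < 0" for a
  proof -
    have "(\<lambda>n. exp a ^ n) \<longlonglongrightarrow> 0" using that by (intro LIMSEQ_realpow_zero) auto
    then show ?thesis by (simp add: exp_of_nat_mult)
  qed
  have "(\<lambda>n. exp (real n * d1) + exp (real n * d2) + exp (real n * d3) + exp (real n * d4)) \<longlonglongrightarrow> 0 + 0 + 0 + 0"
    by (intro tendsto_add lim d)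
  then have "\<forall>\<^sub>F n in sequentially. exp (real n * d1) + exp (real n * d2) + exp (real n * d3) + exp (real n * d4) < 1/2"
    by (rule order_tendstoD) simp
  \<comment> \<open>\<open>N\<close> depends only on the rates and not on \<open>c\<close>, which
    cancels against the total mass \<open>Q\<close>. This uniformity matters because the dilation
    used later varies with \<open>n\<close>.\<close>
  then obtain N where N: "\<And>n. n \<ge> N \<Longrightarrow> exp (real n * d1) + exp (real n * d2) + exp (real n * d3) + exp (real n * d4) < 1/2"
    unfolding eventually_sequentially by blast
  show ?thesis
  proof (intro exI[of _ N] allI impI)
    fix n :: nat and c :: real assume n: "n \<ge> N" and c: "c > 0"
    define G where "G = {x \<in> space (lborel_Rn n).
         \<bar>c * coord_sum n x - real n * w\<bar> \<le> real n * \<delta> \<and> \<bar>c powr p * powr_sum p n x - real n\<bar> \<le> real n * \<delta>}"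
    define B1 where "B1 = {x \<in> space (lborel_Rn n). real n * (w + \<delta>) \<le> c * coord_sum n x}"
    define B2 where "B2 = {x \<in> space (lborel_Rn n). c * coord_sum n x \<le> real n * (w - \<delta>)}"
    define B3 where "B3 = {x \<in> space (lborel_Rn n). c powr p * powr_sum p n x \<le> real n * (1 - \<delta>)}"
    define B4 where "B4 = {x \<in> space (lborel_Rn n). real n * (1 + \<delta>) \<le> c powr p * powr_sum p n x}"
    have [measurable]: "G \<in> sets (lborel_Rn n)" "B1 \<in> sets (lborel_Rn n)" "B2 \<in> sets (lborel_Rn n)"
      "B3 \<in> sets (lborel_Rn n)" "B4 \<in> sets (lborel_Rn n)"
      unfolding G_def B1_def B2_def B3_def B4_def by measurable
    define E where "E A = (\<integral>\<^sup>+ x. ennreal (ptilt p n c t0 s0 x) * indicator A x \<partial>lborel_Rn n)" for A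
    define Q where "Q = exp (real n * L) / c ^ n"
    have Q0: "Q > 0" using c by (simp add: Q_def)
    have fac: "exp (real n * (l - k)) / c ^ n = exp (real n * (l - L - k)) * Q" for l k
      by (simp add: Q_def exp_add[symmetric] algebra_simps)
    have b1: "E B1 \<le> ennreal (exp (real n * d1) * Q)"
      using tilted_bad_set[OF p _ c, of s0 0 B1 n "e1 * (w + \<delta>)" e1 t0] s0 e1
      unfolding E_def fac d1_def by (auto simp: B1_def mult.left_commute)
    have b2: "E B2 \<le> ennreal (exp (real n * d2) * Q)"
    proof -
      have "real n * (e2 * (\<delta> - w)) \<le> - e2 * (c * coord_sum n x)" if "x \<in> B2" for x
        using mult_left_mono[of "c * coord_sum n x" "real n * (w - \<delta>)" e2] that e2 by (simp add: B2_def algebra_simps)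
      then show ?thesis
        using tilted_bad_set[OF p _ c, of s0 0 B2 n "e2 * (\<delta> - w)" "- e2" t0] s0 e2
        unfolding E_def fac d2_def by auto
    qed
    have b3: "E B3 \<le> ennreal (exp (real n * d3) * Q)"
    proof -
      have "real n * (e3 * (\<delta> - 1)) \<le> - e3 * (c powr p * powr_sum p n x)" if "x \<in> B3" for x
        using mult_left_mono[of "c powr p * powr_sum p n x" "real n * (1 - \<delta>)" e3] that e3 by (simp add: B3_def algebra_simps)
      then show ?thesis
        using tilted_bad_set[OF p _ c, of s0 "- e3" B3 n "e3 * (\<delta> - 1)" 0 t0] s0 e3
        unfolding E_def fac d3_def by auto
    qed
    have b4: "E B4 \<le> ennreal (exp (real n * d4) * Q)"
    proof -
      have "real n * (e4 * (\<delta> + 1)) \<le> e4 * (c powr p * powr_sum p n x)" if "x \<in> B4" for x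
        using mult_left_mono[of "real n * (1 + \<delta>)" "c powr p * powr_sum p n x" e4] that e4 by (simp add: B4_def algebra_simps)
      then show ?thesis
        using tilted_bad_set[OF p _ c, of s0 e4 B4 n "e4 * (\<delta> + 1)" 0 t0] s0 e4
        unfolding E_def fac d4_def by auto
    qed
    have tot: "E (space (lborel_Rn n)) = ennreal Q"
    proof -
      have "E (space (lborel_Rn n)) = ennreal ((Zf p t0 s0 / c) ^ n)"
        unfolding E_def nn_integral_ptilt[OF p s0 c, symmetric] by (intro nn_integral_cong) simp
      also have "(Zf p t0 s0 / c) ^ n = Q"
        using Zf_pos[OF p s0, of t0] by (simp add: Q_def L_def power_divide exp_of_nat_mult)
      finally show ?thesis .
    qed
    have "E (space (lborel_Rn n)) \<le> E G + (E B1 + E B2 + E B3 + E B4)"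
    proof -
      have "E (space (lborel_Rn n)) \<le> (\<integral>\<^sup>+ x. ennreal (ptilt p n c t0 s0 x) * indicator G x +
         (ennreal (ptilt p n c t0 s0 x) * indicator B1 x + ennreal (ptilt p n c t0 s0 x) * indicator B2 x +
          ennreal (ptilt p n c t0 s0 x) * indicator B3 x + ennreal (ptilt p n c t0 s0 x) * indicator B4 x) \<partial>lborel_Rn n)"
        unfolding E_def
      proof (intro nn_integral_mono)
        fix x assume x: "x \<in> space (lborel_Rn n)"
        have "x \<in> G \<union> B1 \<union> B2 \<union> B3 \<union> B4"
          using x by (auto simp: G_def B1_def B2_def B3_def B4_def algebra_simps abs_le_iff)
        then show "ennreal (ptilt p n c t0 s0 x) * indicator (space (lborel_Rn n)) x \<le> ennreal (ptilt p n c t0 s0 x) * indicator G x +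
         (ennreal (ptilt p n c t0 s0 x) * indicator B1 x + ennreal (ptilt p n c t0 s0 x) * indicator B2 x +
          ennreal (ptilt p n c t0 s0 x) * indicator B3 x + ennreal (ptilt p n c t0 s0 x) * indicator B4 x)"
          using x unfolding distrib_left[symmetric]
          by (intro mult_left_mono) (auto simp: indicator_def)
      qed
      also have "\<dots> = E G + (E B1 + E B2 + E B3 + E B4)"
        unfolding E_def by (simp add: nn_integral_add)
      finally show ?thesis .
    qed
    also have "E B1 + E B2 + E B3 + E B4 \<le> ennreal (Q / 2)"
    proof -
      have "E B1 + E B2 + E B3 + E B4 \<le> ennreal (exp (real n * d1) * Q) + ennreal (exp (real n * d2) * Q)
          + ennreal (exp (real n * d3) * Q) + ennreal (exp (real n * d4) * Q)"
        by (intro add_mono b1 b2 b3 b4)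
      also have "\<dots> = ennreal ((exp (real n * d1) + exp (real n * d2) + exp (real n * d3) + exp (real n * d4)) * Q)"
        using Q0 by (simp add: ennreal_plus[symmetric] distrib_right del: ennreal_plus)
      also have "\<dots> \<le> ennreal (1/2 * Q)"
        using N[OF n] Q0 by (intro ennreal_leI mult_right_mono) auto
      finally show ?thesis by simp
    qed
    finally have "ennreal Q \<le> E G + ennreal (Q / 2)" unfolding tot by simp
    then have EG: "ennreal (Q / 2) \<le> E G"
    proof (cases "E G")
      case (real r)
      then have "ennreal Q \<le> ennreal (r + Q / 2)" using \<open>ennreal Q \<le> _\<close> Q0 by (simp add: ennreal_plus[symmetric] del: ennreal_plus)
      then have "Q \<le> r + Q / 2" using real Q0 by (subst (asm) ennreal_le_iff) auto
      then show ?thesis using real by (auto intro!: ennreal_leI)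
    qed simp
    \<comment> \<open>An upper bound, per coordinate, for the exponent of the tilt on
      \<open>G\<close>; dividing by \<open>exp (real n * H)\<close> turns tilted mass into Lebesgue
      volume.\<close>
    define H where "H = t0 * w - s0 + (\<bar>t0\<bar> + s0) * \<delta>"
    have "E G \<le> (\<integral>\<^sup>+ x. ennreal (exp (real n * H)) * indicator G x \<partial>lborel_Rn n)"
      unfolding E_def
    proof (intro nn_integral_mono)
      fix x
      show "ennreal (ptilt p n c t0 s0 x) * indicator G x \<le> ennreal (exp (real n * H)) * indicator G x"
      proof (cases "x \<in> G")
        case True
        then have g: "\<bar>c * coord_sum n x - real n * w\<bar> \<le> real n * \<delta>" "\<bar>c powr p * powr_sum p n x - real n\<bar> \<le> real n * \<delta>"
          by (auto simp: G_def)
        have "t0 * (c * coord_sum n x - real n * w) \<le> \<bar>t0\<bar> * (real n * \<delta>)"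
          using mult_left_mono[OF g(1), of "\<bar>t0\<bar>"] by (metis abs_ge_self abs_ge_zero abs_mult order_trans)
        moreover have "s0 * (real n - real n * \<delta>) \<le> s0 * (c powr p * powr_sum p n x)"
          using g(2) s0 by (intro mult_left_mono) auto
        ultimately have "t0 * (c * coord_sum n x) - s0 * (c powr p * powr_sum p n x) \<le> real n * H"
          by (simp add: H_def algebra_simps)
        then have "ptilt p n c t0 s0 x \<le> exp (real n * H)" by (simp add: ptilt_def)
        then show ?thesis using True by (auto intro!: ennreal_leI)
      qed simp
    qed
    also have "\<dots> = ennreal (exp (real n * H)) * emeasure (lborel_Rn n) G" by (simp add: nn_integral_cmult)
    finally have "ennreal (Q / 2) \<le> ennreal (exp (real n * H)) * emeasure (lborel_Rn n) G" using EG by simp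
    then have "ennreal (exp (- (real n * H))) * ennreal (Q / 2) \<le> ennreal (exp (- (real n * H))) * (ennreal (exp (real n * H)) * emeasure (lborel_Rn n) G)"
      by (rule mult_left_mono) simp
    also have "\<dots> = emeasure (lborel_Rn n) G"
      by (simp add: mult.assoc[symmetric] ennreal_mult[symmetric] exp_add[symmetric])
    also have "ennreal (exp (- (real n * H))) * ennreal (Q / 2) = ennreal (exp (real n * (L - H)) / (2 * c ^ n))"
      using Q0 by (simp add: ennreal_mult[symmetric] Q_def exp_diff exp_minus right_diff_distrib field_simps)
    also have "L - H = ln (Zf p t0 s0) - t0 * w + s0 - (\<bar>t0\<bar> + s0) * \<delta>" by (simp add: H_def L_def)
    finally show "ennreal (exp (real n * (ln (Zf p t0 s0) - t0 * w + s0 - (\<bar>t0\<bar> + s0) * \<delta>)) / (2 * c ^ n))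
     \<le> emeasure (lborel_Rn n) {x \<in> space (lborel_Rn n).
         \<bar>c * coord_sum n x - real n * w\<bar> \<le> real n * \<delta> \<and> \<bar>c powr p * powr_sum p n x - real n\<bar> \<le> real n * \<delta>}"
      unfolding G_def .
  qed
qed


section \<open>The large deviation principle\<close>


definition scaled_mean :: "real \<Rightarrow> nat \<Rightarrow> (nat \<Rightarrow> real) \<Rightarrow> real" where
  "scaled_mean p n x = scaled_proj p n (iota_dir n) x"

lemma scaled_mean_measurable [measurable]: "scaled_mean p n \<in> borel_measurable (lborel_Rn n)"
  unfolding scaled_mean_def scaled_proj_def by measurable

lemma lp_ball_sets [measurable]: "lp_ball n p \<in> sets (lborel_Rn n)"
  unfolding lp_ball_def by measurable

lemma scaled_mean_eq:
  assumes "n \<ge> 1"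
  shows "real n * scaled_mean p n x = real n powr (1/p) * coord_sum n x"
proof -
  have "scaled_mean p n x = real n powr (1/p) / sqrt (real n) * (coord_sum n x / sqrt (real n))"
    by (simp add: scaled_mean_def scaled_proj_def iota_dir_def powr_half_sqrt sum_divide_distrib)
  also have "\<dots> = real n powr (1/p) * coord_sum n x / (sqrt (real n) * sqrt (real n))"
    by (simp add: field_simps)
  also have "sqrt (real n) * sqrt (real n) = real n" by simp
  finally show ?thesis using assms by simp
qed

lemma root_powr: "p > 1 \<Longrightarrow> (real n powr (1/p)) powr p = real n"
  by (simp add: powr_powr)

lemma lp_ball_iff:
  assumes "n \<ge> 1" "p > 1"
  shows "x \<in> lp_ball n p \<longleftrightarrow> x \<in> space (lborel_Rn n) \<and> (real n powr (1/p)) powr p * powr_sum p n x \<le> real n"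
  using assms by (simp add: lp_ball_def root_powr)

section \<open>Slices of the ball and its volume\<close>

definition slice :: "real \<Rightarrow> nat \<Rightarrow> real set \<Rightarrow> (nat \<Rightarrow> real) set" where
  "slice p n A = {x \<in> lp_ball n p. scaled_mean p n x \<in> A}"

lemma slice_sets [measurable]:
  assumes [measurable]: "A \<in> sets borel"
  shows "slice p n A \<in> sets (lborel_Rn n)"
proof -
  have "slice p n A = lp_ball n p \<inter> (scaled_mean p n -` A \<inter> space (lborel_Rn n))"
    by (auto simp: slice_def lp_ball_def)
  also have "\<dots> \<in> sets (lborel_Rn n)" by measurable
  finally show ?thesis .
qed

text \<open>With the dilation \<open>n powr (1/p)\<close> the ball becomes the condition that the
  power sum is at most \<open>n\<close>, and the scaled mean becomes the coordinate average. The
  Chernoff exponent is therefore at least \<open>n * (b - s)\<close> on the slice.\<close>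

lemma slice_upper:
  assumes p: "p > 1" and n: "n \<ge> 1" and s: "s > 0" and [measurable]: "A \<in> sets borel"
    and A: "\<And>y. y \<in> A \<Longrightarrow> b \<le> t * y"
  shows "emeasure (lborel_Rn n) (slice p n A)
    \<le> ennreal (exp (real n * (ln (Zf p t s) + s - b)) / (real n powr (1/p)) ^ n)"
proof -
  have "emeasure (lborel_Rn n) (slice p n A)
    \<le> ennreal (exp (real n * (ln (Zf p t s) - (b - s))) / (real n powr (1/p)) ^ n)"
  proof (rule volume_chernoff[OF p s])
    fix x assume x: "x \<in> slice p n A"
    have "(real n powr (1/p)) powr p * powr_sum p n x \<le> real n"
      using x lp_ball_iff[OF n p] by (auto simp: slice_def)
    then have "s * ((real n powr (1/p)) powr p * powr_sum p n x) \<le> s * real n" using s by (intro mult_left_mono) auto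
    moreover have "real n * b \<le> t * (real n powr (1/p) * coord_sum n x)"
    proof -
      have "real n * b \<le> real n * (t * scaled_mean p n x)"
        using A x by (intro mult_left_mono) (auto simp: slice_def)
      also have "\<dots> = t * (real n powr (1/p) * coord_sum n x)"
        unfolding scaled_mean_eq[OF n, symmetric] by (rule mult.left_commute)
      finally show ?thesis .
    qed
    ultimately show "real n * (b - s) \<le> t * (real n powr (1/p) * coord_sum n x) - s * ((real n powr (1/p)) powr p * powr_sum p n x)"
      by (simp add: algebra_simps)
  qed (use n in auto)
  then show ?thesis by (simp add: algebra_simps)
qed

lemma slice_lower:
  assumes p: "p > 1" and w: "\<bar>w\<bar> < 1" and s0: "s0 > 0" and \<eta>: "\<eta> > 0"
    and mx: "\<And>t s. s > 0 \<Longrightarrow> t * w - s - ln (Zf p t s) \<le> t0 * w - s0 - ln (Zf p t0 s0)"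
  shows "\<exists>N\<ge>1. \<forall>n\<ge>N. ennreal (exp (real n * (- (t0 * w - s0 - ln (Zf p t0 s0)) - \<eta>)) / (2 * (real n powr (1/p)) ^ n))
    \<le> emeasure (lborel_Rn n) (slice p n {y. \<bar>y - w\<bar> < \<eta>})"
proof -
  \<comment> \<open>The contraction factor is \<open>exp (- h)\<close>; it moves the mean by at most
    \<open>h\<close> and costs \<open>n * h\<close> in the exponent. In \<open>\<delta>\<close>, the
    bound \<open>h * p\<close> ensures \<open>\<beta> powr p * (1 + \<delta>) \<le> 1\<close>, while
    the other two keep the spread of the mean and the cost
    \<open>(\<bar>t0\<bar> + s0) * \<delta>\<close> of removing the tilt at most
    \<open>\<eta>/4\<close>.\<close>
  define h where "h = min 1 \<eta> / 4"
  define \<delta> where "\<delta> = min (h * p) (min (\<eta>/4) (\<eta> / (4 * (\<bar>t0\<bar> + s0))))"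
  have h: "h > 0" "h \<le> \<eta> / 4" using \<eta> by (auto simp: h_def)
  have T: "\<bar>t0\<bar> + s0 > 0" using s0 by simp
  have \<delta>: "\<delta> > 0" "\<delta> \<le> h * p" "\<delta> \<le> \<eta>/4" "(\<bar>t0\<bar> + s0) * \<delta> \<le> \<eta>/4"
  proof -
    show "\<delta> > 0" using h p \<eta> T by (simp add: \<delta>_def)
    show "\<delta> \<le> h * p" unfolding \<delta>_def by (rule min.cobounded1)
    show "\<delta> \<le> \<eta>/4" unfolding \<delta>_def by (rule min.coboundedI2[OF min.cobounded1])
    have "\<delta> \<le> \<eta> / (4 * (\<bar>t0\<bar> + s0))" unfolding \<delta>_def by (rule min.coboundedI2[OF min.cobounded2])
    then show "(\<bar>t0\<bar> + s0) * \<delta> \<le> \<eta>/4" using T by (simp add: field_simps)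
  qed
  define \<beta> where "\<beta> = exp (- h)"
  have \<beta>: "\<beta> > 0" "\<beta> < 1" "1 - \<beta> \<le> h" "\<beta> powr p * (1 + \<delta>) \<le> 1"
  proof -
    show "\<beta> > 0" "\<beta> < 1" using h by (auto simp: \<beta>_def)
    show "1 - \<beta> \<le> h" using exp_ge_add_one_self[of "- h"] by (simp add: \<beta>_def)
    have "\<beta> powr p * (1 + \<delta>) \<le> exp (- (h * p)) * exp \<delta>"
      using exp_ge_add_one_self[of \<delta>] by (simp add: \<beta>_def exp_powr_real mult_left_mono)
    also have "\<dots> \<le> 1" using \<delta> by (simp add: exp_add[symmetric])
    finally show "\<beta> powr p * (1 + \<delta>) \<le> 1" .
  qed
  have "\<exists>N. \<forall>n\<ge>N. \<forall>c>0. ennreal (exp (real n * (ln (Zf p t0 s0) - t0 * w + s0 - (\<bar>t0\<bar> + s0) * \<delta>)) / (2 * c ^ n))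
     \<le> emeasure (lborel_Rn n) {x \<in> space (lborel_Rn n).
         \<bar>c * coord_sum n x - real n * w\<bar> \<le> real n * \<delta> \<and> \<bar>c powr p * powr_sum p n x - real n\<bar> \<le> real n * \<delta>}"
    by (rule volume_tilted_lower[OF p s0 \<delta>(1) first_order_conditions[OF p s0 mx]])
  then obtain N where N: "\<And>n c. n \<ge> N \<Longrightarrow> c > 0 \<Longrightarrow> ennreal (exp (real n * (ln (Zf p t0 s0) - t0 * w + s0 - (\<bar>t0\<bar> + s0) * \<delta>)) / (2 * c ^ n))
     \<le> emeasure (lborel_Rn n) {x \<in> space (lborel_Rn n).
         \<bar>c * coord_sum n x - real n * w\<bar> \<le> real n * \<delta> \<and> \<bar>c powr p * powr_sum p n x - real n\<bar> \<le> real n * \<delta>}" by meson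
  show ?thesis
  proof (intro exI[of _ "max N 1"] conjI allI impI)
    fix n assume "n \<ge> max N 1"
    then have n: "n \<ge> N" "n \<ge> 1" by auto
    define c where "c = real n powr (1/p)"
    have c: "c > 0" using n by (simp add: c_def)
    have cl: "c / \<beta> > 0" using c \<beta> by simp
    have "exp (real n * (- (t0 * w - s0 - ln (Zf p t0 s0)) - \<eta>)) / (2 * c ^ n)
      \<le> exp (real n * (ln (Zf p t0 s0) - t0 * w + s0 - (\<bar>t0\<bar> + s0) * \<delta>) - real n * h) / (2 * c ^ n)"
    proof (intro divide_right_mono)
      have "real n * (- (t0 * w - s0 - ln (Zf p t0 s0)) - \<eta>) \<le> real n * (ln (Zf p t0 s0) - t0 * w + s0 - (\<bar>t0\<bar> + s0) * \<delta> - h)"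
        using \<delta>(4) h \<eta> by (intro mult_left_mono) (auto simp: field_simps)
      then show "exp (real n * (- (t0 * w - s0 - ln (Zf p t0 s0)) - \<eta>)) \<le> exp (real n * (ln (Zf p t0 s0) - t0 * w + s0 - (\<bar>t0\<bar> + s0) * \<delta>) - real n * h)"
        by (simp add: right_diff_distrib)
    qed (use c in auto)
    \<comment> \<open>The contraction is carried out by enlarging the dilation from \<open>c\<close>
      to \<open>c / \<beta>\<close>; the factor \<open>\<beta> ^ n\<close> is exactly
      \<open>exp (- (real n * h))\<close>.\<close>
    also have "\<dots> = exp (real n * (ln (Zf p t0 s0) - t0 * w + s0 - (\<bar>t0\<bar> + s0) * \<delta>)) / (2 * (c / \<beta>) ^ n)"
    proof -
      have "exp (e - real n * h) = exp e * \<beta> ^ n" for e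
        by (simp add: \<beta>_def exp_of_nat_mult[symmetric] exp_add[symmetric])
      then show ?thesis by (simp add: power_divide)
    qed
    finally have "ennreal (exp (real n * (- (t0 * w - s0 - ln (Zf p t0 s0)) - \<eta>)) / (2 * c ^ n))
      \<le> ennreal (exp (real n * (ln (Zf p t0 s0) - t0 * w + s0 - (\<bar>t0\<bar> + s0) * \<delta>)) / (2 * (c / \<beta>) ^ n))"
      by (rule ennreal_leI)
    also have "\<dots> \<le> emeasure (lborel_Rn n) {x \<in> space (lborel_Rn n).
         \<bar>c / \<beta> * coord_sum n x - real n * w\<bar> \<le> real n * \<delta> \<and> \<bar>(c / \<beta>) powr p * powr_sum p n x - real n\<bar> \<le> real n * \<delta>}"
      by (rule N[OF n(1) cl])
    also have "\<dots> \<le> emeasure (lborel_Rn n) (slice p n {y. \<bar>y - w\<bar> < \<eta>})"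
    proof (rule emeasure_mono)
      show "{x \<in> space (lborel_Rn n). \<bar>c / \<beta> * coord_sum n x - real n * w\<bar> \<le> real n * \<delta> \<and>
         \<bar>(c / \<beta>) powr p * powr_sum p n x - real n\<bar> \<le> real n * \<delta>} \<subseteq> slice p n {y. \<bar>y - w\<bar> < \<eta>}"
      proof (intro subsetI; elim CollectE conjE)
        fix x assume x: "x \<in> space (lborel_Rn n)"
          and x1: "\<bar>c / \<beta> * coord_sum n x - real n * w\<bar> \<le> real n * \<delta>"
          and x2: "\<bar>(c / \<beta>) powr p * powr_sum p n x - real n\<bar> \<le> real n * \<delta>"
        have "(c / \<beta>) powr p * powr_sum p n x \<le> real n * (1 + \<delta>)" using x2 by (simp add: algebra_simps)
        then have "\<beta> powr p * ((c / \<beta>) powr p * powr_sum p n x) \<le> \<beta> powr p * (real n * (1 + \<delta>))"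
          by (intro mult_left_mono) auto
        also have "\<dots> \<le> real n * 1" using mult_left_mono[OF \<beta>(4), of "real n"] by (simp add: mult_ac)
        also have "\<beta> powr p * ((c / \<beta>) powr p * powr_sum p n x) = c powr p * powr_sum p n x"
          using \<beta> c by (simp add: powr_divide)
        finally have "x \<in> lp_ball n p" using lp_ball_iff[OF n(2) p] x by (simp add: c_def)
        moreover have "\<bar>scaled_mean p n x - w\<bar> < \<eta>"
        proof -
          have "c / \<beta> * coord_sum n x - real n * w = real n * (scaled_mean p n x / \<beta> - w)"
            using scaled_mean_eq[OF n(2), of p x] by (simp add: c_def algebra_simps)
          then have "real n * \<bar>scaled_mean p n x / \<beta> - w\<bar> \<le> real n * \<delta>" using x1 by (simp add: abs_mult)
          then have "\<bar>scaled_mean p n x / \<beta> - w\<bar> \<le> \<delta>" using n by simp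
          then have "\<beta> * \<bar>scaled_mean p n x / \<beta> - w\<bar> \<le> 1 * \<delta>" using \<beta> by (intro mult_mono) auto
          also have "\<beta> * \<bar>scaled_mean p n x / \<beta> - w\<bar> = \<bar>scaled_mean p n x - \<beta> * w\<bar>"
            using \<beta> by (subst abs_of_pos[OF \<beta>(1), symmetric]) (simp only: abs_mult[symmetric], simp add: algebra_simps)
          finally have "\<bar>scaled_mean p n x - \<beta> * w\<bar> \<le> \<eta>/4" using \<delta> by simp
          moreover have "\<bar>\<beta> * w - w\<bar> \<le> \<eta>/4"
          proof -
            have "\<bar>\<beta> * w - w\<bar> = (1 - \<beta>) * \<bar>w\<bar>"
              using \<beta> by (subst abs_of_nonneg[of "1 - \<beta>", symmetric]) (simp, simp only: abs_mult[symmetric], simp add: algebra_simps abs_minus_commute)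
            also have "\<dots> \<le> h * 1" using \<beta> w by (intro mult_mono) auto
            finally show ?thesis using h by simp
          qed
          ultimately show ?thesis using \<eta> by linarith
        qed
        ultimately show "x \<in> slice p n {y. \<bar>y - w\<bar> < \<eta>}" by (simp add: slice_def)
      qed
      have "{y. \<bar>y - w\<bar> < \<eta>} \<in> sets borel" by measurable
      then show "slice p n {y. \<bar>y - w\<bar> < \<eta>} \<in> sets (lborel_Rn n)" by measurable
    qed
    finally show "ennreal (exp (real n * (- (t0 * w - s0 - ln (Zf p t0 s0)) - \<eta>)) / (2 * (real n powr (1/p)) ^ n))
      \<le> emeasure (lborel_Rn n) (slice p n {y. \<bar>y - w\<bar> < \<eta>})" by (simp add: c_def)
  qed simp
qed

text \<open>Makes \<open>(0, 1/p)\<close> the explicit maximiser at \<open>w = 0\<close>, so that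
  \<open>slice_lower\<close> applies to central slices.\<close>

lemma maximiser_0:
  assumes p: "p > 1" and s: "s > 0"
  shows "t * 0 - s - ln (Zf p t s) \<le> 0 * 0 - 1/p - ln (Zf p 0 (1/p))"
  using rate_sup_upper[OF s, of t 0 "\<lambda>t s. ln (Zf p t s)" p]
    rate_sup_0_eq[OF p, of "\<lambda>t s. ln (Zf p t s)"] ln_Zf_ge_0[OF p]
  by (simp add: zero_ereal_def)

lemma slice_UNIV: "slice p n UNIV = lp_ball n p"
  by (simp add: slice_def)

lemma lp_ball_upper:
  assumes p: "p > 1" and n: "n \<ge> 1"
  shows "emeasure (lborel_Rn n) (lp_ball n p) \<le> ennreal (exp (real n * (ln (Zf p 0 (1/p)) + 1/p)) / (real n powr (1/p)) ^ n)"
  using slice_upper[OF p n, of "1/p" UNIV 0 0] p by (simp add: slice_UNIV)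

text \<open>The ball contains its central slice, whose lower bound has, up to \<open>\<eta>\<close>,
  the exponent of the Chernoff upper bound for the whole ball.\<close>

lemma lp_ball_lower:
  assumes p: "p > 1" and \<eta>: "\<eta> > 0"
  shows "\<exists>N\<ge>1. \<forall>n\<ge>N. ennreal (exp (real n * (ln (Zf p 0 (1/p)) + 1/p - \<eta>)) / (2 * (real n powr (1/p)) ^ n))
     \<le> emeasure (lborel_Rn n) (lp_ball n p)"
proof -
  have "1 / p > 0" using p by simp
  then obtain N where "N \<ge> 1" and N: "\<And>n. n \<ge> N \<Longrightarrow> ennreal (exp (real n * (- (0 * 0 - 1/p - ln (Zf p 0 (1/p))) - \<eta>)) / (2 * (real n powr (1/p)) ^ n))
    \<le> emeasure (lborel_Rn n) (slice p n {y. \<bar>y - 0\<bar> < \<eta>})"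
    using slice_lower[OF p _ _ \<eta> maximiser_0[OF p]] by auto
  have "emeasure (lborel_Rn n) (slice p n {y. \<bar>y - 0\<bar> < \<eta>}) \<le> emeasure (lborel_Rn n) (lp_ball n p)" for n
    by (rule emeasure_mono) (auto simp: slice_def)
  then show ?thesis using \<open>N \<ge> 1\<close> order_trans[OF N] by (intro exI[of _ N]) (auto simp: add.commute)
qed

section \<open>From volumes to probabilities and logarithmic limits\<close>

lemma prob_eq_slice:
  assumes "uniform_on_lp_ball M X n p" and [measurable]: "A \<in> sets borel"
  shows "emeasure M {\<omega> \<in> space M. scaled_mean p n (X \<omega>) \<in> A}
    = emeasure (lborel_Rn n) (slice p n A) / emeasure (lborel_Rn n) (lp_ball n p)"
proof -
  have X [measurable]: "X \<in> M \<rightarrow>\<^sub>M lborel_Rn n"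
    and d: "distr M (lborel_Rn n) X = uniform_measure (lborel_Rn n) (lp_ball n p)"
    using assms(1) by (auto simp: uniform_on_lp_ball_def)
  define B where "B = {x \<in> space (lborel_Rn n). scaled_mean p n x \<in> A}"
  have B [measurable]: "B \<in> sets (lborel_Rn n)" unfolding B_def by measurable
  have "{\<omega> \<in> space M. scaled_mean p n (X \<omega>) \<in> A} = X -` B \<inter> space M"
    using measurable_space[OF X] by (auto simp: B_def)
  then have "emeasure M {\<omega> \<in> space M. scaled_mean p n (X \<omega>) \<in> A} = emeasure (distr M (lborel_Rn n) X) B"
    by (simp add: emeasure_distr)
  also have "\<dots> = emeasure (lborel_Rn n) (lp_ball n p \<inter> B) / emeasure (lborel_Rn n) (lp_ball n p)"
    unfolding d by (rule emeasure_uniform_measure) measurable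
  also have "lp_ball n p \<inter> B = slice p n A" by (auto simp: B_def slice_def lp_ball_def)
  finally show ?thesis .
qed

text \<open>The constant of \<open>rate_sup\<close>, here in its second role as the exponent per
  coordinate of the ball volume after the factor \<open>(n powr (1/p)) ^ n\<close> is
  removed.\<close>

definition rate_const :: "real \<Rightarrow> real" where
  "rate_const p = 1/p + ln (Zf p 0 (1/p))"

text \<open>Quotient of the Chernoff bound for the slice and the lower bound for the ball. The
  powers of \<open>n\<close> cancel; the factor 2 and the loss \<open>\<eta>\<close> both come from
  the ball.\<close>

lemma prob_upper:
  assumes p: "p > 1" and s: "s > 0" and \<eta>: "\<eta> > 0" and A[measurable]: "A \<in> sets borel"
    and b: "\<And>y. y \<in> A \<Longrightarrow> b \<le> t * y"
    and u: "\<And>n. n \<ge> 1 \<Longrightarrow> uniform_on_lp_ball (M n) (X n) n p"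
  shows "\<exists>N\<ge>1. \<forall>n\<ge>N. emeasure (M n) {\<omega> \<in> space (M n). scaled_mean p n (X n \<omega>) \<in> A}
      \<le> ennreal (2 * exp (- (real n * (b - s - ln (Zf p t s) + rate_const p - \<eta>))))"
proof -
  obtain N where N: "N \<ge> 1" "\<And>n. n \<ge> N \<Longrightarrow> ennreal (exp (real n * (ln (Zf p 0 (1/p)) + 1/p - \<eta>)) / (2 * (real n powr (1/p)) ^ n))
     \<le> emeasure (lborel_Rn n) (lp_ball n p)" using lp_ball_lower[OF p \<eta>] by auto
  show ?thesis
  proof (intro exI[of _ N] conjI allI impI N(1))
    fix n assume nN: "n \<ge> N"
    then have n: "n \<ge> 1" using N by simp
    define c where "c = (real n powr (1/p)) ^ n"
    have c: "c > 0" using n by (simp add: c_def)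
    define r where "r = 2 * exp (- (real n * (b - s - ln (Zf p t s) + rate_const p - \<eta>)))"
    have "emeasure (lborel_Rn n) (slice p n A) / emeasure (lborel_Rn n) (lp_ball n p) \<le> ennreal r"
    proof (rule divide_le_posI_ennreal)
      have pos: "0 < ennreal (exp (real n * (ln (Zf p 0 (1/p)) + 1/p - \<eta>)) / (2 * c))" using c by simp
      also have "\<dots> \<le> emeasure (lborel_Rn n) (lp_ball n p)" using N(2)[OF nN] by (simp add: c_def)
      finally show "0 < emeasure (lborel_Rn n) (lp_ball n p)" .
      have "emeasure (lborel_Rn n) (slice p n A) \<le> ennreal (exp (real n * (ln (Zf p t s) + s - b)) / c)"
        unfolding c_def by (rule slice_upper[OF p n s A b])
      also have "exp (real n * (ln (Zf p t s) + s - b)) / c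
         = r * (exp (real n * (ln (Zf p 0 (1/p)) + 1/p - \<eta>)) / (2 * c))"
        by (simp add: r_def rate_const_def exp_add[symmetric] algebra_simps)
      also have "ennreal \<dots> = ennreal r * ennreal (exp (real n * (ln (Zf p 0 (1/p)) + 1/p - \<eta>)) / (2 * c))"
        using c by (intro ennreal_mult) (auto simp: r_def)
      also have "\<dots> \<le> ennreal r * emeasure (lborel_Rn n) (lp_ball n p)"
        using N(2)[OF nN] by (intro mult_left_mono) (auto simp: c_def)
      finally show "emeasure (lborel_Rn n) (slice p n A) \<le> emeasure (lborel_Rn n) (lp_ball n p) * ennreal r"
        by (simp add: mult.commute)
    qed
    then show "emeasure (M n) {\<omega> \<in> space (M n). scaled_mean p n (X n \<omega>) \<in> A}
      \<le> ennreal (2 * exp (- (real n * (b - s - ln (Zf p t s) + rate_const p - \<eta>))))"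
      using prob_eq_slice[OF u[OF n] A] by (simp add: r_def)
  qed
qed

lemma prob_lower:
  assumes p: "p > 1" and w: "\<bar>w\<bar> < 1" and s0: "s0 > 0" and \<eta>: "\<eta> > 0"
    and mx: "\<And>t s. s > 0 \<Longrightarrow> t * w - s - ln (Zf p t s) \<le> t0 * w - s0 - ln (Zf p t0 s0)"
    and A[measurable]: "A \<in> sets borel" and sub: "{y. \<bar>y - w\<bar> < \<eta>} \<subseteq> A"
    and u: "\<And>n. n \<ge> 1 \<Longrightarrow> uniform_on_lp_ball (M n) (X n) n p"
  shows "\<exists>N\<ge>1. \<forall>n\<ge>N. ennreal (1/2 * exp (- (real n * (t0 * w - s0 - ln (Zf p t0 s0) + rate_const p + \<eta>))))
     \<le> emeasure (M n) {\<omega> \<in> space (M n). scaled_mean p n (X n \<omega>) \<in> A}"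
proof -
  obtain N where N: "N \<ge> 1" "\<And>n. n \<ge> N \<Longrightarrow> ennreal (exp (real n * (- (t0 * w - s0 - ln (Zf p t0 s0)) - \<eta>)) / (2 * (real n powr (1/p)) ^ n))
    \<le> emeasure (lborel_Rn n) (slice p n {y. \<bar>y - w\<bar> < \<eta>})" using slice_lower[OF p w s0 \<eta> mx] by auto
  show ?thesis
  proof (intro exI[of _ N] conjI allI impI N(1))
    fix n assume nN: "n \<ge> N"
    then have n: "n \<ge> 1" using N by simp
    define c where "c = (real n powr (1/p)) ^ n"
    have c: "c > 0" using n by (simp add: c_def)
    define r where "r = 1/2 * exp (- (real n * (t0 * w - s0 - ln (Zf p t0 s0) + rate_const p + \<eta>)))"
    define V where "V = emeasure (lborel_Rn n) (lp_ball n p)"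
    have V: "V \<le> ennreal (exp (real n * (ln (Zf p 0 (1/p)) + 1/p)) / c)"
      unfolding V_def c_def by (rule lp_ball_upper[OF p n])
    have le: "ennreal (exp (real n * (- (t0 * w - s0 - ln (Zf p t0 s0)) - \<eta>)) / (2 * c)) \<le> emeasure (lborel_Rn n) (slice p n A)"
    proof (rule order_trans[OF N(2)[OF nN, folded c_def]])
      show "emeasure (lborel_Rn n) (slice p n {y. \<bar>y - w\<bar> < \<eta>}) \<le> emeasure (lborel_Rn n) (slice p n A)"
        using sub by (intro emeasure_mono) (auto simp: slice_def)
    qed
    have "emeasure (lborel_Rn n) (slice p n A) \<le> V"
      unfolding V_def by (intro emeasure_mono) (auto simp: slice_def)
    moreover have "0 < ennreal (exp (real n * (- (t0 * w - s0 - ln (Zf p t0 s0)) - \<eta>)) / (2 * c))" using c by simp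
    ultimately have V0: "V \<noteq> 0" using le by (metis less_le_trans not_less_zero)
    have Vt: "V < top" using V by (auto simp: top_unique intro: le_less_trans)
    have "ennreal r * V \<le> ennreal r * ennreal (exp (real n * (ln (Zf p 0 (1/p)) + 1/p)) / c)"
      by (intro mult_left_mono V) simp
    also have "\<dots> = ennreal (r * (exp (real n * (ln (Zf p 0 (1/p)) + 1/p)) / c))"
      using c by (intro ennreal_mult[symmetric]) (auto simp: r_def)
    also have "r * (exp (real n * (ln (Zf p 0 (1/p)) + 1/p)) / c)
       = exp (real n * (- (t0 * w - s0 - ln (Zf p t0 s0)) - \<eta>)) / (2 * c)"
      by (simp add: r_def rate_const_def exp_add[symmetric] algebra_simps)
    also note le
    finally have "\<not> emeasure (lborel_Rn n) (slice p n A) < ennreal r * V" by simp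
    then have "\<not> emeasure (lborel_Rn n) (slice p n A) / V < ennreal r"
      using divide_less_ennreal[OF V0 Vt] by simp
    then show "ennreal (1/2 * exp (- (real n * (t0 * w - s0 - ln (Zf p t0 s0) + rate_const p + \<eta>))))
     \<le> emeasure (M n) {\<omega> \<in> space (M n). scaled_mean p n (X n \<omega>) \<in> A}"
      using prob_eq_slice[OF u[OF n] A] by (simp add: r_def V_def)
  qed
qed

lemma elog_mono: "x \<le> y \<Longrightarrow> elog x \<le> elog y"
proof (cases x; cases y)
  fix a b assume xy: "x \<le> y" and *: "0 \<le> a" "x = ennreal a" "0 \<le> b" "y = ennreal b"
  then have "a \<le> b" by simp
  then show ?thesis using * by (cases "a = 0") (auto simp: elog_def)
qed (auto simp: elog_def top_unique)

lemma limsup_log_le: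
  assumes "\<And>\<eta>. \<eta> > 0 \<Longrightarrow> \<exists>N\<ge>1. \<forall>n\<ge>N. P n \<le> ennreal (k * exp (- (real n * (a - \<eta>))))" and k: "k > 0"
  shows "limsup (\<lambda>n. ereal (1 / real n) * elog (P n)) \<le> ereal (- a)"
proof (rule ereal_le_epsilon2)
  fix e :: real assume e: "e > 0"
  obtain N where N: "N \<ge> 1" "\<And>n. n \<ge> N \<Longrightarrow> P n \<le> ennreal (k * exp (- (real n * (a - e/2))))"
    using assms(1)[of "e/2"] e by auto
  have "(\<lambda>n. ln k / real n) \<longlonglongrightarrow> 0" by (rule lim_const_over_n)
  then have ev: "\<forall>\<^sub>F n in sequentially. ln k / real n < e/2" using e by (intro order_tendstoD(2)) auto
  show "limsup (\<lambda>n. ereal (1 / real n) * elog (P n)) \<le> ereal (- a) + ereal e"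
  proof (rule Limsup_bounded)
    show "\<forall>\<^sub>F n in sequentially. ereal (1 / real n) * elog (P n) \<le> ereal (- a) + ereal e"
      using ev eventually_ge_at_top[of N]
    proof eventually_elim
      case (elim n)
      then have n: "n \<ge> 1" using N by simp
      have "elog (P n) \<le> elog (ennreal (k * exp (- (real n * (a - e/2)))))"
        using N(2) elim by (intro elog_mono) auto
      also have "\<dots> = ereal (ln k - real n * (a - e/2))" using k by (subst elog_ennreal) (auto simp: ln_mult)
      finally have "ereal (1 / real n) * elog (P n) \<le> ereal (1 / real n) * ereal (ln k - real n * (a - e/2))"
        by (intro ereal_mult_left_mono) auto
      also have "\<dots> = ereal (ln k / real n - (a - e/2))" using n by (simp add: diff_divide_distrib)
      also have "\<dots> \<le> ereal (- a + e)" unfolding ereal_less_eq using elim by linarith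
      finally show ?case by simp
    qed
  qed
qed

lemma liminf_log_ge:
  assumes "\<And>\<eta>. \<eta> > 0 \<Longrightarrow> \<exists>N\<ge>1. \<forall>n\<ge>N. ennreal (k * exp (- (real n * (a + \<eta>)))) \<le> P n" and k: "k > 0"
  shows "ereal (- a) \<le> liminf (\<lambda>n. ereal (1 / real n) * elog (P n))"
proof (rule ereal_le_epsilon2)
  fix e :: real assume e: "e > 0"
  obtain N where N: "N \<ge> 1" "\<And>n. n \<ge> N \<Longrightarrow> ennreal (k * exp (- (real n * (a + e/2)))) \<le> P n"
    using assms(1)[of "e/2"] e by auto
  have "(\<lambda>n. ln k / real n) \<longlonglongrightarrow> 0" by (rule lim_const_over_n)
  then have ev: "\<forall>\<^sub>F n in sequentially. - (e/2) < ln k / real n" using e by (intro order_tendstoD(1)) auto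
  have "ereal (- a - e) \<le> liminf (\<lambda>n. ereal (1 / real n) * elog (P n))"
  proof (rule Liminf_bounded)
    show "\<forall>\<^sub>F n in sequentially. ereal (- a - e) \<le> ereal (1 / real n) * elog (P n)"
      using ev eventually_ge_at_top[of N]
    proof eventually_elim
      case (elim n)
      then have n: "n \<ge> 1" using N by simp
      have "ereal (- a - e) \<le> ereal (ln k / real n - (a + e/2))" using elim by simp
      also have "\<dots> = ereal (1 / real n) * ereal (ln k - real n * (a + e/2))" using n by (simp add: diff_divide_distrib)
      also have "ereal (ln k - real n * (a + e/2)) = elog (ennreal (k * exp (- (real n * (a + e/2)))))"
        using k by (subst elog_ennreal) (auto simp: ln_mult)
      also have "ereal (1 / real n) * \<dots> \<le> ereal (1 / real n) * elog (P n)"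
        using N(2) elim by (intro ereal_mult_left_mono elog_mono) auto
      finally show ?case .
    qed
  qed
  then have "ereal (- a - e) + ereal e \<le> liminf (\<lambda>n. ereal (1 / real n) * elog (P n)) + ereal e"
    by (rule add_right_mono)
  then show "ereal (- a) \<le> liminf (\<lambda>n. ereal (1 / real n) * elog (P n)) + ereal e" by simp
qed

section \<open>Regularity of the rate function\<close>

lemma I_cr_upper:
  assumes "p > 1" "s > 0"
  shows "ereal (t * w - s - ln (Zf p t s) + rate_const p) \<le> I_cr p w"
  unfolding I_cr_eq[OF assms(1)] rate_const_def by (rule rate_sup_upper[OF assms(2)])

lemma I_cr_least:
  assumes "p > 1" "\<And>t s. s > 0 \<Longrightarrow> ereal (t * w - s - ln (Zf p t s) + rate_const p) \<le> c"
  shows "I_cr p w \<le> c"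
  unfolding I_cr_eq[OF assms(1)] by (rule rate_sup_least) (use assms(2) in \<open>simp add: rate_const_def\<close>)

lemma I_cr_nonneg:
  assumes "p > 1"
  shows "0 \<le> I_cr p w"
  using I_cr_upper[OF assms, of "1/p" 0 w] assms by (simp add: rate_const_def zero_ereal_def)

text \<open>A supremum of affine functions of \<open>w\<close> has intersections of closed
  half-lines (or trivial sets) as sublevel sets, which gives closedness and convexity at
  once.\<close>

lemma I_cr_sublevel:
  assumes "p > 1"
  shows "{w. I_cr p w \<le> c} = (\<Inter>(t, s) \<in> UNIV \<times> {0<..}. {w. ereal (t * w - s - ln (Zf p t s) + rate_const p) \<le> c})"
proof (intro set_eqI iffI)
  fix w assume "w \<in> {w. I_cr p w \<le> c}"
  then show "w \<in> (\<Inter>(t, s) \<in> UNIV \<times> {0<..}. {w. ereal (t * w - s - ln (Zf p t s) + rate_const p) \<le> c})"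
    using order_trans[OF I_cr_upper[OF assms]] by auto
next
  fix w assume "w \<in> (\<Inter>(t, s) \<in> UNIV \<times> {0<..}. {w. ereal (t * w - s - ln (Zf p t s) + rate_const p) \<le> c})"
  then show "w \<in> {w. I_cr p w \<le> c}" using I_cr_least[OF assms, of w c] by auto
qed

lemma I_cr_sublevel_closed:
  assumes "p > 1"
  shows "closed {w. I_cr p w \<le> c}"
  unfolding I_cr_sublevel[OF assms] case_prod_unfold
  by (intro closed_INT ballI closed_Collect_le continuous_intros continuous_on_ereal)

lemma I_cr_sublevel_convex:
  assumes "p > 1"
  shows "convex {w. I_cr p w \<le> ereal c}"
proof -
  have "convex {w. ereal (t * w - s - ln (Zf p t s) + rate_const p) \<le> ereal c}" for t s
  proof -
    have "{w. ereal (t * w - s - ln (Zf p t s) + rate_const p) \<le> ereal c}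
      = {w. t \<bullet> w \<le> c + s + ln (Zf p t s) - rate_const p}" by (auto simp: algebra_simps)
    then show ?thesis using convex_halfspace_le[of t] by simp
  qed
  then show ?thesis unfolding I_cr_sublevel[OF assms] case_prod_unfold by (intro convex_INT) auto
qed

lemma I_cr_minus_le:
  assumes "p > 1"
  shows "I_cr p (- w) \<le> I_cr p w"
proof (rule I_cr_least[OF assms])
  fix t s :: real assume "s > 0"
  then show "ereal (t * - w - s - ln (Zf p t s) + rate_const p) \<le> I_cr p w"
    using I_cr_upper[OF assms, of s "- t" w] by (simp add: Zf_minus)
qed

lemma I_cr_minus: "p > 1 \<Longrightarrow> I_cr p (- w) = I_cr p w"
  using I_cr_minus_le[of p w] I_cr_minus_le[of p "- w"] by (intro antisym) auto

text \<open>The convex sublevel set at height \<open>I_cr p w\<close> contains both 0 and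
  \<open>w\<close>. This lets endpoints be approached from inside without raising the rate.\<close>

lemma I_cr_scale_le:
  assumes p: "p > 1" and \<theta>: "0 \<le> \<theta>" "\<theta> \<le> 1"
  shows "I_cr p (\<theta> * w) \<le> I_cr p w"
proof (cases "I_cr p w")
  case (real c)
  have "0 \<in> {w. I_cr p w \<le> ereal c}" using I_cr_I_qu_0(1)[OF p] I_cr_nonneg[OF p, of w] real by simp
  moreover have "w \<in> {w. I_cr p w \<le> ereal c}" using real by simp
  ultimately have "(1 - \<theta>) *\<^sub>R 0 + \<theta> *\<^sub>R w \<in> {w. I_cr p w \<le> ereal c}"
    using I_cr_sublevel_convex[OF p] \<theta> by (intro convexD) auto
  then show ?thesis using real by simp
next
  case MInf
  then show ?thesis using I_cr_nonneg[OF p, of w] by simp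
qed simp

text \<open>Evaluating at \<open>(t, s) = (p * s, s)\<close>, where \<open>p * y - \<bar>y\<bar> powr p\<close> is largest at \<open>y = 1\<close>, and
  letting \<open>s\<close> grow.\<close>
lemma I_cr_infinite:
  assumes p: "p > 1" and w: "\<bar>w\<bar> > 1"
  shows "I_cr p w = \<infinity>"
proof -
  have main: "I_cr p w = \<infinity>" if w: "w > 1" for w
  proof -
    \<comment> \<open>The gap between \<open>\<bar>y\<bar> powr p\<close> and its tangent at
      \<open>y = 1\<close>; Young's inequality with second factor 1 shows that it is
      nonnegative.\<close>
    define \<phi> where "\<phi> y = \<bar>y\<bar> powr p - 1 - p * (y - 1)" for y :: real
    have \<phi>: "\<phi> y \<ge> 0" for y
    proof -
      have "\<bar>y\<bar> * 1 \<le> \<bar>y\<bar> powr p / p + 1 powr (p / (p - 1)) / (p / (p - 1))"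
        using p by (intro Youngs_inequality) (auto simp: field_simps)
      then have "p * (\<bar>y\<bar> * 1) \<le> p * (\<bar>y\<bar> powr p / p + 1 powr (p / (p - 1)) / (p / (p - 1)))"
        using p by (intro mult_left_mono) auto
      also have "\<dots> = \<bar>y\<bar> powr p + (p - 1)" using p by (simp add: field_simps)
      finally have "p * \<bar>y\<bar> \<le> \<bar>y\<bar> powr p + (p - 1)" by simp
      moreover have "p * y \<le> p * \<bar>y\<bar>" using p by simp
      ultimately show ?thesis by (simp add: \<phi>_def algebra_simps)
    qed
    have e: "tilt p (p * s) s y = exp ((p - 1) * s) * exp (- (s * \<phi> y))" for s y
      by (simp add: tilt_def \<phi>_def exp_add[symmetric] algebra_simps)
    \<comment> \<open>For \<open>s \<ge> 1\<close> the gap term is dominated by its value at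
      \<open>s = 1\<close>, so \<open>ln Zf\<close> grows with slope at most \<open>p - 1\<close>.
      The objective \<open>t * w - s\<close> has slope \<open>p * w - 1\<close>, which leaves the
      net slope \<open>p * (w - 1) > 0\<close>.\<close>
    have Zle: "ln (Zf p (p * s) s) \<le> (p - 1) * s + (ln (Zf p p 1) - (p - 1))" if s: "s \<ge> 1" for s
    proof -
      have "tilt p (p * s) s y \<le> exp ((p - 1) * s - (p - 1)) * tilt p p 1 y" for y
      proof -
        have "exp (- (s * \<phi> y)) \<le> exp (- (1 * \<phi> y))" using mult_right_mono[OF s \<phi>[of y]] by simp
        then have "tilt p (p * s) s y \<le> exp ((p - 1) * s) * exp (- (1 * \<phi> y))" unfolding e by simp
        also have "\<dots> = exp ((p - 1) * s - (p - 1)) * (exp ((p - 1) * 1) * exp (- (1 * \<phi> y)))"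
          by (simp add: exp_add[symmetric])
        finally show ?thesis using e[of 1 y] by simp
      qed
      then have "Zf p (p * s) s \<le> (\<integral>y. exp ((p - 1) * s - (p - 1)) * tilt p p 1 y \<partial>lborel)"
        unfolding Zf_def using s by (intro integral_mono tilt_integrable integrable_mult_right p) auto
      then have "Zf p (p * s) s \<le> exp ((p - 1) * s - (p - 1)) * Zf p p 1" by (simp add: Zf_def)
      then have "ln (Zf p (p * s) s) \<le> ln (exp ((p - 1) * s - (p - 1)) * Zf p p 1)"
        using Zf_pos[OF p] s by (subst ln_le_cancel_iff) auto
      then show ?thesis using Zf_pos[OF p, of 1 p] by (simp add: ln_mult)
    qed
    define C where "C = ln (Zf p p 1) - (p - 1) - rate_const p"
    have ge: "ereal (p * s * (w - 1) - C) \<le> I_cr p w" if s: "s \<ge> 1" for s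
    proof -
      have "p * s * (w - 1) - C \<le> p * s * w - s - ln (Zf p (p * s) s) + rate_const p"
        using Zle[OF s] by (simp add: C_def algebra_simps)
      then show ?thesis using I_cr_upper[OF p, of s "p * s" w] s
        by (meson ereal_less_eq(3) less_le_trans order_trans zero_less_one)
    qed
    have "ereal r \<le> I_cr p w" for r
    proof -
      define s where "s = max 1 ((r + C) / (p * (w - 1)))"
      have "(r + C) / (p * (w - 1)) \<le> s" by (simp add: s_def)
      then have "r \<le> p * s * (w - 1) - C" using p w by (simp add: field_simps)
      then have "ereal r \<le> ereal (p * s * (w - 1) - C)" by simp
      also have "\<dots> \<le> I_cr p w" by (rule ge) (simp add: s_def)
      finally show ?thesis .
    qed
    then show ?thesis by (rule ereal_top)
  qed
  show ?thesis
  proof (cases "w > 0")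
    case True
    then show ?thesis using main w by simp
  next
    case False
    then show ?thesis using main[of "- w"] w I_cr_minus[OF p, of w] by simp
  qed
qed

lemma I_cr_good:
  assumes p: "p > 1"
  shows "good_rate_function (I_cr p)"
proof -
  have "compact {w. I_cr p w \<le> ereal c}" for c
  proof -
    have "{w. I_cr p w \<le> ereal c} \<subseteq> {-1..1}"
    proof
      fix w assume "w \<in> {w. I_cr p w \<le> ereal c}"
      then have "I_cr p w \<noteq> \<infinity>" by auto
      then have "\<not> \<bar>w\<bar> > 1" using I_cr_infinite[OF p] by blast
      then show "w \<in> {-1..1}" by auto
    qed
    then have "bounded {w. I_cr p w \<le> ereal c}" using bounded_closed_interval bounded_subset by blast
    then show ?thesis using I_cr_sublevel_closed[OF p] compact_eq_bounded_closed by blast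
  qed
  then show ?thesis
    using I_cr_nonneg[OF p] I_cr_sublevel_closed[OF p]
    by (simp add: good_rate_function_def rate_function_def lower_semicont_def)
qed

section \<open>The large deviation bounds\<close>

text \<open>Points with \<open>\<bar>v\<bar> < 1\<close> have a maximiser and are handled directly.
  A point of modulus 1 is replaced by \<open>\<theta> * w\<close>, still in \<open>G\<close> and
  strictly inside, where the rate is no larger; outside \<open>[-1, 1]\<close> the rate is
  infinite.\<close>

lemma LDP_lower:
  assumes p: "p > 1" and u: "\<And>n. n \<ge> 1 \<Longrightarrow> uniform_on_lp_ball (M n) (X n) n p" and G: "open G" and w: "w \<in> G"
  shows "- I_cr p w \<le> liminf (\<lambda>n. ereal (1 / real n) * elog (emeasure (M n) {\<omega> \<in> space (M n). scaled_mean p n (X n \<omega>) \<in> G}))"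
    (is "_ \<le> ?L")
proof -
  have inner: "- I_cr p v \<le> ?L" if v: "v \<in> G" "\<bar>v\<bar> < 1" for v
  proof -
    obtain t0 s0 where s0: "s0 > 0" and
      mx: "\<And>t s. s > 0 \<Longrightarrow> t * v - s - ln (Zf p t s) \<le> t0 * v - s0 - ln (Zf p t0 s0)"
      using legendre_attained[OF p v(2) ln_Zf_continuous[OF p] order_refl] by meson
    obtain r where r: "r > 0" "ball v r \<subseteq> G" using G v by (meson open_contains_ball)
    have "ereal (- (t0 * v - s0 - ln (Zf p t0 s0) + rate_const p)) \<le> ?L"
    proof (rule liminf_log_ge[where k = "1/2"])
      fix \<eta> :: real assume \<eta>: "\<eta> > 0"
      have m: "min \<eta> r > 0" using \<eta> r by simp
      have sub: "{y. \<bar>y - v\<bar> < min \<eta> r} \<subseteq> G" using r by (auto simp: dist_real_def abs_minus_commute)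
      have G': "G \<in> sets borel" using G by simp
      obtain N where N: "N \<ge> 1" "\<And>n. n \<ge> N \<Longrightarrow> ennreal (1/2 * exp (- (real n * (t0 * v - s0 - ln (Zf p t0 s0) + rate_const p + min \<eta> r))))
         \<le> emeasure (M n) {\<omega> \<in> space (M n). scaled_mean p n (X n \<omega>) \<in> G}"
        using prob_lower[OF p v(2) s0 m mx G' sub u] by blast
      show "\<exists>N\<ge>1. \<forall>n\<ge>N. ennreal (1/2 * exp (- (real n * (t0 * v - s0 - ln (Zf p t0 s0) + rate_const p + \<eta>))))
         \<le> emeasure (M n) {\<omega> \<in> space (M n). scaled_mean p n (X n \<omega>) \<in> G}"
      proof (intro exI[of _ N] conjI allI impI N(1))
        fix n assume n: "n \<ge> N"
        have "real n * (t0 * v - s0 - ln (Zf p t0 s0) + rate_const p + min \<eta> r)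
           \<le> real n * (t0 * v - s0 - ln (Zf p t0 s0) + rate_const p + \<eta>)" by (intro mult_left_mono) auto
        then show "ennreal (1/2 * exp (- (real n * (t0 * v - s0 - ln (Zf p t0 s0) + rate_const p + \<eta>))))
         \<le> emeasure (M n) {\<omega> \<in> space (M n). scaled_mean p n (X n \<omega>) \<in> G}"
          by (intro order_trans[OF _ N(2)[OF n]] ennreal_leI) simp
      qed
    qed simp
    moreover have "ereal (t0 * v - s0 - ln (Zf p t0 s0) + rate_const p) \<le> I_cr p v" by (rule I_cr_upper[OF p s0])
    then have "- I_cr p v \<le> ereal (- (t0 * v - s0 - ln (Zf p t0 s0) + rate_const p))"
      unfolding uminus_ereal.simps(1)[symmetric] by (rule ereal_minus_le_minus[THEN iffD2])
    ultimately show ?thesis by (rule order_trans[rotated])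
  qed
  show ?thesis
  proof (cases "\<bar>w\<bar> > 1")
    case True
    then show ?thesis using I_cr_infinite[OF p] by simp
  next
    case False
    obtain r where r: "r > 0" "ball w r \<subseteq> G" using G w by (meson open_contains_ball)
    define \<theta> where "\<theta> = 1 - min 1 r / 2"
    have \<theta>: "0 \<le> \<theta>" "\<theta> < 1" using r by (auto simp: \<theta>_def)
    have "\<bar>w - \<theta> * w\<bar> = (1 - \<theta>) * \<bar>w\<bar>"
    proof -
      have "w - \<theta> * w = (1 - \<theta>) * w" by (simp add: algebra_simps)
      then show ?thesis using \<theta> by (simp add: abs_mult)
    qed
    also have "\<dots> \<le> (1 - \<theta>) * 1" using False \<theta> by (intro mult_left_mono) auto
    also have "\<dots> < r" using r by (simp add: \<theta>_def)
    finally have "\<theta> * w \<in> G" using r by (auto simp: dist_real_def)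
    moreover have "\<bar>\<theta> * w\<bar> < 1"
    proof -
      have "\<bar>\<theta> * w\<bar> = \<theta> * \<bar>w\<bar>" using \<theta> by (simp add: abs_mult)
      also have "\<dots> \<le> \<theta> * 1" using False \<theta> by (intro mult_left_mono) auto
      finally show ?thesis using \<theta> by simp
    qed
    ultimately have "- I_cr p (\<theta> * w) \<le> ?L" by (rule inner)
    moreover have "- I_cr p w \<le> - I_cr p (\<theta> * w)" using I_cr_scale_le[OF p \<theta>(1)] \<theta> by simp
    ultimately show ?thesis by (rule order_trans[rotated])
  qed
qed

text \<open>If \<open>x\<close> has the smallest modulus \<open>b\<close> in \<open>C\<close>, then
  \<open>C\<close> is contained in the two tails beyond \<open>b\<close> and \<open>- b\<close>. By
  evenness of \<open>Zf\<close> both tails obey the same Chernoff bound, for each fixed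
  \<open>(t, s)\<close>; the supremum over \<open>(t, s)\<close> then gives
  \<open>I_cr p b = I_cr p x\<close>, so no covering argument is needed.\<close>

lemma LDP_upper:
  assumes p: "p > 1" and u: "\<And>n. n \<ge> 1 \<Longrightarrow> uniform_on_lp_ball (M n) (X n) n p" and C: "closed C"
  shows "limsup (\<lambda>n. ereal (1 / real n) * elog (emeasure (M n) {\<omega> \<in> space (M n). scaled_mean p n (X n \<omega>) \<in> C})) \<le> - (INF x\<in>C. I_cr p x)"
    (is "?L \<le> _")
proof (cases "C = {}")
  case True
  have "?L \<le> - \<infinity>"
  proof (rule Limsup_bounded)
    show "\<forall>\<^sub>F n in sequentially. ereal (1 / real n) * elog (emeasure (M n) {\<omega> \<in> space (M n). scaled_mean p n (X n \<omega>) \<in> C}) \<le> - \<infinity>"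
      \<comment> \<open>The index 0 is excluded because \<open>1 / 0 = 0\<close>, and 0 times minus
        infinity is 0 instead of minus infinity.\<close>
      using eventually_gt_at_top[of 0] by eventually_elim (simp add: True elog_def)
  qed
  then show ?thesis by (simp add: True)
next
  case False
  obtain x where x: "x \<in> C" "\<And>y. y \<in> C \<Longrightarrow> dist 0 x \<le> dist 0 y"
    using distance_attains_inf[OF C False, of 0] by blast
  define b where "b = \<bar>x\<bar>"
  have b: "\<bar>y\<bar> \<ge> b" if "y \<in> C" for y using x(2)[OF that] by (simp add: b_def)
  have Ib: "I_cr p b = I_cr p x" using I_cr_minus[OF p, of x] by (simp add: b_def abs_if)
  have "I_cr p b \<le> - ?L"
  proof (rule I_cr_least[OF p])
    fix t s :: real assume s: "s > 0"
    \<comment> \<open>Both tail bounds need a slope pointing outwards, hence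
      \<open>\<bar>t\<bar>\<close>; since \<open>b \<ge> 0\<close>, this only increases the
      exponent.\<close>
    define a where "a = \<bar>t\<bar> * b - s - ln (Zf p t s) + rate_const p"
    have Zt: "Zf p \<bar>t\<bar> s = Zf p t s" "Zf p (- \<bar>t\<bar>) s = Zf p t s" by (auto simp: abs_if Zf_minus)
    have "?L \<le> ereal (- a)"
    proof (rule limsup_log_le[where k = 4])
      fix \<eta> :: real assume \<eta>: "\<eta> > 0"
      have y1: "\<bar>t\<bar> * b \<le> \<bar>t\<bar> * y" if "y \<in> {b..}" for y using that by (intro mult_left_mono) auto
      have y2: "\<bar>t\<bar> * b \<le> - \<bar>t\<bar> * y" if "y \<in> {..-b}" for y
        using that mult_left_mono[of b "- y" "\<bar>t\<bar>"] by auto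
      obtain N1 where N1: "N1 \<ge> 1" "\<And>n. n \<ge> N1 \<Longrightarrow> emeasure (M n) {\<omega> \<in> space (M n). scaled_mean p n (X n \<omega>) \<in> {b..}}
         \<le> ennreal (2 * exp (- (real n * (a - \<eta>))))"
        using prob_upper[where A = "{b..}", OF p s \<eta> _ y1 u] unfolding a_def Zt by auto
      obtain N2 where N2: "N2 \<ge> 1" "\<And>n. n \<ge> N2 \<Longrightarrow> emeasure (M n) {\<omega> \<in> space (M n). scaled_mean p n (X n \<omega>) \<in> {..-b}}
         \<le> ennreal (2 * exp (- (real n * (a - \<eta>))))"
        using prob_upper[where A = "{..-b}", OF p s \<eta> _ y2 u] unfolding a_def Zt by auto
      show "\<exists>N\<ge>1. \<forall>n\<ge>N. emeasure (M n) {\<omega> \<in> space (M n). scaled_mean p n (X n \<omega>) \<in> C} \<le> ennreal (4 * exp (- (real n * (a - \<eta>))))"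
      proof (intro exI[of _ "max N1 N2"] conjI allI impI)
        fix n assume n: "n \<ge> max N1 N2"
        then have "n \<ge> 1" using N1 by simp
        then have [measurable]: "X n \<in> M n \<rightarrow>\<^sub>M lborel_Rn n" using u by (simp add: uniform_on_lp_ball_def)
        have "emeasure (M n) {\<omega> \<in> space (M n). scaled_mean p n (X n \<omega>) \<in> C}
          \<le> emeasure (M n) ({\<omega> \<in> space (M n). scaled_mean p n (X n \<omega>) \<in> {b..}} \<union> {\<omega> \<in> space (M n). scaled_mean p n (X n \<omega>) \<in> {..-b}})"
        proof (rule emeasure_mono)
          show "{\<omega> \<in> space (M n). scaled_mean p n (X n \<omega>) \<in> C} \<subseteq> {\<omega> \<in> space (M n). scaled_mean p n (X n \<omega>) \<in> {b..}} \<union> {\<omega> \<in> space (M n). scaled_mean p n (X n \<omega>) \<in> {..-b}}"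
          proof
            fix \<omega> assume "\<omega> \<in> {\<omega> \<in> space (M n). scaled_mean p n (X n \<omega>) \<in> C}"
            then have \<omega>: "\<omega> \<in> space (M n)" "b \<le> \<bar>scaled_mean p n (X n \<omega>)\<bar>" using b by auto
            then have "b \<le> scaled_mean p n (X n \<omega>) \<or> scaled_mean p n (X n \<omega>) \<le> - b" by linarith
            then show "\<omega> \<in> {\<omega> \<in> space (M n). scaled_mean p n (X n \<omega>) \<in> {b..}} \<union> {\<omega> \<in> space (M n). scaled_mean p n (X n \<omega>) \<in> {..-b}}"
              using \<omega>(1) by auto
          qed
        qed measurable
        also have "\<dots> \<le> emeasure (M n) {\<omega> \<in> space (M n). scaled_mean p n (X n \<omega>) \<in> {b..}} + emeasure (M n) {\<omega> \<in> space (M n). scaled_mean p n (X n \<omega>) \<in> {..-b}}"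
          by (rule emeasure_subadditive) measurable
        also have "\<dots> \<le> ennreal (2 * exp (- (real n * (a - \<eta>)))) + ennreal (2 * exp (- (real n * (a - \<eta>))))"
          using n by (intro add_mono N1(2) N2(2)) auto
        also have "\<dots> = ennreal (4 * exp (- (real n * (a - \<eta>))))"
          by (subst ennreal_plus[symmetric]) auto
        finally show "emeasure (M n) {\<omega> \<in> space (M n). scaled_mean p n (X n \<omega>) \<in> C} \<le> ennreal (4 * exp (- (real n * (a - \<eta>))))" .
      qed (use N1 in auto)
    qed simp
    then have "ereal a \<le> - ?L" by (subst ereal_minus_le_minus[symmetric]) simp
    moreover have "t * b \<le> \<bar>t\<bar> * b" by (intro mult_right_mono) (auto simp: b_def)
    then have "ereal (t * b - s - ln (Zf p t s) + rate_const p) \<le> ereal a" by (simp add: a_def)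
    ultimately show "ereal (t * b - s - ln (Zf p t s) + rate_const p) \<le> - ?L" by (rule order_trans[rotated])
  qed
  moreover have "(INF x\<in>C. I_cr p x) \<le> I_cr p b" unfolding Ib by (rule INF_lower[OF x(1)])
  ultimately have "(INF x\<in>C. I_cr p x) \<le> - ?L" by simp
  then show ?thesis by (subst ereal_minus_le_minus[symmetric]) simp
qed

theorem theorem2p9:
  fixes p :: real
    and M :: "nat \<Rightarrow> 'w measure"
    and X :: "nat \<Rightarrow> 'w \<Rightarrow> nat \<Rightarrow> real"
  assumes "1 < p"
    and "\<And>n. n \<ge> 1 \<Longrightarrow> prob_space (M n)"
    and "\<And>n. n \<ge> 1 \<Longrightarrow> uniform_on_lp_ball (M n) (X n) n p"
  shows "satisfies_LDP M (\<lambda>n \<omega>. scaled_proj p n (iota_dir n) (X n \<omega>)) (\<lambda>n. real n) (I_cr p)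
    \<and> quasiconvex (I_cr p) \<and> symmetric_fun (I_cr p) \<and> good_rate_function (I_cr p)
    \<and> (\<forall>w\<in>{-1<..<1}.
         (p > 2 \<longrightarrow> I_qu p (mu 2) w \<ge> I_cr p w \<and> (I_qu p (mu 2) w = I_cr p w \<longleftrightarrow> w = 0)) \<and>
         (p = 2 \<longrightarrow> I_qu p (mu 2) w = I_cr p w) \<and>
         (p < 2 \<longrightarrow> I_qu p (mu 2) w \<le> I_cr p w \<and> (I_qu p (mu 2) w = I_cr p w \<longleftrightarrow> w = 0)))"
proof (intro conjI ballI)
  note p = assms(1) and u = assms(3)
  have X [measurable]: "X n \<in> M n \<rightarrow>\<^sub>M lborel_Rn n" if "n \<ge> 1" for n
    using u[OF that] by (simp add: uniform_on_lp_ball_def)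
  show "good_rate_function (I_cr p)" by (rule I_cr_good[OF p])
  show "symmetric_fun (I_cr p)" using I_cr_minus[OF p] by (simp add: symmetric_fun_def)
  show "quasiconvex (I_cr p)"
  proof -
    have "I_cr p w \<noteq> - \<infinity>" for w using I_cr_nonneg[OF p, of w] by auto
    then show ?thesis unfolding quasiconvex_def using I_cr_sublevel_convex[OF p] by simp
  qed
  show "satisfies_LDP M (\<lambda>n \<omega>. scaled_proj p n (iota_dir n) (X n \<omega>)) (\<lambda>n. real n) (I_cr p)"
    unfolding satisfies_LDP_def scaled_mean_def[symmetric]
  proof (intro conjI ballI allI impI)
    fix n :: nat assume n: "n \<ge> 1"
    show "prob_space (M n)" by (rule assms(2)[OF n])
    show "(\<lambda>\<omega>. scaled_mean p n (X n \<omega>)) \<in> borel_measurable (M n)"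
      by (rule measurable_compose[OF X[OF n] scaled_mean_measurable])
  next
    show "rate_function (I_cr p)" using I_cr_good[OF p] by (simp add: good_rate_function_def)
  next
    fix \<Gamma> :: "real set" assume "\<Gamma> \<in> sets borel"
    define P where "P n A = ereal (1 / real n) * elog (emeasure (M n) {\<omega> \<in> space (M n). scaled_mean p n (X n \<omega>) \<in> A})" for n A
    have "(INF x\<in>interior \<Gamma>. I_cr p x) \<ge> - liminf (\<lambda>n. P n (interior \<Gamma>))"
    proof (rule INF_greatest)
      fix w assume "w \<in> interior \<Gamma>"
      then have "- I_cr p w \<le> liminf (\<lambda>n. P n (interior \<Gamma>))"
        unfolding P_def by (intro LDP_lower[OF p u]) auto
      then show "- liminf (\<lambda>n. P n (interior \<Gamma>)) \<le> I_cr p w"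
        by (subst ereal_minus_le_minus[symmetric]) simp
    qed
    then show "- (INF x\<in>interior \<Gamma>. I_cr p x) \<le> liminf (\<lambda>n. ereal (1 / real n) *
       elog (emeasure (M n) {\<omega> \<in> space (M n). scaled_mean p n (X n \<omega>) \<in> interior \<Gamma>}))"
      unfolding P_def by (subst ereal_minus_le_minus[symmetric]) simp
    show "limsup (\<lambda>n. ereal (1 / real n) * elog (emeasure (M n) {\<omega> \<in> space (M n). scaled_mean p n (X n \<omega>) \<in> closure \<Gamma>}))
       \<le> - (INF x\<in>closure \<Gamma>. I_cr p x)"
      by (rule LDP_upper[OF p u]) auto
    have "liminf (\<lambda>n. P n (interior \<Gamma>)) \<le> limsup (\<lambda>n. P n (interior \<Gamma>))"
      by (rule Liminf_le_Limsup) simp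
    also have "\<dots> \<le> limsup (\<lambda>n. P n (closure \<Gamma>))"
    proof (rule Limsup_mono)
      \<comment> \<open>The comparison is made for \<open>n \<ge> 1\<close> only: \<open>X 0\<close>
        is unconstrained, and monotonicity of the measure needs the larger event to be
        measurable.\<close>
      show "\<forall>\<^sub>F n in sequentially. P n (interior \<Gamma>) \<le> P n (closure \<Gamma>)"
        using eventually_ge_at_top[of 1]
      proof eventually_elim
        case (elim n)
        note [measurable] = X[OF elim]
        have [measurable]: "closure \<Gamma> \<in> sets borel" by simp
        have "emeasure (M n) {\<omega> \<in> space (M n). scaled_mean p n (X n \<omega>) \<in> interior \<Gamma>}
          \<le> emeasure (M n) {\<omega> \<in> space (M n). scaled_mean p n (X n \<omega>) \<in> closure \<Gamma>}"
        proof (rule emeasure_mono)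
          show "{\<omega> \<in> space (M n). scaled_mean p n (X n \<omega>) \<in> closure \<Gamma>} \<in> sets (M n)" by measurable
        qed (use interior_subset closure_subset in blast)
        then show ?case unfolding P_def by (intro ereal_mult_left_mono elog_mono) auto
      qed
    qed
    finally show "liminf (\<lambda>n. ereal (1 / real n) * elog (emeasure (M n) {\<omega> \<in> space (M n). scaled_mean p n (X n \<omega>) \<in> interior \<Gamma>}))
       \<le> limsup (\<lambda>n. ereal (1 / real n) * elog (emeasure (M n) {\<omega> \<in> space (M n). scaled_mean p n (X n \<omega>) \<in> closure \<Gamma>}))"
      unfolding P_def .
  qed
next
  fix w :: real assume "w \<in> {-1<..<1}"
  then have w: "\<bar>w\<bar> < 1" by auto
  show "p > 2 \<longrightarrow> I_qu p (mu 2) w \<ge> I_cr p w \<and> (I_qu p (mu 2) w = I_cr p w \<longleftrightarrow> w = 0)"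
    using I_qu_I_cr_gt_2[OF _ w] by blast
  show "p = 2 \<longrightarrow> I_qu p (mu 2) w = I_cr p w" using I_qu_I_cr_2 by blast
  show "p < 2 \<longrightarrow> I_qu p (mu 2) w \<le> I_cr p w \<and> (I_qu p (mu 2) w = I_cr p w \<longleftrightarrow> w = 0)"
    using I_qu_I_cr_less_2[OF assms(1) _ w] by blast
qed

end
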